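(* Let $\mathbf{k}$ be an arbitrary commutative ring and let $\mathfrak{g}$ be the associated Lie algebra of a (right) pre-Lie algebra over $\mathbf{k}$. Then: (i) (Pre-Lie graded PBW theorem) $U\mathfrak{g}$ is a filtered Hopf algebra such that the canonical map $\operatorname{Sym}\mathfrak{g} \to \operatorname{gr} U\mathfrak{g}$ is an isomorphism. (ii) (Pre-Lie quantum PBW theorem) The canonical map in (i) lifts to a coalgebra isomorphism $\operatorname{Sym}\mathfrak{g} \to U\mathfrak{g}$ (that is, there is a filtered coalgebra isomorphism $\operatorname{Sym}\mathfrak{g}\to U\mathfrak{g}$ whose associated graded map is the canonical map $\operatorname{Sym}\mathfrak{g}\to\operatorname{gr}U\mathfrak{g}$).
   Context: A (right) pre-Lie algebra over $\mathbf{k}$ is a $\mathbf{k}$-module $\mathfrak{g}$ (no freeness or flatness is assumed) with a $\mathbf{k}$-bilinear operation $\circ:\mathfrak{g}\otimes\mathfrak{g}\to\mathfrak{g}$ such that $x\circ(y\circ z)-(x\circ y)\circ z = x\circ(z\circ y)-(x\circ z)\circ y$ for all $x,y,z$. Its associated Lie algebra is $\mathfrak{g}$ with the bracket $\{x,y\}:=x\circ y-y\circ x$. All tensor products, tensor algebras $T\mathfrak{g}$ and symmetric algebras $\operatorname{Sym}\mathfrak{g}$ are over $\mathbf{k}$. The universal enveloping algebra is $U\mathfrak{g}=T\mathfrak{g}/(xy-yx-\{x,y\})_{x,y\in\mathfrak{g}}$, with the filtration whose $n$-th piece is the image of $\bigoplus_{i\le n}\mathfrak{g}^{\otimes i}$.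 The canonical map $\operatorname{Sym}\mathfrak{g}\to\operatorname{gr}U\mathfrak{g}$ is the (surjective) algebra map induced by $\mathfrak{g}\to U\mathfrak{g}$. Both $\operatorname{Sym}\mathfrak{g}$ and $U\mathfrak{g}$ carry the standard coproduct $\Delta$, the algebra homomorphism with $\Delta(x)=1\otimes x+x\otimes 1$ for $x\in\mathfrak{g}$, and the standard counit. *)

theory Defs
  imports "HOL-Algebra.Module" "HOL-Algebra.QuotRing"
begin

text \<open>
  All modules and algebras are records of type \<^type>\<open>module\<close>. For a plain module the fields
  \<^const>\<open>mult\<close> and \<^const>\<open>one\<close> are ignored; for a pre-Lie algebra (a Lie algebra) the field
  \<^const>\<open>mult\<close> is the pre-Lie product (the bracket) and \<^const>\<open>one\<close> is ignored.
\<close>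

section \<open>Pre-Lie algebras\<close>

locale prelie_algebra = module +
  assumes prod_closed:
      "\<lbrakk>x \<in> carrier M; y \<in> carrier M\<rbrakk> \<Longrightarrow> x \<otimes>\<^bsub>M\<^esub> y \<in> carrier M"
    and prod_l_distr:
      "\<lbrakk>x \<in> carrier M; y \<in> carrier M; z \<in> carrier M\<rbrakk> \<Longrightarrow>
       (x \<oplus>\<^bsub>M\<^esub> y) \<otimes>\<^bsub>M\<^esub> z = (x \<otimes>\<^bsub>M\<^esub> z) \<oplus>\<^bsub>M\<^esub> (y \<otimes>\<^bsub>M\<^esub> z)"
    and prod_r_distr:
      "\<lbrakk>x \<in> carrier M; y \<in> carrier M; z \<in> carrier M\<rbrakk> \<Longrightarrow>
       x \<otimes>\<^bsub>M\<^esub> (y \<oplus>\<^bsub>M\<^esub> z) = (x \<otimes>\<^bsub>M\<^esub> y) \<oplus>\<^bsub>M\<^esub> (x \<otimes>\<^bsub>M\<^esub> z)"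
    and prod_smult_l:
      "\<lbrakk>c \<in> carrier R; x \<in> carrier M; y \<in> carrier M\<rbrakk> \<Longrightarrow>
       (c \<odot>\<^bsub>M\<^esub> x) \<otimes>\<^bsub>M\<^esub> y = c \<odot>\<^bsub>M\<^esub> (x \<otimes>\<^bsub>M\<^esub> y)"
    and prod_smult_r:
      "\<lbrakk>c \<in> carrier R; x \<in> carrier M; y \<in> carrier M\<rbrakk> \<Longrightarrow>
       x \<otimes>\<^bsub>M\<^esub> (c \<odot>\<^bsub>M\<^esub> y) = c \<odot>\<^bsub>M\<^esub> (x \<otimes>\<^bsub>M\<^esub> y)"
    and prelie_identity:
      "\<lbrakk>x \<in> carrier M; y \<in> carrier M; z \<in> carrier M\<rbrakk> \<Longrightarrow>
       x \<otimes>\<^bsub>M\<^esub> (y \<otimes>\<^bsub>M\<^esub> z) \<ominus>\<^bsub>M\<^esub> (x \<otimes>\<^bsub>M\<^esub> y) \<otimes>\<^bsub>M\<^esub> z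
       = x \<otimes>\<^bsub>M\<^esub> (z \<otimes>\<^bsub>M\<^esub> y) \<ominus>\<^bsub>M\<^esub> (x \<otimes>\<^bsub>M\<^esub> z) \<otimes>\<^bsub>M\<^esub> y"

definition assoc_lie :: "('k, 'g, 'm) module_scheme \<Rightarrow> ('k, 'g, 'm) module_scheme" where
  "assoc_lie G = G\<lparr>mult := (\<lambda>x y. (x \<otimes>\<^bsub>G\<^esub> y) \<ominus>\<^bsub>G\<^esub> (y \<otimes>\<^bsub>G\<^esub> x))\<rparr>"

section \<open>Linear algebra over a commutative ring\<close>

definition ground_alg :: "('k, 'r) ring_scheme \<Rightarrow> ('k, 'k) module" where
  "ground_alg R = \<lparr>carrier = carrier R, mult = mult R, one = one R,
     zero = zero R, add = add R, smult = mult R\<rparr>"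

definition lin_hom :: "('k, 'r) ring_scheme \<Rightarrow> ('k, 'a, 'm) module_scheme \<Rightarrow>
    ('k, 'b, 'n) module_scheme \<Rightarrow> ('a \<Rightarrow> 'b) set" where
  "lin_hom R M N = {h \<in> carrier M \<rightarrow> carrier N.
     (\<forall>x\<in>carrier M. \<forall>y\<in>carrier M. h (x \<oplus>\<^bsub>M\<^esub> y) = h x \<oplus>\<^bsub>N\<^esub> h y) \<and>
     (\<forall>c\<in>carrier R. \<forall>x\<in>carrier M. h (c \<odot>\<^bsub>M\<^esub> x) = c \<odot>\<^bsub>N\<^esub> h x)}"

text \<open>The library's \<^locale>\<open>algebra\<close> is restricted to commutative algebras.\<close>

definition assoc_algebra :: "('k, 'r) ring_scheme \<Rightarrow> ('k, 'a, 'm) module_scheme \<Rightarrow> bool" where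
  "assoc_algebra R A \<longleftrightarrow> module R A \<and> ring A \<and>
     (\<forall>c\<in>carrier R. \<forall>x\<in>carrier A. \<forall>y\<in>carrier A.
        (c \<odot>\<^bsub>A\<^esub> x) \<otimes>\<^bsub>A\<^esub> y = c \<odot>\<^bsub>A\<^esub> (x \<otimes>\<^bsub>A\<^esub> y) \<and>
        x \<otimes>\<^bsub>A\<^esub> (c \<odot>\<^bsub>A\<^esub> y) = c \<odot>\<^bsub>A\<^esub> (x \<otimes>\<^bsub>A\<^esub> y))"

definition alg_hom :: "('k, 'r) ring_scheme \<Rightarrow> ('k, 'a, 'm) module_scheme \<Rightarrow>
    ('k, 'b, 'n) module_scheme \<Rightarrow> ('a \<Rightarrow> 'b) set" where
  "alg_hom R A B = ring_hom A B \<inter> lin_hom R A B"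

definition alg_iso :: "('k, 'r) ring_scheme \<Rightarrow> ('k, 'a, 'm) module_scheme \<Rightarrow>
    ('k, 'b, 'n) module_scheme \<Rightarrow> ('a \<Rightarrow> 'b) set" where
  "alg_iso R A B = {h \<in> alg_hom R A B. bij_betw h (carrier A) (carrier B)}"

definition submodule_span :: "('k, 'r) ring_scheme \<Rightarrow> ('k, 'a, 'm) module_scheme \<Rightarrow>
    'a set \<Rightarrow> 'a set" where
  "submodule_span R M X = \<Inter>{N. submodule N R M \<and> X \<subseteq> N}"

text \<open>
  The quotient of a module by a submodule; when the submodule is a two-sided ideal of an algebra,
  this is the quotient algebra (\<^const>\<open>FactRing\<close> with scalar multiplication).
\<close>

definition quot_alg :: "('k, 'a, 'm) module_scheme \<Rightarrow> 'a set \<Rightarrow> ('k, 'a set) module" where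
  "quot_alg A I = \<lparr>carrier = a_rcosets\<^bsub>A\<^esub> I, mult = rcoset_mult A I, one = I +>\<^bsub>A\<^esub> \<one>\<^bsub>A\<^esub>,
     zero = I, add = set_add A, smult = (\<lambda>c X. \<Union>x\<in>X. I +>\<^bsub>A\<^esub> (c \<odot>\<^bsub>A\<^esub> x))\<rparr>"

text \<open>
  The free module on the carrier of a monoid (finitely supported functions vanishing off the
  carrier), with the convolution product.
\<close>

definition monoid_alg :: "('k, 'r) ring_scheme \<Rightarrow> ('s, 'n) monoid_scheme \<Rightarrow>
    ('k, 's \<Rightarrow> 'k) module" where
  "monoid_alg R S = \<lparr>
     carrier = {f. (\<forall>s. f s \<in> carrier R) \<and> finite {s. f s \<noteq> \<zero>\<^bsub>R\<^esub>} \<and>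
                   {s. f s \<noteq> \<zero>\<^bsub>R\<^esub>} \<subseteq> carrier S},
     mult = (\<lambda>f g s. \<Oplus>\<^bsub>R\<^esub>p\<in>{(a, b). f a \<noteq> \<zero>\<^bsub>R\<^esub> \<and> g b \<noteq> \<zero>\<^bsub>R\<^esub> \<and> a \<otimes>\<^bsub>S\<^esub> b = s}.
               f (fst p) \<otimes>\<^bsub>R\<^esub> g (snd p)),
     one = (\<lambda>s. if s = \<one>\<^bsub>S\<^esub> then \<one>\<^bsub>R\<^esub> else \<zero>\<^bsub>R\<^esub>),
     zero = (\<lambda>s. \<zero>\<^bsub>R\<^esub>),
     add = (\<lambda>f g s. f s \<oplus>\<^bsub>R\<^esub> g s),
     smult = (\<lambda>c f s. c \<otimes>\<^bsub>R\<^esub> f s)\<rparr>"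

definition basis_elt :: "('k, 'r) ring_scheme \<Rightarrow> 's \<Rightarrow> 's \<Rightarrow> 'k" where
  "basis_elt R s = (\<lambda>t. if t = s then \<one>\<^bsub>R\<^esub> else \<zero>\<^bsub>R\<^esub>)"

section \<open>Tensor products\<close>

definition bilinear_rels :: "('k, 'r) ring_scheme \<Rightarrow> ('k, 'a, 'm) module_scheme \<Rightarrow>
    ('k, 'b, 'n) module_scheme \<Rightarrow> ('a \<times> 'b \<Rightarrow> 'k) set" where
  "bilinear_rels R A B = (let F = monoid_alg R (A \<times>\<times> B); e = (\<lambda>a b. basis_elt R (a, b)) in
     {e (a \<oplus>\<^bsub>A\<^esub> a') b \<ominus>\<^bsub>F\<^esub> (e a b \<oplus>\<^bsub>F\<^esub> e a' b) | a a' b.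
        a \<in> carrier A \<and> a' \<in> carrier A \<and> b \<in> carrier B} \<union>
     {e a (b \<oplus>\<^bsub>B\<^esub> b') \<ominus>\<^bsub>F\<^esub> (e a b \<oplus>\<^bsub>F\<^esub> e a b') | a b b'.
        a \<in> carrier A \<and> b \<in> carrier B \<and> b' \<in> carrier B} \<union>
     {e (c \<odot>\<^bsub>A\<^esub> a) b \<ominus>\<^bsub>F\<^esub> (c \<odot>\<^bsub>F\<^esub> e a b) | c a b.
        c \<in> carrier R \<and> a \<in> carrier A \<and> b \<in> carrier B} \<union>
     {e a (c \<odot>\<^bsub>B\<^esub> b) \<ominus>\<^bsub>F\<^esub> (c \<odot>\<^bsub>F\<^esub> e a b) | c a b.
        c \<in> carrier R \<and> a \<in> carrier A \<and> b \<in> carrier B})"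

definition tensor_rels :: "('k, 'r) ring_scheme \<Rightarrow> ('k, 'a, 'm) module_scheme \<Rightarrow>
    ('k, 'b, 'n) module_scheme \<Rightarrow> ('a \<times> 'b \<Rightarrow> 'k) set" where
  "tensor_rels R A B = submodule_span R (monoid_alg R (A \<times>\<times> B)) (bilinear_rels R A B)"

text \<open>
  The underlying module depends only on the module structures. If both factors are algebras,
  the relations form an ideal and the product is $(a \otimes b)(a' \otimes b') = aa' \otimes bb'$.
\<close>

definition tensor :: "('k, 'r) ring_scheme \<Rightarrow> ('k, 'a, 'm) module_scheme \<Rightarrow>
    ('k, 'b, 'n) module_scheme \<Rightarrow> ('k, ('a \<times> 'b \<Rightarrow> 'k) set) module" where
  "tensor R A B = quot_alg (monoid_alg R (A \<times>\<times> B)) (tensor_rels R A B)"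

definition pure_tensor :: "('k, 'r) ring_scheme \<Rightarrow> ('k, 'a, 'm) module_scheme \<Rightarrow>
    ('k, 'b, 'n) module_scheme \<Rightarrow> 'a \<Rightarrow> 'b \<Rightarrow> ('a \<times> 'b \<Rightarrow> 'k) set" where
  "pure_tensor R A B a b = tensor_rels R A B +>\<^bsub>monoid_alg R (A \<times>\<times> B)\<^esub> basis_elt R (a, b)"

text \<open>
  The linear map $a \otimes b \mapsto \beta(a, b)$ into \<open>P\<close> induced by a bilinear map \<open>\<beta>\<close>,
  computed on a representative of the coset.
\<close>

definition tensor_lift :: "('k, 'r) ring_scheme \<Rightarrow> ('k, 'p, 'm) module_scheme \<Rightarrow>
    ('a \<Rightarrow> 'b \<Rightarrow> 'p) \<Rightarrow> ('a \<times> 'b \<Rightarrow> 'k) set \<Rightarrow> 'p" where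
  "tensor_lift R P \<beta> X = (let f = (SOME f. f \<in> X) in
     \<Oplus>\<^bsub>P\<^esub>p\<in>{p. f p \<noteq> \<zero>\<^bsub>R\<^esub>}. f p \<odot>\<^bsub>P\<^esub> \<beta> (fst p) (snd p))"

definition tensor_map :: "('k, 'r) ring_scheme \<Rightarrow> ('k, 'c, 'm) module_scheme \<Rightarrow>
    ('k, 'd, 'n) module_scheme \<Rightarrow> ('a \<Rightarrow> 'c) \<Rightarrow> ('b \<Rightarrow> 'd) \<Rightarrow>
    ('a \<times> 'b \<Rightarrow> 'k) set \<Rightarrow> ('c \<times> 'd \<Rightarrow> 'k) set" where
  "tensor_map R C D f g = tensor_lift R (tensor R C D) (\<lambda>a b. pure_tensor R C D (f a) (g b))"

text \<open>The associator $(A \otimes B) \otimes C \to A \otimes (B \otimes C)$.\<close>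

definition tensor_assoc :: "('k, 'r) ring_scheme \<Rightarrow> ('k, 'a, 'm) module_scheme \<Rightarrow>
    ('k, 'b, 'n) module_scheme \<Rightarrow> ('k, 'c, 'l) module_scheme \<Rightarrow>
    (('a \<times> 'b \<Rightarrow> 'k) set \<times> 'c \<Rightarrow> 'k) set \<Rightarrow> ('a \<times> ('b \<times> 'c \<Rightarrow> 'k) set \<Rightarrow> 'k) set" where
  "tensor_assoc R A B C = (let P = tensor R A (tensor R B C) in
     tensor_lift R P (\<lambda>t c. tensor_lift R P
       (\<lambda>a b. pure_tensor R A (tensor R B C) a (pure_tensor R B C b c)) t))"

section \<open>Filtered coalgebras and filtered Hopf algebras\<close>

definition coalgebra :: "('k, 'r) ring_scheme \<Rightarrow> ('k, 'c, 'm) module_scheme \<Rightarrow>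
    ('c \<Rightarrow> ('c \<times> 'c \<Rightarrow> 'k) set) \<Rightarrow> ('c \<Rightarrow> 'k) \<Rightarrow> bool" where
  "coalgebra R C \<Delta> \<epsilon> \<longleftrightarrow> module R C \<and>
     \<Delta> \<in> lin_hom R C (tensor R C C) \<and> \<epsilon> \<in> lin_hom R C (ground_alg R) \<and>
     (\<forall>x\<in>carrier C.
        tensor_assoc R C C C (tensor_map R (tensor R C C) C \<Delta> id (\<Delta> x))
          = tensor_map R C (tensor R C C) id \<Delta> (\<Delta> x) \<and>
        tensor_lift R C (\<lambda>a b. \<epsilon> a \<odot>\<^bsub>C\<^esub> b) (\<Delta> x) = x \<and>
        tensor_lift R C (\<lambda>a b. \<epsilon> b \<odot>\<^bsub>C\<^esub> a) (\<Delta> x) = x)"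

definition bialgebra :: "('k, 'r) ring_scheme \<Rightarrow> ('k, 'a, 'm) module_scheme \<Rightarrow>
    ('a \<Rightarrow> ('a \<times> 'a \<Rightarrow> 'k) set) \<Rightarrow> ('a \<Rightarrow> 'k) \<Rightarrow> bool" where
  "bialgebra R A \<Delta> \<epsilon> \<longleftrightarrow> assoc_algebra R A \<and> coalgebra R A \<Delta> \<epsilon> \<and>
     \<Delta> \<in> alg_hom R A (tensor R A A) \<and> \<epsilon> \<in> alg_hom R A (ground_alg R)"

definition is_antipode :: "('k, 'r) ring_scheme \<Rightarrow> ('k, 'a, 'm) module_scheme \<Rightarrow>
    ('a \<Rightarrow> ('a \<times> 'a \<Rightarrow> 'k) set) \<Rightarrow> ('a \<Rightarrow> 'k) \<Rightarrow> ('a \<Rightarrow> 'a) \<Rightarrow> bool" where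
  "is_antipode R A \<Delta> \<epsilon> S \<longleftrightarrow> S \<in> lin_hom R A A \<and>
     (\<forall>x\<in>carrier A.
        tensor_lift R A (\<lambda>a b. S a \<otimes>\<^bsub>A\<^esub> b) (\<Delta> x) = \<epsilon> x \<odot>\<^bsub>A\<^esub> \<one>\<^bsub>A\<^esub> \<and>
        tensor_lift R A (\<lambda>a b. a \<otimes>\<^bsub>A\<^esub> S b) (\<Delta> x) = \<epsilon> x \<odot>\<^bsub>A\<^esub> \<one>\<^bsub>A\<^esub>)"

text \<open>Filtrations are ascending, indexed by \<^typ>\<open>nat\<close> and exhaustive.\<close>

definition module_filtration :: "('k, 'r) ring_scheme \<Rightarrow> ('k, 'a, 'm) module_scheme \<Rightarrow>
    (nat \<Rightarrow> 'a set) \<Rightarrow> bool" where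
  "module_filtration R M F \<longleftrightarrow>
     (\<forall>n. submodule (F n) R M \<and> F n \<subseteq> F (Suc n)) \<and> (\<Union>n. F n) = carrier M"

definition filtered_algebra :: "('k, 'r) ring_scheme \<Rightarrow> ('k, 'a, 'm) module_scheme \<Rightarrow>
    (nat \<Rightarrow> 'a set) \<Rightarrow> bool" where
  "filtered_algebra R A F \<longleftrightarrow> assoc_algebra R A \<and> module_filtration R A F \<and> \<one>\<^bsub>A\<^esub> \<in> F 0 \<and>
     (\<forall>m n. \<forall>x\<in>F m. \<forall>y\<in>F n. x \<otimes>\<^bsub>A\<^esub> y \<in> F (m + n))"

text \<open>
  The $n$-th piece of the filtration of a tensor square is the sum of the images of
  $F_i \otimes F_j$ with $i + j = n$; these maps need not be injective.
\<close>

definition tensor_filtration :: "('k, 'r) ring_scheme \<Rightarrow> ('k, 'a, 'm) module_scheme \<Rightarrow>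
    (nat \<Rightarrow> 'a set) \<Rightarrow> nat \<Rightarrow> ('a \<times> 'a \<Rightarrow> 'k) set set" where
  "tensor_filtration R A F n = submodule_span R (tensor R A A)
     {pure_tensor R A A a b | a b i j. i + j = n \<and> a \<in> F i \<and> b \<in> F j}"

definition filtered_coalgebra :: "('k, 'r) ring_scheme \<Rightarrow> ('k, 'c, 'm) module_scheme \<Rightarrow>
    ('c \<Rightarrow> ('c \<times> 'c \<Rightarrow> 'k) set) \<Rightarrow> ('c \<Rightarrow> 'k) \<Rightarrow> (nat \<Rightarrow> 'c set) \<Rightarrow> bool" where
  "filtered_coalgebra R C \<Delta> \<epsilon> F \<longleftrightarrow> coalgebra R C \<Delta> \<epsilon> \<and> module_filtration R C F \<and>
     (\<forall>n. \<Delta> ` F n \<subseteq> tensor_filtration R C F n)"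

definition filtered_hopf_algebra :: "('k, 'r) ring_scheme \<Rightarrow> ('k, 'a, 'm) module_scheme \<Rightarrow>
    ('a \<Rightarrow> ('a \<times> 'a \<Rightarrow> 'k) set) \<Rightarrow> ('a \<Rightarrow> 'k) \<Rightarrow> (nat \<Rightarrow> 'a set) \<Rightarrow> bool" where
  "filtered_hopf_algebra R A \<Delta> \<epsilon> F \<longleftrightarrow>
     bialgebra R A \<Delta> \<epsilon> \<and> filtered_algebra R A F \<and> filtered_coalgebra R A \<Delta> \<epsilon> F \<and>
     (\<exists>S. is_antipode R A \<Delta> \<epsilon> S \<and> (\<forall>n. S ` F n \<subseteq> F n))"

definition filtered_coalgebra_iso :: "('k, 'r) ring_scheme \<Rightarrow>
    ('k, 'c, 'm) module_scheme \<Rightarrow> ('c \<Rightarrow> ('c \<times> 'c \<Rightarrow> 'k) set) \<Rightarrow> ('c \<Rightarrow> 'k) \<Rightarrow> (nat \<Rightarrow> 'c set) \<Rightarrow>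
    ('k, 'd, 'n) module_scheme \<Rightarrow> ('d \<Rightarrow> ('d \<times> 'd \<Rightarrow> 'k) set) \<Rightarrow> ('d \<Rightarrow> 'k) \<Rightarrow> (nat \<Rightarrow> 'd set) \<Rightarrow>
    ('c \<Rightarrow> 'd) \<Rightarrow> bool" where
  "filtered_coalgebra_iso R C \<Delta>\<^sub>C \<epsilon>\<^sub>C F\<^sub>C D \<Delta>\<^sub>D \<epsilon>\<^sub>D F\<^sub>D \<phi> \<longleftrightarrow>
     filtered_coalgebra R C \<Delta>\<^sub>C \<epsilon>\<^sub>C F\<^sub>C \<and> filtered_coalgebra R D \<Delta>\<^sub>D \<epsilon>\<^sub>D F\<^sub>D \<and>
     \<phi> \<in> lin_hom R C D \<and> bij_betw \<phi> (carrier C) (carrier D) \<and>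
     (\<forall>x\<in>carrier C. \<Delta>\<^sub>D (\<phi> x) = tensor_map R D D \<phi> \<phi> (\<Delta>\<^sub>C x) \<and> \<epsilon>\<^sub>D (\<phi> x) = \<epsilon>\<^sub>C x) \<and>
     (\<forall>n. \<phi> ` F\<^sub>C n = F\<^sub>D n)"

section \<open>Associated graded algebras\<close>

definition filt_pred :: "('k, 'a, 'm) module_scheme \<Rightarrow> (nat \<Rightarrow> 'a set) \<Rightarrow> nat \<Rightarrow> 'a set" where
  "filt_pred A F n = (case n of 0 \<Rightarrow> {\<zero>\<^bsub>A\<^esub>} | Suc m \<Rightarrow> F m)"

text \<open>
  The direct sum of the $F_n / F_{n-1}$, as finitely supported families of cosets, with
  $(x + F_{i-1})(y + F_{j-1}) = xy + F_{i+j-1}$ in degree $i + j$.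
\<close>

definition gr_alg :: "('k, 'a, 'm) module_scheme \<Rightarrow> (nat \<Rightarrow> 'a set) \<Rightarrow>
    ('k, nat \<Rightarrow> 'a set) module" where
  "gr_alg A F = (let P = filt_pred A F in \<lparr>
     carrier = {f. (\<forall>n. \<exists>x\<in>F n. f n = P n +>\<^bsub>A\<^esub> x) \<and> finite {n. f n \<noteq> P n}},
     mult = (\<lambda>f g n. \<Oplus>\<^bsub>quot_alg A (P n)\<^esub>i\<in>{..n}.
               \<Union>x\<in>f i. \<Union>y\<in>g (n - i). P n +>\<^bsub>A\<^esub> (x \<otimes>\<^bsub>A\<^esub> y)),
     one = (\<lambda>n. if n = 0 then P n +>\<^bsub>A\<^esub> \<one>\<^bsub>A\<^esub> else P n),
     zero = P,
     add = (\<lambda>f g n. f n <+>\<^bsub>A\<^esub> g n),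
     smult = (\<lambda>c f n. \<Union>x\<in>f n. P n +>\<^bsub>A\<^esub> (c \<odot>\<^bsub>A\<^esub> x))\<rparr>)"

text \<open>The class in degree \<open>n\<close> of \<open>x \<in> F n\<close>.\<close>

definition gr_class :: "('k, 'a, 'm) module_scheme \<Rightarrow> (nat \<Rightarrow> 'a set) \<Rightarrow> nat \<Rightarrow> 'a \<Rightarrow>
    nat \<Rightarrow> 'a set" where
  "gr_class A F n x = (\<lambda>m. if m = n then filt_pred A F m +>\<^bsub>A\<^esub> x else filt_pred A F m)"

definition gr_map :: "('k, 'b, 'm) module_scheme \<Rightarrow> (nat \<Rightarrow> 'b set) \<Rightarrow> ('a \<Rightarrow> 'b) \<Rightarrow>
    (nat \<Rightarrow> 'a set) \<Rightarrow> nat \<Rightarrow> 'b set" where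
  "gr_map B F \<phi> f = (\<lambda>n. \<Union>x\<in>f n. filt_pred B F n +>\<^bsub>B\<^esub> \<phi> x)"

section \<open>Tensor, symmetric and universal enveloping algebras\<close>

text \<open>
  The tensor algebra of \<open>G\<close> is the free module on all words over \<open>G\<close> modulo the multilinear
  relations, with concatenation as product; the words of length \<open>n\<close> span the \<open>n\<close>-th tensor power.
\<close>

definition word_monoid :: "('k, 'g, 'm) module_scheme \<Rightarrow> 'g list monoid" where
  "word_monoid G = \<lparr>carrier = lists (carrier G), mult = (@), one = []\<rparr>"

definition multilinear_rels :: "('k, 'r) ring_scheme \<Rightarrow> ('k, 'g, 'm) module_scheme \<Rightarrow>
    ('g list \<Rightarrow> 'k) set" where
  "multilinear_rels R G = (let F = monoid_alg R (word_monoid G); e = basis_elt R in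
     {e (u @ [x \<oplus>\<^bsub>G\<^esub> y] @ v) \<ominus>\<^bsub>F\<^esub> (e (u @ [x] @ v) \<oplus>\<^bsub>F\<^esub> e (u @ [y] @ v)) | u v x y.
        u \<in> lists (carrier G) \<and> v \<in> lists (carrier G) \<and> x \<in> carrier G \<and> y \<in> carrier G} \<union>
     {e (u @ [c \<odot>\<^bsub>G\<^esub> x] @ v) \<ominus>\<^bsub>F\<^esub> (c \<odot>\<^bsub>F\<^esub> e (u @ [x] @ v)) | u v c x.
        u \<in> lists (carrier G) \<and> v \<in> lists (carrier G) \<and> c \<in> carrier R \<and> x \<in> carrier G})"

definition word_rels :: "('k, 'r) ring_scheme \<Rightarrow> ('k, 'g, 'm) module_scheme \<Rightarrow>
    ('g list \<Rightarrow> 'k) set" where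
  "word_rels R G = submodule_span R (monoid_alg R (word_monoid G)) (multilinear_rels R G)"

definition tensor_alg :: "('k, 'r) ring_scheme \<Rightarrow> ('k, 'g, 'm) module_scheme \<Rightarrow>
    ('k, ('g list \<Rightarrow> 'k) set) module" where
  "tensor_alg R G = quot_alg (monoid_alg R (word_monoid G)) (word_rels R G)"

definition word_tensor :: "('k, 'r) ring_scheme \<Rightarrow> ('k, 'g, 'm) module_scheme \<Rightarrow>
    'g list \<Rightarrow> ('g list \<Rightarrow> 'k) set" where
  "word_tensor R G w = word_rels R G +>\<^bsub>monoid_alg R (word_monoid G)\<^esub> basis_elt R w"

definition tensor_power :: "('k, 'r) ring_scheme \<Rightarrow> ('k, 'g, 'm) module_scheme \<Rightarrow> nat \<Rightarrow>
    ('g list \<Rightarrow> 'k) set set" where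
  "tensor_power R G n = submodule_span R (tensor_alg R G)
     {word_tensor R G w | w. w \<in> lists (carrier G) \<and> length w = n}"

definition tensor_upto :: "('k, 'r) ring_scheme \<Rightarrow> ('k, 'g, 'm) module_scheme \<Rightarrow> nat \<Rightarrow>
    ('g list \<Rightarrow> 'k) set set" where
  "tensor_upto R G n = submodule_span R (tensor_alg R G) (\<Union>i\<le>n. tensor_power R G i)"

definition sym_ideal :: "('k, 'r) ring_scheme \<Rightarrow> ('k, 'g, 'm) module_scheme \<Rightarrow>
    ('g list \<Rightarrow> 'k) set set" where
  "sym_ideal R G = (let T = tensor_alg R G; \<iota> = (\<lambda>x. word_tensor R G [x]) in
     genideal T {(\<iota> x \<otimes>\<^bsub>T\<^esub> \<iota> y) \<ominus>\<^bsub>T\<^esub> (\<iota> y \<otimes>\<^bsub>T\<^esub> \<iota> x) | x y.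
       x \<in> carrier G \<and> y \<in> carrier G})"

definition env_ideal :: "('k, 'r) ring_scheme \<Rightarrow> ('k, 'g, 'm) module_scheme \<Rightarrow>
    ('g list \<Rightarrow> 'k) set set" where
  "env_ideal R L = (let T = tensor_alg R L; \<iota> = (\<lambda>x. word_tensor R L [x]) in
     genideal T {((\<iota> x \<otimes>\<^bsub>T\<^esub> \<iota> y) \<ominus>\<^bsub>T\<^esub> (\<iota> y \<otimes>\<^bsub>T\<^esub> \<iota> x)) \<ominus>\<^bsub>T\<^esub> \<iota> (x \<otimes>\<^bsub>L\<^esub> y) | x y.
       x \<in> carrier L \<and> y \<in> carrier L})"

definition sym_alg :: "('k, 'r) ring_scheme \<Rightarrow> ('k, 'g, 'm) module_scheme \<Rightarrow>
    ('k, ('g list \<Rightarrow> 'k) set set) module" where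
  "sym_alg R G = quot_alg (tensor_alg R G) (sym_ideal R G)"

definition env_alg :: "('k, 'r) ring_scheme \<Rightarrow> ('k, 'g, 'm) module_scheme \<Rightarrow>
    ('k, ('g list \<Rightarrow> 'k) set set) module" where
  "env_alg R L = quot_alg (tensor_alg R L) (env_ideal R L)"

definition sym_gen :: "('k, 'r) ring_scheme \<Rightarrow> ('k, 'g, 'm) module_scheme \<Rightarrow>
    'g \<Rightarrow> ('g list \<Rightarrow> 'k) set set" where
  "sym_gen R G x = sym_ideal R G +>\<^bsub>tensor_alg R G\<^esub> word_tensor R G [x]"

definition env_gen :: "('k, 'r) ring_scheme \<Rightarrow> ('k, 'g, 'm) module_scheme \<Rightarrow>
    'g \<Rightarrow> ('g list \<Rightarrow> 'k) set set" where
  "env_gen R L x = env_ideal R L +>\<^bsub>tensor_alg R L\<^esub> word_tensor R L [x]"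

definition sym_power :: "('k, 'r) ring_scheme \<Rightarrow> ('k, 'g, 'm) module_scheme \<Rightarrow> nat \<Rightarrow>
    ('g list \<Rightarrow> 'k) set set set" where
  "sym_power R G n = (\<lambda>t. sym_ideal R G +>\<^bsub>tensor_alg R G\<^esub> t) ` tensor_power R G n"

definition sym_filtration :: "('k, 'r) ring_scheme \<Rightarrow> ('k, 'g, 'm) module_scheme \<Rightarrow> nat \<Rightarrow>
    ('g list \<Rightarrow> 'k) set set set" where
  "sym_filtration R G n = (\<lambda>t. sym_ideal R G +>\<^bsub>tensor_alg R G\<^esub> t) ` tensor_upto R G n"

definition env_filtration :: "('k, 'r) ring_scheme \<Rightarrow> ('k, 'g, 'm) module_scheme \<Rightarrow> nat \<Rightarrow>
    ('g list \<Rightarrow> 'k) set set set" where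
  "env_filtration R L n = (\<lambda>t. env_ideal R L +>\<^bsub>tensor_alg R L\<^esub> t) ` tensor_upto R L n"

text \<open>
  The standard coproduct and counit of an algebra \<open>A\<close> generated by the image of \<open>\<iota>\<close> on \<open>X\<close>.
  Extensionality makes the homomorphisms unique as HOL functions.
\<close>

definition std_comult :: "('k, 'r) ring_scheme \<Rightarrow> ('k, 'a, 'm) module_scheme \<Rightarrow>
    'g set \<Rightarrow> ('g \<Rightarrow> 'a) \<Rightarrow> 'a \<Rightarrow> ('a \<times> 'a \<Rightarrow> 'k) set" where
  "std_comult R A X \<iota> = (THE \<Delta>. \<Delta> \<in> alg_hom R A (tensor R A A) \<inter> extensional (carrier A) \<and>
     (\<forall>x\<in>X. \<Delta> (\<iota> x) = pure_tensor R A A \<one>\<^bsub>A\<^esub> (\<iota> x) \<oplus>\<^bsub>tensor R A A\<^esub> pure_tensor R A A (\<iota> x) \<one>\<^bsub>A\<^esub>))"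

definition std_counit :: "('k, 'r) ring_scheme \<Rightarrow> ('k, 'a, 'm) module_scheme \<Rightarrow>
    'g set \<Rightarrow> ('g \<Rightarrow> 'a) \<Rightarrow> 'a \<Rightarrow> 'k" where
  "std_counit R A X \<iota> = (THE \<epsilon>. \<epsilon> \<in> alg_hom R A (ground_alg R) \<inter> extensional (carrier A) \<and>
     (\<forall>x\<in>X. \<epsilon> (\<iota> x) = \<zero>\<^bsub>R\<^esub>))"

definition sym_comult where
  "sym_comult R G = std_comult R (sym_alg R G) (carrier G) (sym_gen R G)"

definition sym_counit where
  "sym_counit R G = std_counit R (sym_alg R G) (carrier G) (sym_gen R G)"

definition env_comult where
  "env_comult R L = std_comult R (env_alg R L) (carrier L) (env_gen R L)"

definition env_counit where
  "env_counit R L = std_counit R (env_alg R L) (carrier L) (env_gen R L)"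

definition gr_env where
  "gr_env R L = gr_alg (env_alg R L) (env_filtration R L)"

text \<open>The algebra map from the symmetric algebra to the associated graded algebra of the
  enveloping algebra that sends a generator to its class in degree 1.\<close>

definition canonical_map :: "('k, 'r) ring_scheme \<Rightarrow> ('k, 'g, 'm) module_scheme \<Rightarrow>
    ('g list \<Rightarrow> 'k) set set \<Rightarrow> nat \<Rightarrow> ('g list \<Rightarrow> 'k) set set set" where
  "canonical_map R L = (THE h.
     h \<in> alg_hom R (sym_alg R L) (gr_env R L) \<inter> extensional (carrier (sym_alg R L)) \<and>
     (\<forall>x\<in>carrier L. h (sym_gen R L x)
        = gr_class (env_alg R L) (env_filtration R L) 1 (env_gen R L x)))"

text \<open>
  The identification of the symmetric algebra with its own associated graded algebra sends
  a homogeneous element \<open>s\<close> of degree \<open>n\<close> to its class in degree \<open>n\<close>. Being linear, the two sides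
  agree everywhere once they agree on homogeneous elements.
\<close>

definition lifts_canonical_map where
  "lifts_canonical_map R L \<phi> \<longleftrightarrow> (\<forall>n. \<forall>s\<in>sym_power R L n.
     gr_map (env_alg R L) (env_filtration R L) \<phi>
         (gr_class (sym_alg R L) (sym_filtration R L) n s)
       = canonical_map R L s)"

end

theory Submission
  imports Defs "HOL-Algebra.UnivPoly"
begin

text \<open>
  Write $L$ for the Lie algebra, $S = \operatorname{Sym} L$ and $U$ for the enveloping algebra. For
  $x \in L$ let $D_x$ be the derivation of $S$ with $D_x(y) = y \circ x$. The pre-Lie identity says
  that $[D_y, D_x] = D_{\{x, y\}}$, hence $s \cdot x := s x + D_x(s)$ makes $S$ a right $U$-module, and
  $\Psi(u) := 1 \cdot u$ maps $x_1 \cdots x_n$ to $x_1 \cdots x_n$ plus terms of lower degree. So the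
  degree $n$ part of the canonical map sends $\Psi(u)$ to the class of $u$ for $u \in F_n U$, and
  descending through the filtration yields that both $\Psi$ and the canonical map are injective.
  As each $D_x$ is a coderivation, $\Psi$ is a coalgebra map; its inverse is the required lift.
\<close>

section \<open>Linear maps and spans\<close>

text \<open>The base ring is arbitrary, so the module may have torsion and no basis, and integers
  need not be invertible. Neither ordered monomials nor symmetrization with 1/n! is available, and
  injectivity cannot be tested on a basis.

  The direction of the construction is forced by this. A lift from Sym to U is not an algebra map,
  so the universal property of Sym does not produce it. The universal property of U does produce
  representations, and a representation on Sym evaluated at 1 is a linear map from U to Sym. The
  lift is obtained backwards, as the inverse of that map.

  Since the action is on the right, words grow at their last letter, and the endomorphisms of Sym
  are multiplied in reverse order of composition.

  All maps come from universal properties, and linear identities are checked on words or on pure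
  tensors. Sym is treated as the enveloping algebra of the zero bracket, so that the Hopf structure,
  the filtration and the universal property are established once for both sides.\<close>

lemma lin_homI:
  assumes "\<And>x. x \<in> carrier M \<Longrightarrow> h x \<in> carrier N"
    and "\<And>x y. \<lbrakk>x \<in> carrier M; y \<in> carrier M\<rbrakk> \<Longrightarrow> h (x \<oplus>\<^bsub>M\<^esub> y) = h x \<oplus>\<^bsub>N\<^esub> h y"
    and "\<And>c x. \<lbrakk>c \<in> carrier R; x \<in> carrier M\<rbrakk> \<Longrightarrow> h (c \<odot>\<^bsub>M\<^esub> x) = c \<odot>\<^bsub>N\<^esub> h x"
  shows "h \<in> lin_hom R M N"
  using assms by (auto simp: lin_hom_def)

lemma lin_homD:
  assumes "h \<in> lin_hom R M N"
  shows "x \<in> carrier M \<Longrightarrow> h x \<in> carrier N"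
    and "\<lbrakk>x \<in> carrier M; y \<in> carrier M\<rbrakk> \<Longrightarrow> h (x \<oplus>\<^bsub>M\<^esub> y) = h x \<oplus>\<^bsub>N\<^esub> h y"
    and "\<lbrakk>c \<in> carrier R; x \<in> carrier M\<rbrakk> \<Longrightarrow> h (c \<odot>\<^bsub>M\<^esub> x) = c \<odot>\<^bsub>N\<^esub> h x"
  using assms by (auto simp: lin_hom_def)

lemma lin_hom_comp:
  assumes "f \<in> lin_hom R M N" "g \<in> lin_hom R N P"
  shows "(\<lambda>x. g (f x)) \<in> lin_hom R M P"
  using lin_homD[OF assms(1)] lin_homD[OF assms(2)] by (intro lin_homI) auto

text \<open>\<open>lin_hom\<close> constrains a function only on the carrier. That \<open>M\<close>
  is a module keeps sums and multiples inside the carrier, where \<open>g\<close> and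
  \<open>f\<close> agree.\<close>

lemma lin_hom_cong:
  assumes "f \<in> lin_hom R M N" "module R M" "\<And>x. x \<in> carrier M \<Longrightarrow> g x = f x"
  shows "g \<in> lin_hom R M N"
proof -
  interpret M: module R M by fact
  show ?thesis
    using lin_homD[OF assms(1)] by (intro lin_homI) (auto simp: assms(3))
qed

lemma lin_hom_zero:
  assumes "h \<in> lin_hom R M N" "module R M" "module R N"
  shows "h \<zero>\<^bsub>M\<^esub> = \<zero>\<^bsub>N\<^esub>"
proof -
  interpret M: module R M by fact
  interpret N: module R N by fact
  \<comment> \<open>Zero is written as 0 times 0, because homogeneity of \<open>h\<close> is given
    and preservation of zero is not.\<close>
  have "h (\<zero>\<^bsub>R\<^esub> \<odot>\<^bsub>M\<^esub> \<zero>\<^bsub>M\<^esub>) = \<zero>\<^bsub>R\<^esub> \<odot>\<^bsub>N\<^esub> h \<zero>\<^bsub>M\<^esub>"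
    using lin_homD[OF assms(1)] by blast
  then show ?thesis using lin_homD(1)[OF assms(1)] by simp
qed

text \<open>With negation written as a scalar multiple, linearity and closure under scalars also
  cover inverses and differences.\<close>

lemma (in module) a_inv_eq_smult: "x \<in> carrier M \<Longrightarrow> \<ominus>\<^bsub>M\<^esub> x = (\<ominus>\<^bsub>R\<^esub> \<one>\<^bsub>R\<^esub>) \<odot>\<^bsub>M\<^esub> x"
  by (simp add: smult_l_minus)

lemma lin_hom_neg:
  assumes "h \<in> lin_hom R M N" "module R M" "module R N" "x \<in> carrier M"
  shows "h (\<ominus>\<^bsub>M\<^esub> x) = \<ominus>\<^bsub>N\<^esub> h x"
proof -
  interpret M: module R M by fact
  interpret N: module R N by fact
  show ?thesis
    using lin_homD[OF assms(1)] assms(4) by (simp add: M.a_inv_eq_smult N.a_inv_eq_smult)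
qed

lemma lin_hom_minus:
  assumes "h \<in> lin_hom R M N" "module R M" "module R N" "x \<in> carrier M" "y \<in> carrier M"
  shows "h (x \<ominus>\<^bsub>M\<^esub> y) = h x \<ominus>\<^bsub>N\<^esub> h y"
proof -
  interpret M: module R M by fact
  interpret N: module R N by fact
  show ?thesis
    using lin_homD[OF assms(1)] assms by (simp add: a_minus_def lin_hom_neg)
qed

lemma lin_hom_finsum:
  assumes h: "h \<in> lin_hom R M N" and "module R M" "module R N"
    and "finite A" "f \<in> A \<rightarrow> carrier M"
  shows "h (\<Oplus>\<^bsub>M\<^esub>i\<in>A. f i) = (\<Oplus>\<^bsub>N\<^esub>i\<in>A. h (f i))"
proof -
  interpret M: module R M by fact
  interpret N: module R N by fact
  show ?thesis
    using \<open>finite A\<close> \<open>f \<in> A \<rightarrow> carrier M\<close>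
  proof induct
    case empty then show ?case using lin_hom_zero[OF assms(1-3)] by simp
  next
    case (insert a A)
    moreover have "(\<lambda>i. h (f i)) \<in> A \<rightarrow> carrier N" "h (f a) \<in> carrier N" "f a \<in> carrier M"
      "f \<in> A \<rightarrow> carrier M"
      using insert(4) lin_homD(1)[OF h] by auto
    ultimately show ?case
      by (simp add: lin_homD(2)[OF h])
  qed
qed

lemma lin_hom_addI:
  assumes "f \<in> lin_hom R M N" "g \<in> lin_hom R M N" "module R N"
  shows "(\<lambda>x. f x \<oplus>\<^bsub>N\<^esub> g x) \<in> lin_hom R M N"
proof -
  interpret N: module R N by fact
  show ?thesis
    using lin_homD[OF assms(1)] lin_homD[OF assms(2)]
    by (intro lin_homI) (auto simp: N.smult_r_distr N.M.add.m_ac)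
qed

lemma lin_hom_smultI:
  assumes "f \<in> lin_hom R M N" "module R N" "c \<in> carrier R"
  shows "(\<lambda>x. c \<odot>\<^bsub>N\<^esub> f x) \<in> lin_hom R M N"
proof -
  interpret N: module R N by fact
  show ?thesis
    using lin_homD[OF assms(1)] assms(3)
    by (intro lin_homI) (auto simp: N.smult_r_distr N.smult_assoc1[symmetric] N.R.m_comm)
qed

lemma lin_hom_minusI:
  assumes "f \<in> lin_hom R M N" "g \<in> lin_hom R M N" "module R N"
  shows "(\<lambda>x. f x \<ominus>\<^bsub>N\<^esub> g x) \<in> lin_hom R M N"
proof -
  interpret N: module R N by fact
  show ?thesis
    using lin_homD[OF assms(1)] lin_homD[OF assms(2)]
    by (intro lin_homI)
       (auto simp: a_minus_def N.M.minus_add N.smult_r_distr N.M.add.m_ac N.smult_r_minus)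
qed

lemma (in module) submoduleI':
  assumes "H \<subseteq> carrier M" "\<zero>\<^bsub>M\<^esub> \<in> H" "\<And>a b. \<lbrakk>a \<in> H; b \<in> H\<rbrakk> \<Longrightarrow> a \<oplus>\<^bsub>M\<^esub> b \<in> H"
    and "\<And>a x. \<lbrakk>a \<in> carrier R; x \<in> H\<rbrakk> \<Longrightarrow> a \<odot>\<^bsub>M\<^esub> x \<in> H"
  shows "submodule H R M"
proof (rule submoduleI)
  fix a assume "a \<in> H"
  then show "\<ominus>\<^bsub>M\<^esub> a \<in> H"
    using assms by (subst a_inv_eq_smult) auto
qed (use assms in auto)

lemma submoduleD:
  assumes "submodule H R M"
  shows "x \<in> H \<Longrightarrow> x \<in> carrier M" "\<zero>\<^bsub>M\<^esub> \<in> H" "\<lbrakk>x \<in> H; y \<in> H\<rbrakk> \<Longrightarrow> x \<oplus>\<^bsub>M\<^esub> y \<in> H"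
    "\<lbrakk>c \<in> carrier R; x \<in> H\<rbrakk> \<Longrightarrow> c \<odot>\<^bsub>M\<^esub> x \<in> H"
    "x \<in> H \<Longrightarrow> \<ominus>\<^bsub>M\<^esub> x \<in> H" "\<lbrakk>x \<in> H; y \<in> H\<rbrakk> \<Longrightarrow> x \<ominus>\<^bsub>M\<^esub> y \<in> H"
proof -
  interpret H: submodule H R M by fact
  show 1: "x \<in> H \<Longrightarrow> x \<in> carrier M" "\<zero>\<^bsub>M\<^esub> \<in> H" "\<lbrakk>x \<in> H; y \<in> H\<rbrakk> \<Longrightarrow> x \<oplus>\<^bsub>M\<^esub> y \<in> H"
    "\<lbrakk>c \<in> carrier R; x \<in> H\<rbrakk> \<Longrightarrow> c \<odot>\<^bsub>M\<^esub> x \<in> H" for x y c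
    using H.subset H.one_closed H.m_closed H.smult_closed by auto
  show 2: "x \<in> H \<Longrightarrow> \<ominus>\<^bsub>M\<^esub> x \<in> H" for x
    using H.m_inv_closed by (simp add: a_inv_def)
  show "\<lbrakk>x \<in> H; y \<in> H\<rbrakk> \<Longrightarrow> x \<ominus>\<^bsub>M\<^esub> y \<in> H"
    using 1 2 by (simp add: a_minus_def)
qed

lemma submodule_carrier: "module R M \<Longrightarrow> submodule (carrier M) R M"
  by (rule module.carrier_is_submodule)

lemma span_incl: "X \<subseteq> submodule_span R M X"
  by (auto simp: submodule_span_def)

lemma span_base: "x \<in> X \<Longrightarrow> x \<in> submodule_span R M X"
  by (rule subsetD[OF span_incl])

lemma span_minimal: "submodule N R M \<Longrightarrow> X \<subseteq> N \<Longrightarrow> submodule_span R M X \<subseteq> N"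
  unfolding submodule_span_def by (rule Inter_lower) simp

lemma span_mono: "X \<subseteq> Y \<Longrightarrow> submodule_span R M X \<subseteq> submodule_span R M Y"
  unfolding submodule_span_def by (rule Inter_anti_mono) (intro Collect_mono impI conjI, erule conjunct1, drule conjunct2, erule subset_trans)

text \<open>\<open>X\<close> has to lie in the carrier: only then is the carrier itself among the
  submodules that are intersected, so that the family is not empty.\<close>

lemma span_submodule:
  assumes "module R M" "X \<subseteq> carrier M"
  shows "submodule (submodule_span R M X) R M"
proof -
  interpret M: module R M by fact
  have "submodule_span R M X \<subseteq> carrier M"
    by (intro span_minimal submodule_carrier assms)
  then show ?thesis
  proof (rule M.submoduleI')
    show "\<zero>\<^bsub>M\<^esub> \<in> submodule_span R M X"
      unfolding submodule_span_def by (rule InterI) (metis (lifting) mem_Collect_eq submoduleD(2))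
    show "a \<oplus>\<^bsub>M\<^esub> b \<in> submodule_span R M X"
      if "a \<in> submodule_span R M X" "b \<in> submodule_span R M X" for a b
      using that unfolding submodule_span_def
      by (intro InterI) (metis (lifting) InterD mem_Collect_eq submoduleD(3))
    show "a \<odot>\<^bsub>M\<^esub> b \<in> submodule_span R M X"
      if "a \<in> carrier R" "b \<in> submodule_span R M X" for a b
      using that unfolding submodule_span_def
      by (intro InterI) (metis (lifting) InterD mem_Collect_eq submoduleD(4))
  qed
qed

lemma span_carrier:
  assumes "module R M" "X \<subseteq> carrier M"
  shows "submodule_span R M X \<subseteq> carrier M"
  by (intro span_minimal submodule_carrier assms)

lemma submodule_vimage:
  assumes h: "h \<in> lin_hom R M N" and "module R M" "module R N" "submodule H R N"
  shows "submodule {x \<in> carrier M. h x \<in> H} R M"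
proof -
  interpret M: module R M by fact
  show ?thesis
    using lin_homD[OF h] submoduleD[OF assms(4)] lin_hom_zero[OF assms(1-3)]
    by (intro M.submoduleI') auto
qed

text \<open>The preimage of \<open>H\<close> is a submodule containing \<open>X\<close>, hence it
  contains the span. This replaces induction over linear combinations throughout.\<close>

lemma lin_hom_span:
  assumes h: "h \<in> lin_hom R M N" and "module R M" "module R N" "submodule H R N"
    and "X \<subseteq> carrier M" "\<And>x. x \<in> X \<Longrightarrow> h x \<in> H" "y \<in> submodule_span R M X"
  shows "h y \<in> H"
proof -
  have "submodule_span R M X \<subseteq> {x \<in> carrier M. h x \<in> H}"
    by (intro span_minimal submodule_vimage assms) (use assms in auto)
  with assms show ?thesis by blast
qed

text \<open>The filtrations and symmetric powers are defined as images of spans; this rewrites them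
  as spans of images of words.\<close>

lemma lin_hom_image_span:
  assumes h: "h \<in> lin_hom R M N" and "module R M" "module R N" and X: "X \<subseteq> carrier M"
  shows "h ` submodule_span R M X = submodule_span R N (h ` X)"
proof
  interpret M: module R M by fact
  interpret N: module R N by fact
  have hX: "h ` X \<subseteq> carrier N" using X lin_homD(1)[OF h] by auto
  note N = span_submodule[OF \<open>module R N\<close> hX]
  show "h ` submodule_span R M X \<subseteq> submodule_span R N (h ` X)"
    using lin_hom_span[OF assms(1-3) N X span_base[OF imageI]] by blast
  note S = submoduleD[OF span_submodule[OF \<open>module R M\<close> X]]
  have "submodule (h ` submodule_span R M X) R N"
  proof (rule N.submoduleI')
    show "h ` submodule_span R M X \<subseteq> carrier N" using S lin_homD(1)[OF h] by auto
    show "\<zero>\<^bsub>N\<^esub> \<in> h ` submodule_span R M X"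
      using lin_hom_zero[OF assms(1-3)] S(2) by (metis imageI)
    fix b assume "b \<in> h ` submodule_span R M X"
    then obtain y where y: "y \<in> submodule_span R M X" "b = h y" by blast
    show "a \<oplus>\<^bsub>N\<^esub> b \<in> h ` submodule_span R M X" if a: "a \<in> h ` submodule_span R M X" for a
    proof -
      from a obtain x where x: "x \<in> submodule_span R M X" "a = h x" by blast
      with y have "a \<oplus>\<^bsub>N\<^esub> b = h (x \<oplus>\<^bsub>M\<^esub> y)" using S(1) lin_homD(2)[OF h] by metis
      then show ?thesis using S(3)[OF x(1) y(1)] by blast
    qed
    show "c \<odot>\<^bsub>N\<^esub> b \<in> h ` submodule_span R M X" if c: "c \<in> carrier R" for c
    proof -
      from c y have "c \<odot>\<^bsub>N\<^esub> b = h (c \<odot>\<^bsub>M\<^esub> y)" using S(1) lin_homD(3)[OF h] by metis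
      then show ?thesis using S(4)[OF c y(1)] by blast
    qed
  qed
  then show "submodule_span R N (h ` X) \<subseteq> h ` submodule_span R M X"
    by (intro span_minimal image_mono span_incl)
qed

lemma submodule_equalizer:
  assumes f: "f \<in> lin_hom R M N" and g: "g \<in> lin_hom R M N" and "module R M" "module R N"
  shows "submodule {x \<in> carrier M. f x = g x} R M"
proof -
  interpret M: module R M by fact
  show ?thesis
    using lin_homD[OF f] lin_homD[OF g] lin_hom_zero[OF f assms(3-4)] lin_hom_zero[OF g assms(3-4)]
    by (intro M.submoduleI') auto
qed

text \<open>The equalizer of two linear maps is a submodule. Most identities below are obtained in
  this way, by comparing both sides on words or on pure tensors.\<close>

lemma lin_hom_eq_on_span:
  assumes f: "f \<in> lin_hom R M N" and g: "g \<in> lin_hom R M N" and "module R M" "module R N"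
    and "X \<subseteq> carrier M" "\<And>x. x \<in> X \<Longrightarrow> f x = g x" "y \<in> submodule_span R M X"
  shows "f y = g y"
proof -
  have "submodule_span R M X \<subseteq> {x \<in> carrier M. f x = g x}"
    by (intro span_minimal submodule_equalizer assms) (use assms in auto)
  with assms show ?thesis by blast
qed

text \<open>Linearity is recorded separately in each variable, so that each variable can be handed
  to the span lemmas on its own.\<close>

definition bilin_map where
  "bilin_map R A B P \<beta> \<longleftrightarrow> (\<forall>b\<in>carrier B. (\<lambda>a. \<beta> a b) \<in> lin_hom R A P) \<and>
     (\<forall>a\<in>carrier A. \<beta> a \<in> lin_hom R B P)"

lemma bilin_mapD:
  assumes "bilin_map R A B P \<beta>"
  shows "b \<in> carrier B \<Longrightarrow> (\<lambda>a. \<beta> a b) \<in> lin_hom R A P"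
    "a \<in> carrier A \<Longrightarrow> \<beta> a \<in> lin_hom R B P"
    "a \<in> carrier A \<Longrightarrow> (\<lambda>b. \<beta> a b) \<in> lin_hom R B P"
  using assms by (auto simp: bilin_map_def)

lemma bilin_mapI:
  assumes "\<And>b. b \<in> carrier B \<Longrightarrow> (\<lambda>a. \<beta> a b) \<in> lin_hom R A P"
    and "\<And>a. a \<in> carrier A \<Longrightarrow> (\<lambda>b. \<beta> a b) \<in> lin_hom R B P"
  shows "bilin_map R A B P \<beta>"
  using assms by (auto simp: bilin_map_def)

lemma bilin_map_closed:
  "bilin_map R A B P \<beta> \<Longrightarrow> a \<in> carrier A \<Longrightarrow> b \<in> carrier B \<Longrightarrow> \<beta> a b \<in> carrier P"
  using lin_homD(1) bilin_mapD(2) by metis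

lemma bilin_map_comp:
  assumes "bilin_map R A B P \<beta>" "f \<in> lin_hom R A' A" "g \<in> lin_hom R B' B"
  shows "bilin_map R A' B' P (\<lambda>a b. \<beta> (f a) (g b))"
  using assms lin_hom_comp[OF assms(2) bilin_mapD(1)[OF assms(1)]]
    lin_hom_comp[OF assms(3) bilin_mapD(3)[OF assms(1)]]
  by (intro bilin_mapI) (auto dest: lin_homD)

lemma bilin_map_lin:
  assumes "bilin_map R A B P \<beta>" "f \<in> lin_hom R P Q"
  shows "bilin_map R A B Q (\<lambda>a b. f (\<beta> a b))"
  by (rule bilin_mapI; rule lin_hom_comp[OF _ assms(2)]) (auto intro: bilin_mapD[OF assms(1)])

lemma bilin_map_eq_on_span:
  assumes f: "bilin_map R A B P \<beta>" and g: "bilin_map R A B P \<gamma>"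
    and "module R A" "module R B" "module R P"
    and "X \<subseteq> carrier A" "Y \<subseteq> carrier B" "\<And>x y. \<lbrakk>x \<in> X; y \<in> Y\<rbrakk> \<Longrightarrow> \<beta> x y = \<gamma> x y"
    and "a \<in> submodule_span R A X" "b \<in> submodule_span R B Y"
  shows "\<beta> a b = \<gamma> a b"
proof -
  have bB: "b \<in> carrier B" using span_carrier[of R B Y] assms by blast
  \<comment> \<open>The second variable is extended to its span first, while the first one is frozen
    at a generator.\<close>
  have "\<beta> x b = \<gamma> x b" if "x \<in> X" for x
    using lin_hom_eq_on_span[OF bilin_mapD(2)[OF f] bilin_mapD(2)[OF g], of x x Y b] assms that by blast
  then show ?thesis
    using lin_hom_eq_on_span[OF bilin_mapD(1)[OF f bB] bilin_mapD(1)[OF g bB], of X a] assms by blast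
qed

lemma bilin_map_span:
  assumes f: "bilin_map R A B P \<beta>"
    and "module R A" "module R B" "module R P"
    and "X \<subseteq> carrier A" "Y \<subseteq> carrier B" "submodule H R P"
    and "\<And>x y. \<lbrakk>x \<in> X; y \<in> Y\<rbrakk> \<Longrightarrow> \<beta> x y \<in> H"
    and "a \<in> submodule_span R A X" "b \<in> submodule_span R B Y"
  shows "\<beta> a b \<in> H"
proof -
  have bB: "b \<in> carrier B" using span_carrier[of R B Y] assms by blast
  have "\<beta> x b \<in> H" if "x \<in> X" for x
    using lin_hom_span[OF bilin_mapD(2)[OF f], of x H Y b] assms that by blast
  then show ?thesis
    using lin_hom_span[OF bilin_mapD(1)[OF f bB], of H X a] assms by blast
qed

section \<open>Algebras\<close>

text \<open>A locale form of \<open>assoc_algebra\<close>, so that one interpretation supplies both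
  the module theory and the ring theory of a possibly noncommutative algebra.\<close>

locale assoc_alg = module R A + A?: ring A for R (structure) and A (structure) +
  assumes smult_mult_l: "\<lbrakk>c \<in> carrier R; x \<in> carrier A; y \<in> carrier A\<rbrakk> \<Longrightarrow>
      (c \<odot>\<^bsub>A\<^esub> x) \<otimes>\<^bsub>A\<^esub> y = c \<odot>\<^bsub>A\<^esub> (x \<otimes>\<^bsub>A\<^esub> y)"
    and smult_mult_r: "\<lbrakk>c \<in> carrier R; x \<in> carrier A; y \<in> carrier A\<rbrakk> \<Longrightarrow>
      x \<otimes>\<^bsub>A\<^esub> (c \<odot>\<^bsub>A\<^esub> y) = c \<odot>\<^bsub>A\<^esub> (x \<otimes>\<^bsub>A\<^esub> y)"

lemma assoc_algebra_iff: "assoc_algebra R A \<longleftrightarrow> assoc_alg R A"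
  by (auto simp: assoc_algebra_def assoc_alg_def assoc_alg_axioms_def)

lemma (in assoc_alg) mult_bilin: "bilin_map R A A A (mult A)"
  by (auto intro!: bilin_mapI lin_homI simp: A.l_distr A.r_distr smult_mult_l smult_mult_r)

lemma (in assoc_alg) module_axioms': "module R A" ..

lemma (in assoc_alg) ring_axioms': "ring A" ..

lemma alg_homI:
  assumes "h \<in> lin_hom R A B" "h \<one>\<^bsub>A\<^esub> = \<one>\<^bsub>B\<^esub>"
    and "\<And>x y. \<lbrakk>x \<in> carrier A; y \<in> carrier A\<rbrakk> \<Longrightarrow> h (x \<otimes>\<^bsub>A\<^esub> y) = h x \<otimes>\<^bsub>B\<^esub> h y"
  shows "h \<in> alg_hom R A B"
  using assms by (auto simp: alg_hom_def ring_hom_def lin_hom_def)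

lemma alg_homD:
  assumes "h \<in> alg_hom R A B"
  shows "h \<in> lin_hom R A B" "h \<one>\<^bsub>A\<^esub> = \<one>\<^bsub>B\<^esub>"
    "\<lbrakk>x \<in> carrier A; y \<in> carrier A\<rbrakk> \<Longrightarrow> h (x \<otimes>\<^bsub>A\<^esub> y) = h x \<otimes>\<^bsub>B\<^esub> h y"
    "x \<in> carrier A \<Longrightarrow> h x \<in> carrier B"
  using assms by (auto simp: alg_hom_def ring_hom_def lin_hom_def)

lemma alg_hom_comp:
  assumes "f \<in> alg_hom R A B" "g \<in> alg_hom R B C"
  shows "(\<lambda>x. g (f x)) \<in> alg_hom R A C"
  using alg_homD[OF assms(1)] alg_homD[OF assms(2)]
  by (intro alg_homI lin_hom_comp[of f R A B g C]) auto

lemma alg_hom_id: "id \<in> alg_hom R A A"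
  by (intro alg_homI lin_homI) auto

text \<open>Both sides of multiplicativity are bilinear, so a spanning set decides.\<close>

lemma alg_hom_multI_span:
  assumes h: "h \<in> lin_hom R A B" and A: "assoc_alg R A" and B: "assoc_alg R B" and X: "X \<subseteq> carrier A"
    and span: "submodule_span R A X = carrier A"
    and one: "h \<one>\<^bsub>A\<^esub> = \<one>\<^bsub>B\<^esub>"
    and mult: "\<And>x y. \<lbrakk>x \<in> X; y \<in> X\<rbrakk> \<Longrightarrow> h (x \<otimes>\<^bsub>A\<^esub> y) = h x \<otimes>\<^bsub>B\<^esub> h y"
  shows "h \<in> alg_hom R A B"
proof -
  interpret A: assoc_alg R A by fact
  interpret B: assoc_alg R B by fact
  show ?thesis
  proof (rule alg_homI[OF h one])
    fix x y assume "x \<in> carrier A" "y \<in> carrier A"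
    then show "h (x \<otimes>\<^bsub>A\<^esub> y) = h x \<otimes>\<^bsub>B\<^esub> h y"
      using bilin_map_eq_on_span[OF bilin_map_lin[OF A.mult_bilin h]
          bilin_map_comp[OF B.mult_bilin h h] A.module_axioms' A.module_axioms' B.module_axioms' X X mult]
      by (simp add: span)
  qed
qed

text \<open>The module axioms are equations, apart from inverses, which are images of inverses; so
  they survive a surjection that respects the operations. Preservation of zero is a separate
  premise, because deriving it from linearity would presuppose the structure of
  \<open>Q\<close>.\<close>

lemma module_transport:
  assumes M: "module R M"
    and surj: "\<And>y. y \<in> carrier Q \<Longrightarrow> \<exists>x\<in>carrier M. \<pi> x = y"
    and h: "\<pi> \<in> lin_hom R M Q" and zero: "\<pi> \<zero>\<^bsub>M\<^esub> = \<zero>\<^bsub>Q\<^esub>"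
  shows "module R Q"
proof -
  interpret M: module R M by fact
  note D = lin_homD[OF h]
  note Ds = D(2,3)[symmetric]
  have E: "\<exists>x\<in>carrier M. y = \<pi> x" if "y \<in> carrier Q" for y using surj[OF that] by blast
  show ?thesis
  proof (rule moduleI)
    show "cring R" by (rule M.R.is_cring)
    show "abelian_group Q"
    proof (rule abelian_groupI)
      fix x assume "x \<in> carrier Q"
      then obtain a where a: "a \<in> carrier M" "x = \<pi> a" using E by blast
      show "\<exists>y\<in>carrier Q. y \<oplus>\<^bsub>Q\<^esub> x = \<zero>\<^bsub>Q\<^esub>"
        by (rule bexI[of _ "\<pi> (\<ominus>\<^bsub>M\<^esub> a)"])
          (use a D(1) in \<open>auto simp: Ds zero[symmetric] M.M.l_neg\<close>)
    next
      fix x y assume "x \<in> carrier Q" "y \<in> carrier Q"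
      then obtain a b where "a \<in> carrier M" "x = \<pi> a" "b \<in> carrier M" "y = \<pi> b" using E by metis
      then show "x \<oplus>\<^bsub>Q\<^esub> y = y \<oplus>\<^bsub>Q\<^esub> x" by (simp add: Ds M.M.a_comm)
    qed (auto simp: zero[symmetric] D(1) Ds M.M.a_assoc dest!: E)
  qed (auto simp: zero[symmetric] D(1) Ds M.smult_l_distr M.smult_r_distr M.smult_assoc1 dest!: E)
qed

lemma assoc_alg_transport:
  assumes A: "assoc_alg R A"
    and surj: "\<And>y. y \<in> carrier Q \<Longrightarrow> \<exists>x\<in>carrier A. \<pi> x = y"
    and h: "\<pi> \<in> alg_hom R A Q" and zero: "\<pi> \<zero>\<^bsub>A\<^esub> = \<zero>\<^bsub>Q\<^esub>"
  shows "assoc_alg R Q"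
proof -
  interpret A: assoc_alg R A by fact
  have m: "module R Q"
    by (rule module_transport[OF A.module_axioms' surj alg_homD(1)[OF h] zero])
  interpret Q: module R Q by (rule m)
  note D = lin_homD[OF alg_homD(1)[OF h]] alg_homD(2-3)[OF h]
  note Ds = D(2-5)[symmetric]
  have E: "\<exists>x\<in>carrier A. y = \<pi> x" if "y \<in> carrier Q" for y using surj[OF that] by blast
  have r: "ring Q"
    by (rule ringI; (rule monoidI)?)
       (auto simp: Q.abelian_group_axioms D(1) Ds A.l_distr A.r_distr A.m_assoc dest!: E)
  show ?thesis
    unfolding assoc_alg_def assoc_alg_axioms_def
    using m r by (auto simp: D(1) Ds A.smult_mult_l A.smult_mult_r dest!: E)
qed

lemma ground_alg_simps [simp]:
  "carrier (ground_alg R) = carrier R" "mult (ground_alg R) = mult R" "one (ground_alg R) = one R"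
  "zero (ground_alg R) = zero R" "add (ground_alg R) = add R" "smult (ground_alg R) = mult R"
  by (simp_all add: ground_alg_def)

lemma assoc_alg_ground: "cring R \<Longrightarrow> assoc_alg R (ground_alg R)"
proof -
  assume "cring R"
  then interpret cring R .
  have 1: "abelian_group (ground_alg R)"
    by (rule abelian_groupI) (auto simp: a_ac intro: l_neg add.l_inv_ex)
  then have m: "module R (ground_alg R)"
    by (intro moduleI) (auto simp: l_distr r_distr m_assoc is_cring)
  moreover have "ring (ground_alg R)"
    using 1 by (intro ringI monoidI) (auto simp: l_distr r_distr m_assoc)
  ultimately show ?thesis
    unfolding assoc_alg_def assoc_alg_axioms_def by (auto simp: m_ac)
qed

lemma (in module) minus_eq_zero_iff:
  assumes "x \<in> carrier M" "y \<in> carrier M"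
  shows "x \<ominus>\<^bsub>M\<^esub> y = \<zero>\<^bsub>M\<^esub> \<longleftrightarrow> x = y"
proof
  assume "x \<ominus>\<^bsub>M\<^esub> y = \<zero>\<^bsub>M\<^esub>"
  then have "(x \<oplus>\<^bsub>M\<^esub> \<ominus>\<^bsub>M\<^esub> y) \<oplus>\<^bsub>M\<^esub> y = \<zero>\<^bsub>M\<^esub> \<oplus>\<^bsub>M\<^esub> y" by (simp add: a_minus_def)
  then show "x = y" using assms by (simp add: M.a_assoc M.l_neg)
qed (use assms in \<open>simp add: a_minus_def M.r_neg\<close>)

section \<open>Free modules and monoid algebras\<close>

definition lin_ext :: "('k, 'r) ring_scheme \<Rightarrow> ('k, 'p, 'm) module_scheme \<Rightarrow> ('s \<Rightarrow> 'p) \<Rightarrow>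
    ('s \<Rightarrow> 'k) \<Rightarrow> 'p" where
  "lin_ext R P g f = (\<Oplus>\<^bsub>P\<^esub>s\<in>{s. f s \<noteq> \<zero>\<^bsub>R\<^esub>}. f s \<odot>\<^bsub>P\<^esub> g s)"

lemma monoid_alg_simps [simp]:
  "add (monoid_alg R S) = (\<lambda>f g s. f s \<oplus>\<^bsub>R\<^esub> g s)"
  "zero (monoid_alg R S) = (\<lambda>s. \<zero>\<^bsub>R\<^esub>)"
  "smult (monoid_alg R S) = (\<lambda>c f s. c \<otimes>\<^bsub>R\<^esub> f s)"
  "one (monoid_alg R S) = basis_elt R \<one>\<^bsub>S\<^esub>"
  by (simp_all add: monoid_alg_def basis_elt_def fun_eq_iff)

lemma monoid_alg_carrier_iff:
  "f \<in> carrier (monoid_alg R S) \<longleftrightarrow> (\<forall>s. f s \<in> carrier R) \<and> finite {s. f s \<noteq> \<zero>\<^bsub>R\<^esub>} \<and>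
     {s. f s \<noteq> \<zero>\<^bsub>R\<^esub>} \<subseteq> carrier S"
  by (simp add: monoid_alg_def)

lemma monoid_alg_carrierD:
  assumes "f \<in> carrier (monoid_alg R S)"
  shows "f s \<in> carrier R" "finite {s. f s \<noteq> \<zero>\<^bsub>R\<^esub>}" "{s. f s \<noteq> \<zero>\<^bsub>R\<^esub>} \<subseteq> carrier S"
  using assms by (auto simp: monoid_alg_carrier_iff)

lemma (in cring) monoid_alg_carrierI:
  assumes "\<And>s. f s \<in> carrier R" "finite A" "A \<subseteq> carrier S" "\<And>s. s \<notin> A \<Longrightarrow> f s = \<zero>"
  shows "f \<in> carrier (monoid_alg R S)"
proof -
  have "{s. f s \<noteq> \<zero>} \<subseteq> A" using assms(4) by auto
  with assms show ?thesis
    unfolding monoid_alg_carrier_iff by (meson finite_subset subset_trans)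
qed

lemma (in cring) module_monoid_alg: "module R (monoid_alg R S)"
proof (rule moduleI)
  let ?F = "monoid_alg R S"
  have add: "f \<oplus>\<^bsub>?F\<^esub> g \<in> carrier ?F" if "f \<in> carrier ?F" "g \<in> carrier ?F" for f g
    using that monoid_alg_carrierD[OF that(1)] monoid_alg_carrierD[OF that(2)]
    by (intro monoid_alg_carrierI[of _ "{s. f s \<noteq> \<zero>} \<union> {s. g s \<noteq> \<zero>}"]) auto
  show smult: "c \<odot>\<^bsub>?F\<^esub> f \<in> carrier ?F" if "c \<in> carrier R" "f \<in> carrier ?F" for c f
    using that monoid_alg_carrierD[OF that(2)]
    by (intro monoid_alg_carrierI[of _ "{s. f s \<noteq> \<zero>}"]) auto
  show "cring R" by (rule is_cring)
  note D = monoid_alg_carrierD(1)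
  show "abelian_group ?F"
  proof (rule abelian_groupI)
    fix f g assume "f \<in> carrier ?F" "g \<in> carrier ?F"
    then show "f \<oplus>\<^bsub>?F\<^esub> g \<in> carrier ?F" by (rule add)
  next
    show "\<zero>\<^bsub>?F\<^esub> \<in> carrier ?F"
      by (intro monoid_alg_carrierI[of _ "{}"]) auto
  next
    fix f assume f: "f \<in> carrier ?F"
    show "\<exists>g\<in>carrier ?F. g \<oplus>\<^bsub>?F\<^esub> f = \<zero>\<^bsub>?F\<^esub>"
    proof (rule bexI)
      show "((\<ominus> \<one>) \<odot>\<^bsub>?F\<^esub> f) \<oplus>\<^bsub>?F\<^esub> f = \<zero>\<^bsub>?F\<^esub>" using D[OF f] by (auto simp: l_minus l_neg)
      show "(\<ominus> \<one>) \<odot>\<^bsub>?F\<^esub> f \<in> carrier ?F" by (rule smult[OF _ f]) simp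
    qed
  qed (auto simp: D a_ac)
qed (auto simp: monoid_alg_carrierD(1) l_distr r_distr m_assoc)

lemma (in cring) basis_elt_closed: "s \<in> carrier S \<Longrightarrow> basis_elt R s \<in> carrier (monoid_alg R S)"
  by (rule monoid_alg_carrierI[of _ "{s}"]) (auto simp: basis_elt_def)

lemma (in cring) basis_subset: "basis_elt R ` carrier S \<subseteq> carrier (monoid_alg R S)"
  by (intro image_subsetI basis_elt_closed)

lemma (in cring) basis_span:
  "submodule_span R (monoid_alg R S) (basis_elt R ` carrier S) = carrier (monoid_alg R S)"
  (is "?span = carrier ?F")
proof
  interpret F: module R ?F by (rule module_monoid_alg)
  show "?span \<subseteq> carrier ?F" by (intro span_carrier module_monoid_alg basis_subset)
  note S = submoduleD[OF span_submodule[OF module_monoid_alg basis_subset]]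
  \<comment> \<open>The induction is on a finite set containing the support rather than on the
    support itself, so that erasing the coefficient at \<open>a\<close> leaves a function covered by
    the induction hypothesis.\<close>
  have *: "f \<in> ?span" if "finite A" "A \<subseteq> carrier S" "\<And>s. f s \<in> carrier R" "{s. f s \<noteq> \<zero>} \<subseteq> A" for A f
    using that
  proof (induct A arbitrary: f)
    case empty
    then have "f = \<zero>\<^bsub>?F\<^esub>" by auto
    then show ?case using S(2)[of S] by simp
  next
    case (insert a A)
    let ?g = "f(a := \<zero>)"
    have "?g \<in> ?span" using insert by (intro insert(3)) auto
    moreover have "f a \<odot>\<^bsub>?F\<^esub> basis_elt R a \<in> ?span"
      using insert by (intro S(4) span_base) auto
    moreover have "f = ?g \<oplus>\<^bsub>?F\<^esub> f a \<odot>\<^bsub>?F\<^esub> basis_elt R a"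
      using insert(5) by (auto simp: basis_elt_def)
    ultimately show ?case using S(3)[of ?g S] by metis
  qed
  show "carrier ?F \<subseteq> ?span"
    by (rule subsetI) (rule *[OF _ _ _ subset_refl]; erule monoid_alg_carrierD)
qed

text \<open>Supports change under addition and scaling. Once the support is replaced by a common
  finite superset, sums for different functions can be compared term by term.\<close>

lemma (in module) lin_ext_eq:
  assumes "finite A" "{s. f s \<noteq> \<zero>\<^bsub>R\<^esub>} \<subseteq> A" "\<And>s. s \<in> A \<Longrightarrow> g s \<in> carrier M" "\<And>s. f s \<in> carrier R"
  shows "lin_ext R M g f = (\<Oplus>\<^bsub>M\<^esub>s\<in>A. f s \<odot>\<^bsub>M\<^esub> g s)"
  unfolding lin_ext_def using assms
  by (intro M.add.finprod_mono_neutral_cong_left) auto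

lemma (in module) lin_ext_lin:
  assumes g: "\<And>s. s \<in> carrier S \<Longrightarrow> g s \<in> carrier M"
  shows "lin_ext R M g \<in> lin_hom R (monoid_alg R S) M"
proof (rule lin_homI)
  let ?F = "monoid_alg R S"
  interpret F: module R ?F by (rule R.module_monoid_alg)
  fix f assume f: "f \<in> carrier ?F"
  note f' = monoid_alg_carrierD[OF f]
  have E: "lin_ext R M g f = (\<Oplus>\<^bsub>M\<^esub>s\<in>A. f s \<odot>\<^bsub>M\<^esub> g s)"
    if "finite A" "{s. f s \<noteq> \<zero>\<^bsub>R\<^esub>} \<subseteq> A" "A \<subseteq> carrier S" "f \<in> carrier ?F" for A f
    using that g monoid_alg_carrierD[OF that(4)] by (intro lin_ext_eq) auto
  show "lin_ext R M g f \<in> carrier M"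
    using f' g by (subst E[OF f'(2) _ _ f]) (auto intro!: M.finsum_closed)
  show "lin_ext R M g (c \<odot>\<^bsub>?F\<^esub> f) = c \<odot>\<^bsub>M\<^esub> lin_ext R M g f" if c: "c \<in> carrier R" for c
  proof -
    have "lin_ext R M g (c \<odot>\<^bsub>?F\<^esub> f) = (\<Oplus>\<^bsub>M\<^esub>s\<in>{s. f s \<noteq> \<zero>\<^bsub>R\<^esub>}. (c \<otimes>\<^bsub>R\<^esub> f s) \<odot>\<^bsub>M\<^esub> g s)"
      using f' c F.smult_closed[OF c f] by (subst E[OF f'(2)]) auto
    also have "\<dots> = (\<Oplus>\<^bsub>M\<^esub>s\<in>{s. f s \<noteq> \<zero>\<^bsub>R\<^esub>}. c \<odot>\<^bsub>M\<^esub> (f s \<odot>\<^bsub>M\<^esub> g s))"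
      using f' g c by (intro M.finsum_cong') (auto simp: smult_assoc1)
    also have "\<dots> = c \<odot>\<^bsub>M\<^esub> lin_ext R M g f"
      unfolding lin_ext_def using f' g c by (intro finsum_smult_ldistr[symmetric]) auto
    finally show ?thesis .
  qed
  fix h assume h: "h \<in> carrier ?F"
  note h' = monoid_alg_carrierD[OF h]
  let ?A = "{s. f s \<noteq> \<zero>\<^bsub>R\<^esub>} \<union> {s. h s \<noteq> \<zero>\<^bsub>R\<^esub>}"
  have A: "finite ?A" "?A \<subseteq> carrier S" using f' h' by auto
  have "lin_ext R M g (f \<oplus>\<^bsub>?F\<^esub> h) = (\<Oplus>\<^bsub>M\<^esub>s\<in>?A. (f s \<oplus>\<^bsub>R\<^esub> h s) \<odot>\<^bsub>M\<^esub> g s)"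
    using f' h' F.M.a_closed[OF f h] by (subst E[OF A(1) _ A(2)]) auto
  also have "\<dots> = (\<Oplus>\<^bsub>M\<^esub>s\<in>?A. f s \<odot>\<^bsub>M\<^esub> g s \<oplus>\<^bsub>M\<^esub> h s \<odot>\<^bsub>M\<^esub> g s)"
    using f' h' g A(2) by (intro M.finsum_cong') (auto simp: smult_l_distr subset_iff)
  also have "\<dots> = lin_ext R M g f \<oplus>\<^bsub>M\<^esub> lin_ext R M g h"
    using f' h' g A(2)
    by (subst (1 2) E[OF A(1) _ A(2)]) (auto intro!: M.finsum_addf simp: f h subset_iff)
  finally show "lin_ext R M g (f \<oplus>\<^bsub>?F\<^esub> h) = lin_ext R M g f \<oplus>\<^bsub>M\<^esub> lin_ext R M g h" .
qed

lemma (in module) lin_ext_basis: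
  assumes "g s \<in> carrier M"
  shows "lin_ext R M g (basis_elt R s) = g s"
proof -
  have "lin_ext R M g (basis_elt R s) = (\<Oplus>\<^bsub>M\<^esub>t\<in>{s}. basis_elt R s t \<odot>\<^bsub>M\<^esub> g t)"
    using assms by (intro lin_ext_eq) (auto simp: basis_elt_def)
  then show ?thesis using assms by (simp add: basis_elt_def)
qed

text \<open>The index set of the defining convolution depends on \<open>f\<close>, \<open>g\<close>
  and \<open>s\<close>. Over a fixed finite rectangle, bilinearity can be read off term by
  term.\<close>

lemma (in cring) monoid_alg_mult_eq:
  assumes "finite A" "finite B" "{s. f s \<noteq> \<zero>} \<subseteq> A" "{s. g s \<noteq> \<zero>} \<subseteq> B"
    "\<And>s. f s \<in> carrier R" "\<And>s. g s \<in> carrier R"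
  shows "(f \<otimes>\<^bsub>monoid_alg R S\<^esub> g) s =
    (\<Oplus>p\<in>A \<times> B. if fst p \<otimes>\<^bsub>S\<^esub> snd p = s then f (fst p) \<otimes> g (snd p) else \<zero>)"
proof -
  have "{(a, b). f a \<noteq> \<zero> \<and> g b \<noteq> \<zero> \<and> a \<otimes>\<^bsub>S\<^esub> b = s} \<subseteq> A \<times> B" using assms by auto
  then show ?thesis
    using assms by (simp add: monoid_alg_def)
      (intro add.finprod_mono_neutral_cong_left; auto)
qed

lemma (in cring) monoid_alg_mult_closed:
  assumes S: "monoid S" and f: "f \<in> carrier (monoid_alg R S)" and g: "g \<in> carrier (monoid_alg R S)"
  shows "f \<otimes>\<^bsub>monoid_alg R S\<^esub> g \<in> carrier (monoid_alg R S)"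
proof -
  note f' = monoid_alg_carrierD[OF f] and g' = monoid_alg_carrierD[OF g]
  let ?A = "{s. f s \<noteq> \<zero>}" and ?B = "{s. g s \<noteq> \<zero>}"
  let ?C = "(\<lambda>p. fst p \<otimes>\<^bsub>S\<^esub> snd p) ` (?A \<times> ?B)"
  note E = monoid_alg_mult_eq[OF f'(2) g'(2) subset_refl subset_refl f'(1) g'(1)]
  show ?thesis
  proof (rule monoid_alg_carrierI[of _ ?C])
    show "(f \<otimes>\<^bsub>monoid_alg R S\<^esub> g) s \<in> carrier R" for s
      unfolding E using f' g' by (intro finsum_closed) auto
    show "?C \<subseteq> carrier S"
    proof
      fix s assume "s \<in> ?C"
      then obtain a b where "a \<in> ?A" "b \<in> ?B" "s = a \<otimes>\<^bsub>S\<^esub> b" by auto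
      then show "s \<in> carrier S" using subsetD[OF f'(3)] subsetD[OF g'(3)] monoid.m_closed[OF S] by metis
    qed
    show "(f \<otimes>\<^bsub>monoid_alg R S\<^esub> g) s = \<zero>" if "s \<notin> ?C" for s
    proof -
      have "(\<Oplus>p\<in>?A \<times> ?B. if fst p \<otimes>\<^bsub>S\<^esub> snd p = s then f (fst p) \<otimes> g (snd p) else \<zero>)
        = (\<Oplus>p\<in>?A \<times> ?B. \<zero>)"
        using that by (intro finsum_cong') auto
      then show ?thesis unfolding E by simp
    qed
  qed (use f' g' in auto)
qed

lemma (in cring) monoid_alg_bilin:
  assumes S: "monoid S"
  shows "bilin_map R (monoid_alg R S) (monoid_alg R S) (monoid_alg R S) (mult (monoid_alg R S))"
proof (rule bilin_mapI)
  let ?F = "monoid_alg R S"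
  note D = monoid_alg_carrierD
  have fin: "finite {s. f s \<noteq> \<zero>}" if "f \<in> carrier ?F" for f using D(2)[OF that] .
  fix f assume f: "f \<in> carrier ?F"
  show "(\<lambda>g. g \<otimes>\<^bsub>?F\<^esub> f) \<in> lin_hom R ?F ?F"
  proof (rule lin_homI)
    fix g assume g: "g \<in> carrier ?F"
    show "g \<otimes>\<^bsub>?F\<^esub> f \<in> carrier ?F" by (rule monoid_alg_mult_closed[OF S g f])
    show "(c \<odot>\<^bsub>?F\<^esub> g) \<otimes>\<^bsub>?F\<^esub> f = c \<odot>\<^bsub>?F\<^esub> (g \<otimes>\<^bsub>?F\<^esub> f)" if c: "c \<in> carrier R" for c
    proof
      fix s
      note E = monoid_alg_mult_eq[OF fin[OF g] fin[OF f] _ subset_refl _ D(1)[OF f]]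
      show "((c \<odot>\<^bsub>?F\<^esub> g) \<otimes>\<^bsub>?F\<^esub> f) s = (c \<odot>\<^bsub>?F\<^esub> (g \<otimes>\<^bsub>?F\<^esub> f)) s"
        using c D(1)[OF f] D(1)[OF g] fin[OF f] fin[OF g]
        apply (subst E, force, force)
        apply (simp, subst E, simp, simp)
        apply (subst finsum_rdistr, simp, simp, force)
        apply (intro finsum_cong', auto simp: m_assoc)
        done
    qed
    fix h assume h: "h \<in> carrier ?F"
    show "(g \<oplus>\<^bsub>?F\<^esub> h) \<otimes>\<^bsub>?F\<^esub> f = (g \<otimes>\<^bsub>?F\<^esub> f) \<oplus>\<^bsub>?F\<^esub> (h \<otimes>\<^bsub>?F\<^esub> f)"
    proof
      fix s
      let ?A = "{s. g s \<noteq> \<zero>} \<union> {s. h s \<noteq> \<zero>}"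
      have A: "finite ?A" using fin[OF g] fin[OF h] by simp
      note E = monoid_alg_mult_eq[OF A fin[OF f] _ subset_refl _ D(1)[OF f]]
      show "((g \<oplus>\<^bsub>?F\<^esub> h) \<otimes>\<^bsub>?F\<^esub> f) s = ((g \<otimes>\<^bsub>?F\<^esub> f) \<oplus>\<^bsub>?F\<^esub> (h \<otimes>\<^bsub>?F\<^esub> f)) s"
        using D(1)[OF f] D(1)[OF g] D(1)[OF h] fin[OF f] A
        apply (subst E, force, force)
        apply (simp, subst E, force, simp)
        apply (subst E, force, simp)
        apply (subst finsum_addf[symmetric], force, force)
        apply (intro finsum_cong', auto simp: l_distr)
        done
    qed
  qed
  show "(\<lambda>g. f \<otimes>\<^bsub>?F\<^esub> g) \<in> lin_hom R ?F ?F"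
  proof (rule lin_homI)
    fix g assume g: "g \<in> carrier ?F"
    show "f \<otimes>\<^bsub>?F\<^esub> g \<in> carrier ?F" by (rule monoid_alg_mult_closed[OF S f g])
    show "f \<otimes>\<^bsub>?F\<^esub> (c \<odot>\<^bsub>?F\<^esub> g) = c \<odot>\<^bsub>?F\<^esub> (f \<otimes>\<^bsub>?F\<^esub> g)" if c: "c \<in> carrier R" for c
    proof
      fix s
      note E = monoid_alg_mult_eq[OF fin[OF f] fin[OF g] subset_refl _ D(1)[OF f]]
      show "(f \<otimes>\<^bsub>?F\<^esub> (c \<odot>\<^bsub>?F\<^esub> g)) s = (c \<odot>\<^bsub>?F\<^esub> (f \<otimes>\<^bsub>?F\<^esub> g)) s"
        using c D(1)[OF f] D(1)[OF g] fin[OF f] fin[OF g]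
        apply (subst E, force, force)
        apply (simp, subst E, simp, simp)
        apply (subst finsum_rdistr, simp, simp, force)
        apply (intro finsum_cong', auto simp: m_lcomm)
        done
    qed
    fix h assume h: "h \<in> carrier ?F"
    show "f \<otimes>\<^bsub>?F\<^esub> (g \<oplus>\<^bsub>?F\<^esub> h) = (f \<otimes>\<^bsub>?F\<^esub> g) \<oplus>\<^bsub>?F\<^esub> (f \<otimes>\<^bsub>?F\<^esub> h)"
    proof
      fix s
      let ?A = "{s. g s \<noteq> \<zero>} \<union> {s. h s \<noteq> \<zero>}"
      have A: "finite ?A" using fin[OF g] fin[OF h] by simp
      note E = monoid_alg_mult_eq[OF fin[OF f] A subset_refl _ D(1)[OF f]]
      show "(f \<otimes>\<^bsub>?F\<^esub> (g \<oplus>\<^bsub>?F\<^esub> h)) s = ((f \<otimes>\<^bsub>?F\<^esub> g) \<oplus>\<^bsub>?F\<^esub> (f \<otimes>\<^bsub>?F\<^esub> h)) s"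
        using D(1)[OF f] D(1)[OF g] D(1)[OF h] fin[OF f] A
        apply (subst E, force, force)
        apply (simp, subst E, force, simp)
        apply (subst E, force, simp)
        apply (subst finsum_addf[symmetric], force, force)
        apply (intro finsum_cong', auto simp: r_distr)
        done
    qed
  qed
qed

lemma (in cring) basis_mult:
  "basis_elt R a \<otimes>\<^bsub>monoid_alg R S\<^esub> basis_elt R b = basis_elt R (a \<otimes>\<^bsub>S\<^esub> b)"
proof
  fix s
  have "(basis_elt R a \<otimes>\<^bsub>monoid_alg R S\<^esub> basis_elt R b) s =
      (\<Oplus>p\<in>{a} \<times> {b}. if fst p \<otimes>\<^bsub>S\<^esub> snd p = s then basis_elt R a (fst p) \<otimes> basis_elt R b (snd p) else \<zero>)"
    by (rule monoid_alg_mult_eq) (auto simp: basis_elt_def)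
  then show "(basis_elt R a \<otimes>\<^bsub>monoid_alg R S\<^esub> basis_elt R b) s = basis_elt R (a \<otimes>\<^bsub>S\<^esub> b) s"
    by (auto simp: basis_elt_def)
qed

lemma (in cring) assoc_alg_monoid_alg:
  assumes S: "monoid S"
  shows "assoc_alg R (monoid_alg R S)"
proof -
  let ?F = "monoid_alg R S"
  interpret S: monoid S by fact
  interpret F: module R ?F by (rule module_monoid_alg)
  note mF = module_monoid_alg[of S]
  note bil = monoid_alg_bilin[OF S]
  note L = bilin_mapD(1)[OF bil] and Rr = bilin_mapD(3)[OF bil]
  note eqI = lin_hom_eq_on_span[OF _ _ mF mF basis_subset, unfolded basis_span]
  have cl: "f \<otimes>\<^bsub>?F\<^esub> g \<in> carrier ?F" if "f \<in> carrier ?F" "g \<in> carrier ?F" for f g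
    using monoid_alg_mult_closed[OF S that] .
  \<comment> \<open>Associativity is trilinear. Each variable in turn is reduced to a basis element,
    where the claim is associativity in \<open>S\<close>.\<close>
  have "(f \<otimes>\<^bsub>?F\<^esub> g) \<otimes>\<^bsub>?F\<^esub> h = f \<otimes>\<^bsub>?F\<^esub> (g \<otimes>\<^bsub>?F\<^esub> h)"
    if f: "f \<in> carrier ?F" and g: "g \<in> carrier ?F" and h: "h \<in> carrier ?F" for f g h
  proof (rule eqI[OF _ _ _ f])
    show "(\<lambda>f. (f \<otimes>\<^bsub>?F\<^esub> g) \<otimes>\<^bsub>?F\<^esub> h) \<in> lin_hom R ?F ?F" by (rule lin_hom_comp[OF L[OF g] L[OF h]])
    show "(\<lambda>f. f \<otimes>\<^bsub>?F\<^esub> (g \<otimes>\<^bsub>?F\<^esub> h)) \<in> lin_hom R ?F ?F" by (rule L[OF cl[OF g h]])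
    fix f assume "f \<in> basis_elt R ` carrier S"
    then obtain a where a: "a \<in> carrier S" "f = basis_elt R a" by auto
    then have f: "f \<in> carrier ?F" by (simp add: basis_elt_closed)
    show "(f \<otimes>\<^bsub>?F\<^esub> g) \<otimes>\<^bsub>?F\<^esub> h = f \<otimes>\<^bsub>?F\<^esub> (g \<otimes>\<^bsub>?F\<^esub> h)"
    proof (rule eqI[OF _ _ _ g])
      show "(\<lambda>g. (f \<otimes>\<^bsub>?F\<^esub> g) \<otimes>\<^bsub>?F\<^esub> h) \<in> lin_hom R ?F ?F" by (rule lin_hom_comp[OF Rr[OF f] L[OF h]])
      show "(\<lambda>g. f \<otimes>\<^bsub>?F\<^esub> (g \<otimes>\<^bsub>?F\<^esub> h)) \<in> lin_hom R ?F ?F" by (rule lin_hom_comp[OF L[OF h] Rr[OF f]])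
      fix g assume "g \<in> basis_elt R ` carrier S"
      then obtain b where b: "b \<in> carrier S" "g = basis_elt R b" by auto
      then have g: "g \<in> carrier ?F" by (simp add: basis_elt_closed)
      show "(f \<otimes>\<^bsub>?F\<^esub> g) \<otimes>\<^bsub>?F\<^esub> h = f \<otimes>\<^bsub>?F\<^esub> (g \<otimes>\<^bsub>?F\<^esub> h)"
      proof (rule eqI[OF _ _ _ h])
        show "(\<lambda>h. (f \<otimes>\<^bsub>?F\<^esub> g) \<otimes>\<^bsub>?F\<^esub> h) \<in> lin_hom R ?F ?F" by (rule Rr[OF cl[OF f g]])
        show "(\<lambda>h. f \<otimes>\<^bsub>?F\<^esub> (g \<otimes>\<^bsub>?F\<^esub> h)) \<in> lin_hom R ?F ?F" by (rule lin_hom_comp[OF Rr[OF g] Rr[OF f]])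
        fix h assume "h \<in> basis_elt R ` carrier S"
        then obtain c where "c \<in> carrier S" "h = basis_elt R c" by auto
        then show "(f \<otimes>\<^bsub>?F\<^esub> g) \<otimes>\<^bsub>?F\<^esub> h = f \<otimes>\<^bsub>?F\<^esub> (g \<otimes>\<^bsub>?F\<^esub> h)"
          using a b by (simp add: basis_mult S.m_assoc)
      qed
    qed
  qed
  moreover have one: "\<one>\<^bsub>?F\<^esub> \<in> carrier ?F" by (simp add: basis_elt_closed)
  moreover have "\<one>\<^bsub>?F\<^esub> \<otimes>\<^bsub>?F\<^esub> f = f" "f \<otimes>\<^bsub>?F\<^esub> \<one>\<^bsub>?F\<^esub> = f" if f: "f \<in> carrier ?F" for f
  proof -
    have id: "(\<lambda>f. f) \<in> lin_hom R ?F ?F" by (intro lin_homI) auto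
    show "\<one>\<^bsub>?F\<^esub> \<otimes>\<^bsub>?F\<^esub> f = f"
      by (rule eqI[OF Rr[OF one] id _ f]) (auto simp: basis_mult)
    show "f \<otimes>\<^bsub>?F\<^esub> \<one>\<^bsub>?F\<^esub> = f"
      by (rule eqI[OF L[OF one] id _ f]) (auto simp: basis_mult)
  qed
  moreover note LD = lin_homD[OF L] and RD = lin_homD[OF Rr]
  ultimately have "ring ?F"
    by (intro ringI monoidI F.M.abelian_group_axioms cl LD(2) RD(2)) auto
  then show ?thesis
    unfolding assoc_alg_def assoc_alg_axioms_def
    using mF LD(3) RD(3) by blast
qed

lemma lin_ext_alg_hom:
  assumes A: "assoc_alg R A" and S: "monoid S"
    and g: "\<And>s. s \<in> carrier S \<Longrightarrow> g s \<in> carrier A"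
    and one: "g \<one>\<^bsub>S\<^esub> = \<one>\<^bsub>A\<^esub>"
    and mult: "\<And>s t. \<lbrakk>s \<in> carrier S; t \<in> carrier S\<rbrakk> \<Longrightarrow> g (s \<otimes>\<^bsub>S\<^esub> t) = g s \<otimes>\<^bsub>A\<^esub> g t"
  shows "lin_ext R A g \<in> alg_hom R (monoid_alg R S) A"
proof -
  interpret A: assoc_alg R A by fact
  interpret S: monoid S by fact
  show ?thesis
    by (rule alg_hom_multI_span[OF A.lin_ext_lin[OF g] A.R.assoc_alg_monoid_alg[OF S] A
          A.R.basis_subset A.R.basis_span])
      (auto simp: A.lin_ext_basis g one mult A.R.basis_mult)
qed

section \<open>Quotients\<close>

text \<open>Evaluation at a chosen representative, with the same choice that
  \<open>tensor_lift\<close> makes. The lift of a bilinear map thus becomes an instance of a map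
  induced on a quotient.\<close>

definition coset_map :: "('a \<Rightarrow> 'b) \<Rightarrow> 'a set \<Rightarrow> 'b" where
  "coset_map h X = h (SOME x. x \<in> X)"

lemma quot_alg_simps:
  "carrier (quot_alg A I) = a_rcosets\<^bsub>A\<^esub> I" "mult (quot_alg A I) = rcoset_mult A I"
  "one (quot_alg A I) = I +>\<^bsub>A\<^esub> \<one>\<^bsub>A\<^esub>" "zero (quot_alg A I) = I" "add (quot_alg A I) = set_add A"
  "smult (quot_alg A I) = (\<lambda>c X. \<Union>x\<in>X. I +>\<^bsub>A\<^esub> (c \<odot>\<^bsub>A\<^esub> x))"
  by (simp_all add: quot_alg_def)

locale mod_quot = module R A + I: submodule I R A for R (structure) and A (structure) and I
begin

lemma abelian_subgroup_I: "abelian_subgroup I A"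
  by (intro abelian_subgroupI3 additive_subgroupI I.subgroup_axioms M.abelian_group_axioms)

sublocale Q: abelian_subgroup I A by (rule abelian_subgroup_I)

lemma module_A: "module R A" ..

lemma submodule_I: "submodule I R A" ..

abbreviation "Q \<equiv> quot_alg A I"
abbreviation "\<pi> x \<equiv> I +>\<^bsub>A\<^esub> x"

lemma proj_closed: "x \<in> carrier A \<Longrightarrow> \<pi> x \<in> carrier Q"
  by (simp add: quot_alg_simps M.a_rcosetsI Q.a_subset)

lemma proj_surj: "X \<in> carrier Q \<Longrightarrow> \<exists>x\<in>carrier A. \<pi> x = X"
  by (auto simp: quot_alg_simps A_RCOSETS_def')

lemma carrier_Q: "carrier Q = \<pi> ` carrier A"
  using proj_closed proj_surj by blast

lemma proj_eq_iff:
  assumes "x \<in> carrier A" "y \<in> carrier A"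
  shows "\<pi> x = \<pi> y \<longleftrightarrow> x \<ominus>\<^bsub>A\<^esub> y \<in> I"
  using assms Q.a_rcos_module[of y x] Q.a_rcos_self Q.a_repr_independence'
  unfolding a_minus_def by metis

lemma proj_zero_iff: "x \<in> carrier A \<Longrightarrow> \<pi> x = I \<longleftrightarrow> x \<in> I"
  by (metis Q.a_rcos_const Q.a_rcos_self)

lemma proj_self: "x \<in> carrier A \<Longrightarrow> x \<in> \<pi> x"
  by (rule Q.a_rcos_self)

lemma mem_projD: "y \<in> \<pi> x \<Longrightarrow> x \<in> carrier A \<Longrightarrow> y \<in> carrier A \<and> \<pi> y = \<pi> x"
  using Q.a_repr_independence' Q.a_elemrcos_carrier by metis

text \<open>Scaling keeps differences inside \<open>I\<close>, so the union in the definition of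
  \<open>quot_alg\<close> runs over a constant family of cosets.\<close>

lemma proj_smult:
  assumes "c \<in> carrier R" "x \<in> carrier A"
  shows "c \<odot>\<^bsub>Q\<^esub> \<pi> x = \<pi> (c \<odot>\<^bsub>A\<^esub> x)"
proof -
  have *: "\<pi> (c \<odot>\<^bsub>A\<^esub> y) = \<pi> (c \<odot>\<^bsub>A\<^esub> x)" if "y \<in> \<pi> x" for y
  proof -
    have y: "y \<in> carrier A" "y \<ominus>\<^bsub>A\<^esub> x \<in> I"
      using mem_projD[OF that] proj_eq_iff[of y x] assms by blast+
    have "c \<odot>\<^bsub>A\<^esub> (y \<ominus>\<^bsub>A\<^esub> x) \<in> I" using y assms by blast
    then show ?thesis
      using y assms by (subst proj_eq_iff) (auto simp: a_minus_def smult_r_distr smult_r_minus)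
  qed
  show ?thesis
    unfolding quot_alg_simps by (rule UN_constant_eq[OF proj_self[OF assms(2)]]) (rule ballI, rule *)
qed

lemma proj_lin: "\<pi> \<in> lin_hom R A Q"
  by (rule lin_homI) (simp_all add: proj_closed proj_smult[symmetric], simp add: quot_alg_simps Q.a_rcos_sum)

lemma proj_zero: "\<pi> \<zero>\<^bsub>A\<^esub> = \<zero>\<^bsub>Q\<^esub>"
  using proj_zero_iff[OF M.zero_closed] Q.zero_closed by (simp add: quot_alg_simps)

lemma module_Q: "module R Q"
  by (rule module_transport[OF module_A proj_surj proj_lin proj_zero])

text \<open>The chosen representative differs from \<open>x\<close> by an element of
  \<open>I\<close>, which \<open>h\<close> kills.\<close>

lemma coset_map_proj:
  assumes h: "h \<in> lin_hom R A P" and P: "module R P" and ker: "\<And>x. x \<in> I \<Longrightarrow> h x = \<zero>\<^bsub>P\<^esub>"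
    and x: "x \<in> carrier A"
  shows "coset_map h (\<pi> x) = h x"
proof -
  interpret P: module R P by fact
  define y where "y = (SOME y. y \<in> \<pi> x)"
  have "y \<in> \<pi> x" unfolding y_def using proj_self[OF x] by (rule someI)
  from mem_projD[OF this x] have y: "y \<in> carrier A" "y \<ominus>\<^bsub>A\<^esub> x \<in> I"
    using proj_eq_iff[of y x] x by blast+
  have "h y \<ominus>\<^bsub>P\<^esub> h x = \<zero>\<^bsub>P\<^esub>"
    using ker[OF y(2)] lin_hom_minus[OF h module_A P y(1) x] by simp
  then have "h y = h x"
    using lin_homD(1)[OF h] x y by (simp add: P.minus_eq_zero_iff)
  then show ?thesis by (simp add: coset_map_def y_def)
qed

lemma coset_map_lin:
  assumes h: "h \<in> lin_hom R A P" and P: "module R P" and ker: "\<And>x. x \<in> I \<Longrightarrow> h x = \<zero>\<^bsub>P\<^esub>"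
  shows "coset_map h \<in> lin_hom R Q P"
proof -
  note E = coset_map_proj[OF assms]
  note p = lin_homD(2,3)[OF proj_lin, symmetric]
  note h' = lin_homD[OF h]
  show ?thesis
    by (rule lin_homI) (auto simp: carrier_Q p E h')
qed

lemma proj_span:
  assumes "X \<subseteq> carrier A"
  shows "\<pi> ` submodule_span R A X = submodule_span R Q (\<pi> ` X)"
  by (rule lin_hom_image_span[OF proj_lin module_A module_Q assms])

end

locale alg_quot = assoc_alg R A + I: ideal I A for R (structure) and A (structure) and I
begin

text \<open>A ring ideal is closed under scalars because c x = (c 1) x.\<close>

lemma submodule_I: "submodule I R A"
proof (rule submoduleI')
  fix c x assume c: "c \<in> carrier R" "x \<in> I"
  then have "(c \<odot>\<^bsub>A\<^esub> \<one>\<^bsub>A\<^esub>) \<otimes>\<^bsub>A\<^esub> x \<in> I" by (intro I.I_l_closed) auto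
  moreover have "x \<in> carrier A" using c(2) by (rule I.a_Hcarr)
  ultimately show "c \<odot>\<^bsub>A\<^esub> x \<in> I" using c by (simp add: smult_mult_l)
qed (auto intro: I.a_Hcarr)

sublocale mod_quot R A I
  by (intro mod_quot.intro submodule_I module_axioms')

lemma proj_alg_hom: "\<pi> \<in> alg_hom R A Q"
  by (rule alg_homI[OF proj_lin]) (auto simp: quot_alg_simps I.rcoset_mult_add)

lemma assoc_alg_Q: "assoc_alg R Q"
  by (rule assoc_alg_transport[OF assoc_alg_axioms proj_surj proj_alg_hom proj_zero])

lemma coset_map_alg_hom:
  assumes h: "h \<in> alg_hom R A P" and P: "module R P" and ker: "\<And>x. x \<in> I \<Longrightarrow> h x = \<zero>\<^bsub>P\<^esub>"
  shows "coset_map h \<in> alg_hom R Q P"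
proof -
  note E = coset_map_proj[OF alg_homD(1)[OF h] P ker]
  note p = alg_homD(2,3)[OF proj_alg_hom, symmetric]
  show ?thesis
    by (rule alg_homI[OF coset_map_lin[OF alg_homD(1)[OF h] P ker]])
      (auto simp: carrier_Q p E alg_homD[OF h])
qed

end

section \<open>Tensor products\<close>

lemma (in module) zero_submodule: "submodule {\<zero>\<^bsub>M\<^esub>} R M"
  by (rule submoduleI') auto

lemma (in module) minus_self: "x \<in> carrier M \<Longrightarrow> x \<ominus>\<^bsub>M\<^esub> x = \<zero>\<^bsub>M\<^esub>"
  by (simp add: minus_eq_zero_iff)

lemma (in module) m_minus_closed: "x \<in> carrier M \<Longrightarrow> y \<in> carrier M \<Longrightarrow> x \<ominus>\<^bsub>M\<^esub> y \<in> carrier M"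
  by (simp add: a_minus_def)

locale two_modules = A: module R A + B: module R B for R (structure) and A and B
begin

abbreviation "F \<equiv> monoid_alg R (A \<times>\<times> B)"
abbreviation "e a b \<equiv> basis_elt R (a, b)"

lemma moduleF: "module R F"
  by (rule A.R.module_monoid_alg)

sublocale F: module R F
  by (rule moduleF)

lemma e_closed: "a \<in> carrier A \<Longrightarrow> b \<in> carrier B \<Longrightarrow> e a b \<in> carrier F"
  by (rule A.R.basis_elt_closed) simp

lemma bilinear_rels_cases:
  assumes "r \<in> bilinear_rels R A B"
  obtains (add1) a a' b where "a \<in> carrier A" "a' \<in> carrier A" "b \<in> carrier B"
      "r = e (a \<oplus>\<^bsub>A\<^esub> a') b \<ominus>\<^bsub>F\<^esub> (e a b \<oplus>\<^bsub>F\<^esub> e a' b)"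
    | (add2) a b b' where "a \<in> carrier A" "b \<in> carrier B" "b' \<in> carrier B"
      "r = e a (b \<oplus>\<^bsub>B\<^esub> b') \<ominus>\<^bsub>F\<^esub> (e a b \<oplus>\<^bsub>F\<^esub> e a b')"
    | (smult1) c a b where "c \<in> carrier R" "a \<in> carrier A" "b \<in> carrier B"
      "r = e (c \<odot>\<^bsub>A\<^esub> a) b \<ominus>\<^bsub>F\<^esub> (c \<odot>\<^bsub>F\<^esub> e a b)"
    | (smult2) c a b where "c \<in> carrier R" "a \<in> carrier A" "b \<in> carrier B"
      "r = e a (c \<odot>\<^bsub>B\<^esub> b) \<ominus>\<^bsub>F\<^esub> (c \<odot>\<^bsub>F\<^esub> e a b)"
proof -
  from assms show thesis
    unfolding bilinear_rels_def Let_def Un_iff mem_Collect_eq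
    by (elim disjE exE conjE)
      ((rule add1; assumption), (rule add2; assumption), (rule smult1; assumption), (rule smult2; assumption))
qed

lemma bilinear_relsI:
  "\<lbrakk>a \<in> carrier A; a' \<in> carrier A; b \<in> carrier B\<rbrakk> \<Longrightarrow>
    e (a \<oplus>\<^bsub>A\<^esub> a') b \<ominus>\<^bsub>F\<^esub> (e a b \<oplus>\<^bsub>F\<^esub> e a' b) \<in> bilinear_rels R A B"
  "\<lbrakk>a \<in> carrier A; b \<in> carrier B; b' \<in> carrier B\<rbrakk> \<Longrightarrow>
    e a (b \<oplus>\<^bsub>B\<^esub> b') \<ominus>\<^bsub>F\<^esub> (e a b \<oplus>\<^bsub>F\<^esub> e a b') \<in> bilinear_rels R A B"
  "\<lbrakk>c \<in> carrier R; a \<in> carrier A; b \<in> carrier B\<rbrakk> \<Longrightarrow>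
    e (c \<odot>\<^bsub>A\<^esub> a) b \<ominus>\<^bsub>F\<^esub> (c \<odot>\<^bsub>F\<^esub> e a b) \<in> bilinear_rels R A B"
  "\<lbrakk>c \<in> carrier R; a \<in> carrier A; b \<in> carrier B\<rbrakk> \<Longrightarrow>
    e a (c \<odot>\<^bsub>B\<^esub> b) \<ominus>\<^bsub>F\<^esub> (c \<odot>\<^bsub>F\<^esub> e a b) \<in> bilinear_rels R A B"
  unfolding bilinear_rels_def Let_def Un_iff mem_Collect_eq by metis+

lemma bilinear_rels_subset: "bilinear_rels R A B \<subseteq> carrier F"
proof
  fix r assume "r \<in> bilinear_rels R A B"
  then show "r \<in> carrier F"
    by (cases rule: bilinear_rels_cases)
      (simp_all only: F.m_minus_closed F.M.a_closed F.smult_closed e_closed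
        A.M.a_closed B.M.a_closed A.smult_closed B.smult_closed)
qed

sublocale T: mod_quot R F "tensor_rels R A B"
  unfolding tensor_rels_def
  by (intro mod_quot.intro span_submodule moduleF bilinear_rels_subset)

lemma module_T: "module R (tensor R A B)"
  unfolding tensor_def by (rule T.module_Q)

sublocale T': module R "tensor R A B"
  by (rule module_T)

lemma proj_lin: "(+>\<^bsub>F\<^esub>) (tensor_rels R A B) \<in> lin_hom R F (tensor R A B)"
  unfolding tensor_def by (rule T.proj_lin)

text \<open>Each generating relation is the difference of the two sides of one bilinearity law for
  the map (a, b) to \<open>h (e a b)\<close>, so \<open>h\<close> kills it, and then kills the
  span.\<close>

lemma rels_vanish:
  assumes h: "h \<in> lin_hom R F P" and P: "module R P"
    and bil: "bilin_map R A B P (\<lambda>a b. h (e a b))" and r: "r \<in> tensor_rels R A B"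
  shows "h r = \<zero>\<^bsub>P\<^esub>"
proof -
  interpret P: module R P by fact
  note hD = lin_homD[OF h] and hm = lin_hom_minus[OF h moduleF P]
  note l = lin_homD[OF bilin_mapD(1)[OF bil]] and r' = lin_homD[OF bilin_mapD(3)[OF bil]]
  have "h r \<in> {\<zero>\<^bsub>P\<^esub>}" if "r \<in> bilinear_rels R A B" for r
    using that
  proof (cases rule: bilinear_rels_cases)
    case add1
    show ?thesis
      by (simp only: add1 hm hD l F.M.a_closed e_closed A.M.a_closed)
        (simp add: add1 P.minus_self P.M.a_closed hD e_closed del: monoid_alg_simps)
  next
    case add2
    show ?thesis
      by (simp only: add2 hm hD r' F.M.a_closed e_closed B.M.a_closed)
        (simp add: add2 P.minus_self P.M.a_closed hD e_closed del: monoid_alg_simps)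
  next
    case smult1
    show ?thesis
      by (simp only: smult1 hm hD l F.smult_closed e_closed A.smult_closed)
        (simp add: smult1 P.minus_self hD e_closed del: monoid_alg_simps)
  next
    case smult2
    show ?thesis
      by (simp only: smult2 hm hD r' F.smult_closed e_closed B.smult_closed)
        (simp add: smult2 P.minus_self hD e_closed del: monoid_alg_simps)
  qed
  then have "h r \<in> {\<zero>\<^bsub>P\<^esub>}"
    using lin_hom_span[OF h moduleF P P.zero_submodule bilinear_rels_subset] r
    unfolding tensor_rels_def by blast
  then show ?thesis by simp
qed

lemma rels_mem:
  assumes "r \<in> bilinear_rels R A B"
  shows "r \<in> tensor_rels R A B"
  using assms unfolding tensor_rels_def by (rule span_base)

lemma pure_bilin: "bilin_map R A B (tensor R A B) (pure_tensor R A B)"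
proof (intro bilin_mapI lin_homI)
  \<comment> \<open>Each bilinearity law is one of the defining relations, with one side moved
    across.\<close>
  have eq: "T.\<pi> x = T.\<pi> y" if "x \<ominus>\<^bsub>F\<^esub> y \<in> bilinear_rels R A B" "x \<in> carrier F" "y \<in> carrier F" for x y
    using that T.proj_eq_iff rels_mem by blast
  note pD = lin_homD(2,3)[OF proj_lin, symmetric]
  note cl = e_closed F.M.a_closed F.smult_closed A.M.a_closed A.smult_closed B.M.a_closed B.smult_closed
  show cl': "pure_tensor R A B a b \<in> carrier (tensor R A B)" if "a \<in> carrier A" "b \<in> carrier B" for a b
    unfolding pure_tensor_def using lin_homD(1)[OF proj_lin] e_closed[OF that] .
  then show "pure_tensor R A B a b \<in> carrier (tensor R A B)" if "a \<in> carrier A" "b \<in> carrier B" for a b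
    using that .
  show "pure_tensor R A B (a \<oplus>\<^bsub>A\<^esub> a') b = pure_tensor R A B a b \<oplus>\<^bsub>tensor R A B\<^esub> pure_tensor R A B a' b"
    if "a \<in> carrier A" "a' \<in> carrier A" "b \<in> carrier B" for a a' b
    unfolding pure_tensor_def using that
    by (simp only: pD e_closed, intro eq) (rule bilinear_relsI cl | assumption)+
  show "pure_tensor R A B a (b \<oplus>\<^bsub>B\<^esub> b') = pure_tensor R A B a b \<oplus>\<^bsub>tensor R A B\<^esub> pure_tensor R A B a b'"
    if "a \<in> carrier A" "b \<in> carrier B" "b' \<in> carrier B" for a b b'
    unfolding pure_tensor_def using that
    by (simp only: pD e_closed, intro eq) (rule bilinear_relsI cl | assumption)+
  show "pure_tensor R A B (c \<odot>\<^bsub>A\<^esub> a) b = c \<odot>\<^bsub>tensor R A B\<^esub> pure_tensor R A B a b"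
    if "c \<in> carrier R" "a \<in> carrier A" "b \<in> carrier B" for c a b
    unfolding pure_tensor_def using that
    by (simp only: pD e_closed, intro eq) (rule bilinear_relsI cl | assumption)+
  show "pure_tensor R A B a (c \<odot>\<^bsub>B\<^esub> b) = c \<odot>\<^bsub>tensor R A B\<^esub> pure_tensor R A B a b"
    if "c \<in> carrier R" "a \<in> carrier A" "b \<in> carrier B" for c a b
    unfolding pure_tensor_def using that
    by (simp only: pD e_closed, intro eq) (rule bilinear_relsI cl | assumption)+
qed

lemma pure_closed: "a \<in> carrier A \<Longrightarrow> b \<in> carrier B \<Longrightarrow> pure_tensor R A B a b \<in> carrier (tensor R A B)"
  by (rule bilin_map_closed[OF pure_bilin])

lemma pure_span:
  "submodule_span R (tensor R A B) {pure_tensor R A B a b | a b. a \<in> carrier A \<and> b \<in> carrier B}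
    = carrier (tensor R A B)"
proof -
  have "T.\<pi> ` basis_elt R ` (carrier A \<times> carrier B)
    = {pure_tensor R A B a b | a b. a \<in> carrier A \<and> b \<in> carrier B}"
    unfolding pure_tensor_def image_image by blast
  then show ?thesis
    using T.proj_span[OF A.R.basis_subset] A.R.basis_span[of "A \<times>\<times> B"] T.carrier_Q
    unfolding tensor_def by simp
qed

lemma pure_subset: "{pure_tensor R A B a b | a b. a \<in> carrier A \<and> b \<in> carrier B} \<subseteq> carrier (tensor R A B)"
  by (auto intro: pure_closed)

lemma tensor_hom_eq:
  assumes "f \<in> lin_hom R (tensor R A B) P" "g \<in> lin_hom R (tensor R A B) P" "module R P"
    and "\<And>a b. \<lbrakk>a \<in> carrier A; b \<in> carrier B\<rbrakk> \<Longrightarrow> f (pure_tensor R A B a b) = g (pure_tensor R A B a b)"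
    and "t \<in> carrier (tensor R A B)"
  shows "f t = g t"
  by (rule lin_hom_eq_on_span[OF assms(1,2) module_T assms(3) pure_subset])
    (use assms(4,5) in \<open>auto simp only: pure_span\<close>)

lemma tensor_hom_mem:
  assumes "f \<in> lin_hom R (tensor R A B) P" "module R P" "submodule H R P"
    and "\<And>a b. \<lbrakk>a \<in> carrier A; b \<in> carrier B\<rbrakk> \<Longrightarrow> f (pure_tensor R A B a b) \<in> H"
    and "t \<in> carrier (tensor R A B)"
  shows "f t \<in> H"
  by (rule lin_hom_span[OF assms(1) module_T assms(2,3) pure_subset])
    (use assms(4,5) in \<open>auto simp only: pure_span\<close>)

lemma tensor_lift:
  assumes P: "module R P" and bil: "bilin_map R A B P \<beta>"
  shows tensor_lift_lin: "tensor_lift R P \<beta> \<in> lin_hom R (tensor R A B) P"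
    and tensor_lift_pure: "a \<in> carrier A \<Longrightarrow> b \<in> carrier B \<Longrightarrow>
      tensor_lift R P \<beta> (pure_tensor R A B a b) = \<beta> a b"
proof -
  interpret P: module R P by fact
  let ?g = "\<lambda>p. \<beta> (fst p) (snd p)"
  let ?h = "lin_ext R P ?g"
  \<comment> \<open>Both sides choose the same representative and then sum over its support.\<close>
  have eq: "tensor_lift R P \<beta> = coset_map ?h"
    by (rule ext) (simp add: tensor_lift_def coset_map_def lin_ext_def Let_def)
  have g: "?g s \<in> carrier P" if "s \<in> carrier (A \<times>\<times> B)" for s
    using that bilin_map_closed[OF bil] by auto
  have h: "?h \<in> lin_hom R F P" by (rule P.lin_ext_lin[OF g])
  have he: "?h (e a b) = \<beta> a b" if "a \<in> carrier A" "b \<in> carrier B" for a b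
    using P.lin_ext_basis[of ?g "(a, b)"] bilin_map_closed[OF bil that] by simp
  have "bilin_map R A B P (\<lambda>a b. ?h (e a b))"
    by (rule bilin_mapI)
      (auto simp: he intro: lin_hom_cong[OF bilin_mapD(1)[OF bil] A.module_axioms]
        lin_hom_cong[OF bilin_mapD(3)[OF bil] B.module_axioms])
  then have ker: "?h r = \<zero>\<^bsub>P\<^esub>" if "r \<in> tensor_rels R A B" for r
    using that by (rule rels_vanish[OF h P])
  show "tensor_lift R P \<beta> \<in> lin_hom R (tensor R A B) P"
    unfolding eq tensor_def by (rule T.coset_map_lin[OF h P ker])
  show "tensor_lift R P \<beta> (pure_tensor R A B a b) = \<beta> a b" if "a \<in> carrier A" "b \<in> carrier B"
    unfolding eq pure_tensor_def using T.coset_map_proj[OF h P ker e_closed[OF that]] he[OF that] by simp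
qed

end

locale two_algs = A: assoc_alg R A + B: assoc_alg R B for R (structure) and A and B
begin

sublocale two_modules R A B
  by (intro two_modules.intro A.module_axioms B.module_axioms)

lemma monoid_AB: "monoid (A \<times>\<times> B)"
  by (intro DirProd_monoid A.A.monoid_axioms B.A.monoid_axioms)

lemma assoc_alg_F: "assoc_alg R F"
  by (rule A.R.assoc_alg_monoid_alg[OF monoid_AB])

sublocale F: assoc_alg R F
  by (rule assoc_alg_F)

lemma e_mult: "e a b \<otimes>\<^bsub>F\<^esub> e a' b' = e (a \<otimes>\<^bsub>A\<^esub> a') (b \<otimes>\<^bsub>B\<^esub> b')"
  by (simp add: A.R.basis_mult)

lemma submodule_rels: "submodule (tensor_rels R A B) R F"
  by (rule T.submodule_I)

text \<open>Multiply by a basis element and project: the result depends bilinearly on the remaining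
  pair, since it is a pure tensor of products, so \<open>rels_vanish\<close> applies with the tensor
  product as target. General multipliers follow by linearity.\<close>

lemma ideal_rels: "ideal (tensor_rels R A B) F"
proof (rule idealI)
  show "ring F" by (rule F.ring_axioms')
  show "subgroup (tensor_rels R A B) (add_monoid F)"
    using submodule_rels by (simp add: submodule_def)
  have T0: "T.\<pi> x = \<zero>\<^bsub>tensor R A B\<^esub> \<longleftrightarrow> x \<in> tensor_rels R A B" if "x \<in> carrier F" for x
    using T.proj_zero_iff[OF that] by (simp add: tensor_def quot_alg_simps)
  note LR = bilin_mapD[OF F.mult_bilin]
  fix r assume r: "r \<in> tensor_rels R A B"
  then have rF: "r \<in> carrier F" by (rule submoduleD[OF submodule_rels])
  fix f assume f: "f \<in> carrier F"
  have ef: "\<exists>a b. a \<in> carrier A \<and> b \<in> carrier B \<and> x = e a b" if "x \<in> basis_elt R ` carrier (A \<times>\<times> B)" for x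
    using that by auto
  note sp = lin_hom_span[OF _ moduleF moduleF submodule_rels A.R.basis_subset, unfolded A.R.basis_span, OF _ _ f]
  show "f \<otimes>\<^bsub>F\<^esub> r \<in> tensor_rels R A B"
  proof (rule sp[OF LR(1)[OF rF]])
    fix x assume "x \<in> basis_elt R ` carrier (A \<times>\<times> B)"
    then obtain a b where ab: "a \<in> carrier A" "b \<in> carrier B" "x = e a b" using ef by blast
    have "T.\<pi> (e a b \<otimes>\<^bsub>F\<^esub> r) = \<zero>\<^bsub>tensor R A B\<^esub>"
    proof (rule rels_vanish[OF lin_hom_comp[OF LR(3) proj_lin] module_T _ r])
      show "e a b \<in> carrier F" using ab e_closed by blast
      show "bilin_map R A B (tensor R A B) (\<lambda>a' b'. T.\<pi> (e a b \<otimes>\<^bsub>F\<^esub> e a' b'))"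
        unfolding e_mult pure_tensor_def[symmetric]
        by (rule bilin_map_comp[OF pure_bilin]) (use ab A.mult_bilin B.mult_bilin in \<open>auto dest: bilin_mapD(2)\<close>)
    qed
    then show "x \<otimes>\<^bsub>F\<^esub> r \<in> tensor_rels R A B"
      using T0 rF ab e_closed by auto
  qed
  show "r \<otimes>\<^bsub>F\<^esub> f \<in> tensor_rels R A B"
  proof (rule sp[OF LR(3)[OF rF]])
    fix x assume "x \<in> basis_elt R ` carrier (A \<times>\<times> B)"
    then obtain a b where ab: "a \<in> carrier A" "b \<in> carrier B" "x = e a b" using ef by blast
    have "T.\<pi> (r \<otimes>\<^bsub>F\<^esub> e a b) = \<zero>\<^bsub>tensor R A B\<^esub>"
    proof (rule rels_vanish[OF lin_hom_comp[OF LR(1) proj_lin] module_T _ r])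
      show "e a b \<in> carrier F" using ab e_closed by blast
      show "bilin_map R A B (tensor R A B) (\<lambda>a' b'. T.\<pi> (e a' b' \<otimes>\<^bsub>F\<^esub> e a b))"
        unfolding e_mult pure_tensor_def[symmetric]
        by (rule bilin_map_comp[OF pure_bilin]) (use ab A.mult_bilin B.mult_bilin in \<open>auto dest: bilin_mapD(1)\<close>)
    qed
    then show "r \<otimes>\<^bsub>F\<^esub> x \<in> tensor_rels R A B"
      using T0 rF ab e_closed by auto
  qed
qed

sublocale TA: alg_quot R F "tensor_rels R A B"
  by (intro alg_quot.intro ideal_rels assoc_alg_F)

lemma assoc_alg_T: "assoc_alg R (tensor R A B)"
  unfolding tensor_def by (rule TA.assoc_alg_Q)

sublocale T': assoc_alg R "tensor R A B"
  by (rule assoc_alg_T)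

lemma pure_mult:
  assumes "a \<in> carrier A" "b \<in> carrier B" "a' \<in> carrier A" "b' \<in> carrier B"
  shows "pure_tensor R A B a b \<otimes>\<^bsub>tensor R A B\<^esub> pure_tensor R A B a' b'
    = pure_tensor R A B (a \<otimes>\<^bsub>A\<^esub> a') (b \<otimes>\<^bsub>B\<^esub> b')"
  using alg_homD(3)[OF TA.proj_alg_hom] assms e_closed e_mult
  unfolding pure_tensor_def tensor_def by metis

lemma tensor_one: "\<one>\<^bsub>tensor R A B\<^esub> = pure_tensor R A B \<one>\<^bsub>A\<^esub> \<one>\<^bsub>B\<^esub>"
  unfolding pure_tensor_def tensor_def quot_alg_simps by simp

lemma tensor_alg_homI:
  assumes h: "h \<in> lin_hom R (tensor R A B) P" and P: "assoc_alg R P"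
    and "h (pure_tensor R A B \<one>\<^bsub>A\<^esub> \<one>\<^bsub>B\<^esub>) = \<one>\<^bsub>P\<^esub>"
    and m: "\<And>a b a' b'. \<lbrakk>a \<in> carrier A; b \<in> carrier B; a' \<in> carrier A; b' \<in> carrier B\<rbrakk> \<Longrightarrow>
      h (pure_tensor R A B (a \<otimes>\<^bsub>A\<^esub> a') (b \<otimes>\<^bsub>B\<^esub> b'))
        = h (pure_tensor R A B a b) \<otimes>\<^bsub>P\<^esub> h (pure_tensor R A B a' b')"
  shows "h \<in> alg_hom R (tensor R A B) P"
proof (rule alg_hom_multI_span[OF h assoc_alg_T P pure_subset pure_span])
  fix x y assume "x \<in> {pure_tensor R A B a b |a b. a \<in> carrier A \<and> b \<in> carrier B}"
    "y \<in> {pure_tensor R A B a b |a b. a \<in> carrier A \<and> b \<in> carrier B}"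
  then obtain a b a' b' where "x = pure_tensor R A B a b" "y = pure_tensor R A B a' b'"
    "a \<in> carrier A" "b \<in> carrier B" "a' \<in> carrier A" "b' \<in> carrier B" by blast
  then show "h (x \<otimes>\<^bsub>tensor R A B\<^esub> y) = h x \<otimes>\<^bsub>P\<^esub> h y" by (simp only: pure_mult m)
qed (simp add: tensor_one assms)

end

section \<open>Functoriality of the tensor product\<close>

lemma tensor_map:
  assumes "module R A" "module R B" "module R C" "module R D"
    and f: "f \<in> lin_hom R A C" and g: "g \<in> lin_hom R B D"
  shows tensor_map_lin: "tensor_map R C D f g \<in> lin_hom R (tensor R A B) (tensor R C D)"
    and tensor_map_pure: "a \<in> carrier A \<Longrightarrow> b \<in> carrier B \<Longrightarrow>
      tensor_map R C D f g (pure_tensor R A B a b) = pure_tensor R C D (f a) (g b)"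
proof -
  interpret AB: two_modules R A B by (intro two_modules.intro assms)
  interpret CD: two_modules R C D by (intro two_modules.intro assms)
  note b = bilin_map_comp[OF CD.pure_bilin f g]
  show "tensor_map R C D f g \<in> lin_hom R (tensor R A B) (tensor R C D)"
    unfolding tensor_map_def by (rule AB.tensor_lift_lin[OF CD.module_T b])
  show "a \<in> carrier A \<Longrightarrow> b \<in> carrier B \<Longrightarrow>
      tensor_map R C D f g (pure_tensor R A B a b) = pure_tensor R C D (f a) (g b)"
    unfolding tensor_map_def by (rule AB.tensor_lift_pure[OF CD.module_T b])
qed

lemma tensor_map_alg_hom:
  assumes "assoc_alg R A" "assoc_alg R B" "assoc_alg R C" "assoc_alg R D"
    and f: "f \<in> alg_hom R A C" and g: "g \<in> alg_hom R B D"
  shows "tensor_map R C D f g \<in> alg_hom R (tensor R A B) (tensor R C D)"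
proof -
  interpret AB: two_algs R A B by (intro two_algs.intro assms)
  interpret CD: two_algs R C D by (intro two_algs.intro assms)
  note tm = tensor_map[OF AB.A.module_axioms AB.B.module_axioms CD.A.module_axioms CD.B.module_axioms
      alg_homD(1)[OF f] alg_homD(1)[OF g]]
  show ?thesis
    by (rule AB.tensor_alg_homI[OF tm(1) CD.assoc_alg_T])
      (simp_all add: tm(2) alg_homD[OF f] alg_homD[OF g] CD.tensor_one CD.pure_mult)
qed

lemma tensor_map_comp:
  assumes "module R A" "module R B" "module R C" "module R D" "module R E" "module R E'"
    and "f \<in> lin_hom R A C" "g \<in> lin_hom R B D" "f' \<in> lin_hom R C E" "g' \<in> lin_hom R D E'"
    and t: "t \<in> carrier (tensor R A B)"
  shows "tensor_map R E E' f' g' (tensor_map R C D f g t)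
    = tensor_map R E E' (\<lambda>x. f' (f x)) (\<lambda>x. g' (g x)) t"
proof -
  interpret AB: two_modules R A B by (intro two_modules.intro assms)
  interpret EE: two_modules R E E' by (intro two_modules.intro assms)
  note 1 = tensor_map[OF assms(1-4,7,8)] and 2 = tensor_map[OF assms(3-6,9,10)]
    and 3 = tensor_map[OF assms(1,2,5,6) lin_hom_comp[OF assms(7,9)] lin_hom_comp[OF assms(8,10)]]
  show ?thesis
    by (rule AB.tensor_hom_eq[OF lin_hom_comp[OF 1(1) 2(1)] 3(1) EE.module_T _ t])
      (simp add: 1(2) 2(2) 3(2) lin_homD[OF assms(7)] lin_homD[OF assms(8)])
qed

lemma tensor_map_id:
  assumes "module R A" "module R B"
    and f: "\<And>x. x \<in> carrier A \<Longrightarrow> f x = x" and g: "\<And>x. x \<in> carrier B \<Longrightarrow> g x = x"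
    and t: "t \<in> carrier (tensor R A B)"
  shows "tensor_map R A B f g t = t"
proof -
  interpret AB: two_modules R A B by (intro two_modules.intro assms)
  have fl: "f \<in> lin_hom R A A" "g \<in> lin_hom R B B"
    by (intro lin_homI; simp add: f g)+
  note tm = tensor_map[OF assms(1,2,1,2) fl]
  have id: "(\<lambda>t. t) \<in> lin_hom R (tensor R A B) (tensor R A B)" by (intro lin_homI) auto
  show ?thesis
    by (rule AB.tensor_hom_eq[OF tm(1) id AB.module_T _ t]) (simp add: tm(2) f g)
qed

section \<open>The associator as an algebra map\<close>

locale three_algs = A: assoc_alg R A + B: assoc_alg R B + C: assoc_alg R C
  for R (structure) and A and B and C
begin

sublocale AB: two_algs R A B by unfold_locales
sublocale BC: two_algs R B C by unfold_locales
sublocale ABC: two_algs R A "tensor R B C"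
  by (intro two_algs.intro A.assoc_alg_axioms BC.assoc_alg_T)
sublocale ABC': two_algs R "tensor R A B" C
  by (intro two_algs.intro C.assoc_alg_axioms AB.assoc_alg_T)

abbreviation "P \<equiv> tensor R A (tensor R B C)"
abbreviation "\<beta> c \<equiv> (\<lambda>a b. pure_tensor R A (tensor R B C) a (pure_tensor R B C b c))"
abbreviation "\<gamma> t c \<equiv> tensor_lift R P (\<beta> c) t"

lemma \<beta>_bilin: "c \<in> carrier C \<Longrightarrow> bilin_map R A B P (\<beta> c)"
  using bilin_map_comp[OF ABC.pure_bilin _ bilin_mapD(1)[OF BC.pure_bilin], of "\<lambda>x. x" A]
  by (auto intro: lin_homI)

lemmas \<gamma>_lin = AB.tensor_lift_lin[OF ABC.module_T \<beta>_bilin]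
lemmas \<gamma>_pure = AB.tensor_lift_pure[OF ABC.module_T \<beta>_bilin]

lemma \<gamma>_bilin: "bilin_map R (tensor R A B) C P \<gamma>"
proof (rule bilin_mapI)
  show "(\<lambda>t. \<gamma> t c) \<in> lin_hom R (tensor R A B) P" if "c \<in> carrier C" for c
    using \<gamma>_lin[OF that] by (rule lin_hom_cong[OF _ AB.module_T]) simp
  fix t assume t: "t \<in> carrier (tensor R A B)"
  note ABC.pure_bilin
  show "(\<lambda>c. \<gamma> t c) \<in> lin_hom R C P"
  proof (rule lin_homI)
    fix x assume x: "x \<in> carrier C"
    then show "\<gamma> t x \<in> carrier P" using lin_homD(1)[OF \<gamma>_lin] t by blast
    have pl: "(\<lambda>c. \<beta> c a b) \<in> lin_hom R C P" if "a \<in> carrier A" "b \<in> carrier B" for a b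
      using lin_hom_comp[OF bilin_mapD(3)[OF BC.pure_bilin] bilin_mapD(3)[OF ABC.pure_bilin]] that by blast
    \<comment> \<open>For fixed \<open>x\<close> and \<open>y\<close> this compares two linear maps
      of \<open>t\<close>, so pure tensors decide; there it is additivity of
      \<open>\<beta> c a b\<close> in \<open>c\<close>.\<close>
    show "\<gamma> t (x \<oplus>\<^bsub>C\<^esub> y) = \<gamma> t x \<oplus>\<^bsub>P\<^esub> \<gamma> t y" if y: "y \<in> carrier C" for y
      by (rule AB.tensor_hom_eq[OF \<gamma>_lin lin_hom_addI[OF \<gamma>_lin \<gamma>_lin ABC.module_T] ABC.module_T _ t])
        (use x y C.M.a_closed in \<open>auto simp only: \<gamma>_pure lin_homD(2)[OF pl]\<close>)
    show "\<gamma> t (c \<odot>\<^bsub>C\<^esub> x) = c \<odot>\<^bsub>P\<^esub> \<gamma> t x" if c: "c \<in> carrier R" for c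
      by (rule AB.tensor_hom_eq[OF \<gamma>_lin lin_hom_smultI[OF \<gamma>_lin ABC.module_T] ABC.module_T _ t])
        (use x c C.smult_closed in \<open>auto simp only: \<gamma>_pure lin_homD(3)[OF pl]\<close>)
  qed
qed

lemma tensor_assoc_eq: "tensor_assoc R A B C = tensor_lift R P \<gamma>"
  by (simp add: tensor_assoc_def Let_def)

lemma tensor_assoc_pure:
  assumes "a \<in> carrier A" "b \<in> carrier B" "c \<in> carrier C"
  shows "tensor_assoc R A B C (pure_tensor R (tensor R A B) C (pure_tensor R A B a b) c) = \<beta> c a b"
  using ABC'.tensor_lift_pure[OF ABC.module_T \<gamma>_bilin AB.pure_closed assms(3)] \<gamma>_pure assms
  unfolding tensor_assoc_eq by simp

text \<open>Coassociativity will compare two algebra maps on generators, which requires a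
  multiplicative associator. As the associator is a lift nested in a lift, the reduction to pure
  tensors is made twice.\<close>

lemma tensor_assoc_alg_hom:
  "tensor_assoc R A B C \<in> alg_hom R (tensor R (tensor R A B) C) P"
  unfolding tensor_assoc_eq
proof (rule ABC'.tensor_alg_homI[OF ABC'.tensor_lift_lin[OF ABC.module_T \<gamma>_bilin] ABC.assoc_alg_T])
  note tp = ABC'.tensor_lift_pure[OF ABC.module_T \<gamma>_bilin]
  have "tensor_lift R P \<gamma> (pure_tensor R (tensor R A B) C \<one>\<^bsub>tensor R A B\<^esub> \<one>\<^bsub>C\<^esub>) = \<gamma> \<one>\<^bsub>tensor R A B\<^esub> \<one>\<^bsub>C\<^esub>"
    by (rule tp) (rule AB.T'.one_closed, rule C.A.one_closed)
  also have "\<dots> = \<one>\<^bsub>P\<^esub>"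
    by (simp add: AB.tensor_one \<gamma>_pure ABC.tensor_one BC.tensor_one)
  finally show "tensor_lift R P \<gamma> (pure_tensor R (tensor R A B) C \<one>\<^bsub>tensor R A B\<^esub> \<one>\<^bsub>C\<^esub>) = \<one>\<^bsub>P\<^esub>" .
  fix t c t' c' assume t: "t \<in> carrier (tensor R A B)" and c: "c \<in> carrier C"
    and t': "t' \<in> carrier (tensor R A B)" and c': "c' \<in> carrier C"
  have cc: "c \<otimes>\<^bsub>C\<^esub> c' \<in> carrier C" using c c' by simp
  have "\<gamma> (t \<otimes>\<^bsub>tensor R A B\<^esub> t') (c \<otimes>\<^bsub>C\<^esub> c') = \<gamma> t c \<otimes>\<^bsub>P\<^esub> \<gamma> t' c'"
  proof (rule bilin_map_eq_on_span[OF _ _ AB.module_T AB.module_T ABC.module_T AB.pure_subset AB.pure_subset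
        _ t[folded AB.pure_span] t'[folded AB.pure_span]])
    show "bilin_map R (tensor R A B) (tensor R A B) P (\<lambda>t t'. \<gamma> (t \<otimes>\<^bsub>tensor R A B\<^esub> t') (c \<otimes>\<^bsub>C\<^esub> c'))"
      by (rule bilin_map_lin[OF AB.T'.mult_bilin \<gamma>_lin[OF cc]])
    show "bilin_map R (tensor R A B) (tensor R A B) P (\<lambda>t t'. \<gamma> t c \<otimes>\<^bsub>P\<^esub> \<gamma> t' c')"
      by (rule bilin_map_comp[OF ABC.T'.mult_bilin \<gamma>_lin[OF c] \<gamma>_lin[OF c']])
    fix x y assume "x \<in> {pure_tensor R A B a b |a b. a \<in> carrier A \<and> b \<in> carrier B}"
      "y \<in> {pure_tensor R A B a b |a b. a \<in> carrier A \<and> b \<in> carrier B}"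
    then obtain a b a' b' where xy: "x = pure_tensor R A B a b" "y = pure_tensor R A B a' b'"
      "a \<in> carrier A" "b \<in> carrier B" "a' \<in> carrier A" "b' \<in> carrier B" by blast
    then show "\<gamma> (x \<otimes>\<^bsub>tensor R A B\<^esub> y) (c \<otimes>\<^bsub>C\<^esub> c') = \<gamma> x c \<otimes>\<^bsub>P\<^esub> \<gamma> y c'"
      using c c' cc by (simp add: AB.pure_mult \<gamma>_pure ABC.pure_mult BC.pure_mult BC.pure_closed)
  qed
  then show "tensor_lift R P \<gamma> (pure_tensor R (tensor R A B) C (t \<otimes>\<^bsub>tensor R A B\<^esub> t') (c \<otimes>\<^bsub>C\<^esub> c'))
     = tensor_lift R P \<gamma> (pure_tensor R (tensor R A B) C t c)
       \<otimes>\<^bsub>P\<^esub> tensor_lift R P \<gamma> (pure_tensor R (tensor R A B) C t' c')"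
    using t c t' c' cc AB.T'.m_closed by (simp only: tp)
qed

end

section \<open>Tensor algebras and enveloping algebras\<close>

definition word_prod :: "('k, 'a, 'm) module_scheme \<Rightarrow> ('g \<Rightarrow> 'a) \<Rightarrow> 'g list \<Rightarrow> 'a" where
  "word_prod A f w = foldr (\<lambda>x a. f x \<otimes>\<^bsub>A\<^esub> a) w \<one>\<^bsub>A\<^esub>"

lemma word_prod_simps [simp]:
  "word_prod A f [] = \<one>\<^bsub>A\<^esub>" "word_prod A f (x # w) = f x \<otimes>\<^bsub>A\<^esub> word_prod A f w"
  by (simp_all add: word_prod_def)

lemma (in assoc_alg) word_prod_closed:
  "(\<And>x. x \<in> set w \<Longrightarrow> f x \<in> carrier A) \<Longrightarrow> word_prod A f w \<in> carrier A"
  by (induct w) auto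

lemma (in assoc_alg) word_prod_append:
  "(\<And>x. x \<in> set u \<union> set v \<Longrightarrow> f x \<in> carrier A) \<Longrightarrow>
    word_prod A f (u @ v) = word_prod A f u \<otimes>\<^bsub>A\<^esub> word_prod A f v"
  by (induct u) (auto simp: word_prod_closed A.m_assoc)

lemma alg_hom_word_prod:
  assumes h: "h \<in> alg_hom R A B" and A: "assoc_alg R A" and f: "\<And>x. x \<in> set w \<Longrightarrow> f x \<in> carrier A"
  shows "h (word_prod A f w) = word_prod B (\<lambda>x. h (f x)) w"
proof -
  interpret A: assoc_alg R A by fact
  show ?thesis
    using f by (induct w) (simp_all add: alg_homD[OF h] A.word_prod_closed)
qed

lemma word_prod_cong: "(\<And>x. x \<in> set w \<Longrightarrow> f x = g x) \<Longrightarrow> word_prod A f w = word_prod A g w"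
  by (induct w) auto

text \<open>Used with \<open>genideal_minimal\<close>: an ideal generated by relations that
  \<open>h\<close> kills lies in the kernel.\<close>

lemma alg_hom_kernel_ideal:
  assumes h: "h \<in> alg_hom R A B" and A: "assoc_alg R A" and B: "assoc_alg R B"
  shows "ideal {x \<in> carrier A. h x = \<zero>\<^bsub>B\<^esub>} A"
proof -
  interpret A: assoc_alg R A by fact
  interpret B: assoc_alg R B by fact
  have "submodule {x \<in> carrier A. h x \<in> {\<zero>\<^bsub>B\<^esub>}} R A"
    by (rule submodule_vimage[OF alg_homD(1)[OF h] A.module_axioms' B.module_axioms' B.zero_submodule])
  then have "subgroup {x \<in> carrier A. h x = \<zero>\<^bsub>B\<^esub>} (add_monoid A)"
    by (simp add: submodule_def)
  then show ?thesis
    by (intro idealI A.ring_axioms') (auto simp: alg_homD[OF h])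
qed

text \<open>Closure of the bracket puts the defining relations inside the tensor algebra. One locale
  thereby serves both the bracket of \<open>L\<close> and the zero bracket.\<close>

locale bracket_module = module R L for R (structure) and L (structure) +
  assumes bracket_closed: "\<lbrakk>x \<in> carrier L; y \<in> carrier L\<rbrakk> \<Longrightarrow> x \<otimes>\<^bsub>L\<^esub> y \<in> carrier L"
begin

abbreviation "W \<equiv> word_monoid L"
abbreviation "F \<equiv> monoid_alg R W"
abbreviation "words \<equiv> lists (carrier L)"
abbreviation "T \<equiv> tensor_alg R L"
abbreviation "wt \<equiv> word_tensor R L"

lemma word_monoid_simps [simp]: "carrier W = words" "mult W = (@)" "one W = []"
  by (simp_all add: word_monoid_def)

lemma monoid_W: "monoid W"
  by (rule monoidI) auto

lemma assoc_alg_F: "assoc_alg R F"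
  by (rule R.assoc_alg_monoid_alg[OF monoid_W])

sublocale F: assoc_alg R F
  by (rule assoc_alg_F)

lemma moduleF: "module R F"
  by (rule F.module_axioms')

lemma e_closed: "w \<in> words \<Longrightarrow> basis_elt R w \<in> carrier F"
  by (rule R.basis_elt_closed) simp

lemma e_closed': "u \<in> words \<Longrightarrow> v \<in> words \<Longrightarrow> x \<in> carrier L \<Longrightarrow> basis_elt R (u @ [x] @ v) \<in> carrier F"
  by (rule e_closed) simp

lemma multilinear_rels_cases:
  assumes "r \<in> multilinear_rels R L"
  obtains (add) u v x y where "u \<in> words" "v \<in> words" "x \<in> carrier L" "y \<in> carrier L"
      "r = basis_elt R (u @ [x \<oplus>\<^bsub>L\<^esub> y] @ v)
        \<ominus>\<^bsub>F\<^esub> (basis_elt R (u @ [x] @ v) \<oplus>\<^bsub>F\<^esub> basis_elt R (u @ [y] @ v))"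
    | (smult) u v c x where "u \<in> words" "v \<in> words" "c \<in> carrier R" "x \<in> carrier L"
      "r = basis_elt R (u @ [c \<odot>\<^bsub>L\<^esub> x] @ v) \<ominus>\<^bsub>F\<^esub> (c \<odot>\<^bsub>F\<^esub> basis_elt R (u @ [x] @ v))"
proof -
  from assms show thesis
    unfolding multilinear_rels_def Let_def Un_iff mem_Collect_eq
    by (elim disjE exE conjE) ((rule add; assumption), (rule smult; assumption))
qed

lemma multilinear_relsI:
  "\<lbrakk>u \<in> words; v \<in> words; x \<in> carrier L; y \<in> carrier L\<rbrakk> \<Longrightarrow>
    basis_elt R (u @ [x \<oplus>\<^bsub>L\<^esub> y] @ v)
      \<ominus>\<^bsub>F\<^esub> (basis_elt R (u @ [x] @ v) \<oplus>\<^bsub>F\<^esub> basis_elt R (u @ [y] @ v)) \<in> multilinear_rels R L"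
  "\<lbrakk>u \<in> words; v \<in> words; c \<in> carrier R; x \<in> carrier L\<rbrakk> \<Longrightarrow>
    basis_elt R (u @ [c \<odot>\<^bsub>L\<^esub> x] @ v) \<ominus>\<^bsub>F\<^esub> (c \<odot>\<^bsub>F\<^esub> basis_elt R (u @ [x] @ v)) \<in> multilinear_rels R L"
  unfolding multilinear_rels_def Let_def Un_iff mem_Collect_eq by metis+

lemma multilinear_rels_subset: "multilinear_rels R L \<subseteq> carrier F"
proof
  fix r assume "r \<in> multilinear_rels R L"
  then show "r \<in> carrier F"
    by (cases rule: multilinear_rels_cases)
      (simp_all only: F.m_minus_closed F.M.a_closed F.smult_closed e_closed' M.a_closed smult_closed)
qed

sublocale WR: mod_quot R F "word_rels R L"
  unfolding word_rels_def
  by (intro mod_quot.intro span_submodule moduleF multilinear_rels_subset)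

lemma module_T: "module R T"
  unfolding tensor_alg_def by (rule WR.module_Q)

lemma proj_lin: "(+>\<^bsub>F\<^esub>) (word_rels R L) \<in> lin_hom R F T"
  unfolding tensor_alg_def by (rule WR.proj_lin)

text \<open>The counterpart of \<open>rels_vanish\<close> for words: linearity in one letter, with
  the context \<open>u\<close> and \<open>v\<close> kept fixed.\<close>

lemma word_rels_vanish:
  assumes h: "h \<in> lin_hom R F P" and P: "module R P"
    and lin: "\<And>u v. \<lbrakk>u \<in> words; v \<in> words\<rbrakk> \<Longrightarrow> (\<lambda>x. h (basis_elt R (u @ [x] @ v))) \<in> lin_hom R L P"
    and r: "r \<in> word_rels R L"
  shows "h r = \<zero>\<^bsub>P\<^esub>"
proof -
  interpret P: module R P by fact
  note hD = lin_homD[OF h] and hm = lin_hom_minus[OF h moduleF P]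
  note l = lin_homD[OF lin]
  have "h r \<in> {\<zero>\<^bsub>P\<^esub>}" if "r \<in> multilinear_rels R L" for r
    using that
  proof (cases rule: multilinear_rels_cases)
    case add
    show ?thesis
      by (simp only: add hm hD l F.M.a_closed e_closed' M.a_closed)
        (simp only: add P.minus_self P.M.a_closed hD e_closed' singleton_iff)
  next
    case smult
    show ?thesis
      by (simp only: smult hm hD l F.smult_closed e_closed' smult_closed)
        (simp only: smult P.minus_self P.smult_closed hD e_closed' singleton_iff)
  qed
  then have "h r \<in> {\<zero>\<^bsub>P\<^esub>}"
    using lin_hom_span[OF h moduleF P P.zero_submodule multilinear_rels_subset] r
    unfolding word_rels_def by blast
  then show ?thesis by simp
qed

lemma rels_mem: "r \<in> multilinear_rels R L \<Longrightarrow> r \<in> word_rels R L"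
  unfolding word_rels_def by (rule span_base)

lemma wt_closed: "w \<in> words \<Longrightarrow> wt w \<in> carrier T"
  unfolding word_tensor_def using lin_homD(1)[OF proj_lin e_closed] .

lemma wt_lin:
  assumes "u \<in> words" "v \<in> words"
  shows "(\<lambda>x. wt (u @ [x] @ v)) \<in> lin_hom R L T"
proof (rule lin_homI)
  have eq: "WR.\<pi> x = WR.\<pi> y" if "x \<ominus>\<^bsub>F\<^esub> y \<in> multilinear_rels R L" "x \<in> carrier F" "y \<in> carrier F" for x y
    using that WR.proj_eq_iff rels_mem by blast
  note pD = lin_homD(2,3)[OF proj_lin, symmetric]
  note cl = e_closed' F.M.a_closed F.smult_closed M.a_closed smult_closed
  fix x assume x: "x \<in> carrier L"
  show "wt (u @ [x] @ v) \<in> carrier T" using x assms by (intro wt_closed) auto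
  show "wt (u @ [x \<oplus>\<^bsub>L\<^esub> y] @ v) = wt (u @ [x] @ v) \<oplus>\<^bsub>T\<^esub> wt (u @ [y] @ v)" if "y \<in> carrier L" for y
    unfolding word_tensor_def using that x assms
    by (simp only: pD e_closed', intro eq) (rule multilinear_relsI cl | assumption)+
  show "wt (u @ [c \<odot>\<^bsub>L\<^esub> x] @ v) = c \<odot>\<^bsub>T\<^esub> wt (u @ [x] @ v)" if "c \<in> carrier R" for c
    unfolding word_tensor_def using that x assms
    by (simp only: pD e_closed', intro eq) (rule multilinear_relsI cl | assumption)+
qed

lemma e_mult: "basis_elt R u \<otimes>\<^bsub>F\<^esub> basis_elt R v = basis_elt R (u @ v)"
  by (simp add: R.basis_mult)

lemma submodule_rels: "submodule (word_rels R L) R F"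
  by (rule WR.submodule_I)

text \<open>Multiplying a relation by a word only lengthens its context \<open>u\<close> or
  \<open>v\<close>, and \<open>wt_lin\<close> holds in every context.\<close>

lemma ideal_rels: "ideal (word_rels R L) F"
proof (rule idealI)
  show "ring F" by (rule F.ring_axioms')
  show "subgroup (word_rels R L) (add_monoid F)"
    using submodule_rels by (simp add: submodule_def)
  have T0: "WR.\<pi> x = \<zero>\<^bsub>T\<^esub> \<longleftrightarrow> x \<in> word_rels R L" if "x \<in> carrier F" for x
    using WR.proj_zero_iff[OF that] by (simp add: tensor_alg_def quot_alg_simps)
  note LR = bilin_mapD[OF F.mult_bilin]
  fix r assume r: "r \<in> word_rels R L"
  then have rF: "r \<in> carrier F" by (rule submoduleD[OF submodule_rels])
  fix f assume f: "f \<in> carrier F"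
  note sp = lin_hom_span[OF _ moduleF moduleF submodule_rels R.basis_subset, unfolded R.basis_span, OF _ _ f]
  show "f \<otimes>\<^bsub>F\<^esub> r \<in> word_rels R L"
  proof (rule sp[OF LR(1)[OF rF]])
    fix x assume "x \<in> basis_elt R ` carrier W"
    then obtain w where w: "w \<in> words" "x = basis_elt R w" by auto
    have "WR.\<pi> (basis_elt R w \<otimes>\<^bsub>F\<^esub> r) = \<zero>\<^bsub>T\<^esub>"
    proof (rule word_rels_vanish[OF lin_hom_comp[OF LR(3) proj_lin] module_T _ r])
      show "basis_elt R w \<in> carrier F" using w e_closed by blast
      show "(\<lambda>x. WR.\<pi> (basis_elt R w \<otimes>\<^bsub>F\<^esub> basis_elt R (u @ [x] @ v))) \<in> lin_hom R L T"
        if "u \<in> words" "v \<in> words" for u v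
        using wt_lin[of "w @ u" v] w that by (simp add: e_mult word_tensor_def[symmetric])
    qed
    then show "x \<otimes>\<^bsub>F\<^esub> r \<in> word_rels R L"
      using T0 rF w e_closed by auto
  qed
  show "r \<otimes>\<^bsub>F\<^esub> f \<in> word_rels R L"
  proof (rule sp[OF LR(3)[OF rF]])
    fix x assume "x \<in> basis_elt R ` carrier W"
    then obtain w where w: "w \<in> words" "x = basis_elt R w" by auto
    have "WR.\<pi> (r \<otimes>\<^bsub>F\<^esub> basis_elt R w) = \<zero>\<^bsub>T\<^esub>"
    proof (rule word_rels_vanish[OF lin_hom_comp[OF LR(1) proj_lin] module_T _ r])
      show "basis_elt R w \<in> carrier F" using w e_closed by blast
      show "(\<lambda>x. WR.\<pi> (basis_elt R (u @ [x] @ v) \<otimes>\<^bsub>F\<^esub> basis_elt R w)) \<in> lin_hom R L T"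
        if "u \<in> words" "v \<in> words" for u v
        using wt_lin[of u "v @ w"] w that by (simp add: e_mult word_tensor_def[symmetric])
    qed
    then show "r \<otimes>\<^bsub>F\<^esub> x \<in> word_rels R L"
      using T0 rF w e_closed by auto
  qed
qed

sublocale TA: alg_quot R F "word_rels R L"
  by (intro alg_quot.intro ideal_rels assoc_alg_F)

lemma assoc_alg_T: "assoc_alg R T"
  unfolding tensor_alg_def by (rule TA.assoc_alg_Q)

sublocale T: assoc_alg R T
  by (rule assoc_alg_T)

lemma wt_append: "u \<in> words \<Longrightarrow> v \<in> words \<Longrightarrow> wt (u @ v) = wt u \<otimes>\<^bsub>T\<^esub> wt v"
  using alg_homD(3)[OF TA.proj_alg_hom e_closed e_closed] e_mult
  unfolding word_tensor_def tensor_alg_def by metis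

lemma wt_Nil: "wt [] = \<one>\<^bsub>T\<^esub>"
  unfolding word_tensor_def tensor_alg_def quot_alg_simps by simp

lemma wt_span: "submodule_span R T (wt ` words) = carrier T"
  using WR.proj_span[OF R.basis_subset] R.basis_span[of W] WR.carrier_Q
  unfolding tensor_alg_def word_tensor_def by (simp add: image_image)

text \<open>The products \<open>word_prod A f w\<close> are multiplicative in \<open>w\<close> and
  linear in each letter, so their linear extension is an algebra map that descends to the
  quotient.\<close>

lemma tensor_alg_lift:
  assumes A: "assoc_alg R A" and f: "f \<in> lin_hom R L A"
  shows "\<exists>h\<in>alg_hom R T A. \<forall>w\<in>words. h (wt w) = word_prod A f w"
proof -
  interpret A: assoc_alg R A by fact
  let ?g = "lin_ext R A (word_prod A f)"
  note fc = lin_homD(1)[OF f]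
  have wc: "word_prod A f w \<in> carrier A" if "w \<in> words" for w
    by (rule A.word_prod_closed) (use that fc in auto)
  have wa: "word_prod A f (u @ v) = word_prod A f u \<otimes>\<^bsub>A\<^esub> word_prod A f v"
    if "u \<in> words" "v \<in> words" for u v
    by (rule A.word_prod_append) (use that fc in auto)
  have g: "?g \<in> alg_hom R F A"
    by (rule lin_ext_alg_hom[OF A monoid_W]) (auto simp: wc wa)
  have ge: "?g (basis_elt R w) = word_prod A f w" if "w \<in> words" for w
    by (rule A.lin_ext_basis[where g = "word_prod A f", OF wc[OF that]])
  have ker: "?g r = \<zero>\<^bsub>A\<^esub>" if "r \<in> word_rels R L" for r
  proof (rule word_rels_vanish[OF alg_homD(1)[OF g] A.module_axioms' _ that])
    fix u v assume uv: "u \<in> words" "v \<in> words"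
    have "(\<lambda>x. word_prod A f u \<otimes>\<^bsub>A\<^esub> (f x \<otimes>\<^bsub>A\<^esub> word_prod A f v)) \<in> lin_hom R L A"
      by (rule lin_hom_comp[OF lin_hom_comp[OF f bilin_mapD(1)[OF A.mult_bilin]] bilin_mapD(3)[OF A.mult_bilin]])
        (use uv wc in auto)
    then show "(\<lambda>x. ?g (basis_elt R (u @ [x] @ v))) \<in> lin_hom R L A"
      by (rule lin_hom_cong[OF _ module_axioms]) (use uv in \<open>simp add: ge wa\<close>)
  qed
  have "coset_map ?g (wt w) = word_prod A f w" if "w \<in> words" for w
    unfolding word_tensor_def
    using WR.coset_map_proj[OF alg_homD(1)[OF g] A.module_axioms' ker e_closed[OF that]] ge[OF that] by simp
  moreover have "coset_map ?g \<in> alg_hom R T A"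
    unfolding tensor_alg_def by (rule TA.coset_map_alg_hom[OF g A.module_axioms' ker])
  ultimately show ?thesis by blast
qed

section \<open>The enveloping algebra and its universal property\<close>

abbreviation "I \<equiv> env_ideal R L"
abbreviation "U \<equiv> env_alg R L"
abbreviation "\<iota> \<equiv> env_gen R L"

definition env_rels where
  "env_rels = {((wt [x] \<otimes>\<^bsub>T\<^esub> wt [y]) \<ominus>\<^bsub>T\<^esub> (wt [y] \<otimes>\<^bsub>T\<^esub> wt [x])) \<ominus>\<^bsub>T\<^esub> wt [x \<otimes>\<^bsub>L\<^esub> y] | x y.
    x \<in> carrier L \<and> y \<in> carrier L}"

lemma env_ideal_eq: "I = genideal T env_rels"
  unfolding env_ideal_def Let_def env_rels_def ..

lemma wt1_closed: "x \<in> carrier L \<Longrightarrow> wt [x] \<in> carrier T"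
  by (rule wt_closed) simp

lemma env_rels_subset: "env_rels \<subseteq> carrier T"
  by (auto simp: env_rels_def wt1_closed bracket_closed T.m_minus_closed)

lemma ideal_I: "ideal I T"
  unfolding env_ideal_eq by (rule T.genideal_ideal[OF env_rels_subset])

sublocale UA: alg_quot R T I
  by (intro alg_quot.intro ideal_I assoc_alg_T)

lemma assoc_alg_U: "assoc_alg R U"
  unfolding env_alg_def by (rule UA.assoc_alg_Q)

sublocale U: assoc_alg R U
  by (rule assoc_alg_U)

lemma proj_U: "(+>\<^bsub>T\<^esub>) I \<in> alg_hom R T U"
  unfolding env_alg_def by (rule UA.proj_alg_hom)

lemma gen_lin: "\<iota> \<in> lin_hom R L U"
  unfolding env_gen_def
  using lin_hom_comp[OF wt_lin[of "[]" "[]"] alg_homD(1)[OF proj_U]] by simp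

lemma gen_closed: "x \<in> carrier L \<Longrightarrow> \<iota> x \<in> carrier U"
  by (rule lin_homD(1)[OF gen_lin])

lemma gen_rel:
  assumes x: "x \<in> carrier L" and y: "y \<in> carrier L"
  shows "\<iota> x \<otimes>\<^bsub>U\<^esub> \<iota> y \<ominus>\<^bsub>U\<^esub> \<iota> y \<otimes>\<^bsub>U\<^esub> \<iota> x = \<iota> (x \<otimes>\<^bsub>L\<^esub> y)"
proof -
  have "((wt [x] \<otimes>\<^bsub>T\<^esub> wt [y]) \<ominus>\<^bsub>T\<^esub> (wt [y] \<otimes>\<^bsub>T\<^esub> wt [x])) \<ominus>\<^bsub>T\<^esub> wt [x \<otimes>\<^bsub>L\<^esub> y] \<in> env_rels"
    using assms unfolding env_rels_def by blast
  then have "((wt [x] \<otimes>\<^bsub>T\<^esub> wt [y]) \<ominus>\<^bsub>T\<^esub> (wt [y] \<otimes>\<^bsub>T\<^esub> wt [x])) \<ominus>\<^bsub>T\<^esub> wt [x \<otimes>\<^bsub>L\<^esub> y] \<in> I"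
    unfolding env_ideal_eq using T.genideal_self[OF env_rels_subset] by blast
  then have "I +>\<^bsub>T\<^esub> ((wt [x] \<otimes>\<^bsub>T\<^esub> wt [y]) \<ominus>\<^bsub>T\<^esub> (wt [y] \<otimes>\<^bsub>T\<^esub> wt [x])) = I +>\<^bsub>T\<^esub> wt [x \<otimes>\<^bsub>L\<^esub> y]"
    using assms by (subst UA.proj_eq_iff) (auto simp: wt1_closed bracket_closed T.m_minus_closed)
  then show ?thesis
    using assms
    by (simp add: env_gen_def lin_hom_minus[OF alg_homD(1)[OF proj_U] T.module_axioms' U.module_axioms']
        alg_homD[OF proj_U] wt1_closed)
qed

abbreviation "uw \<equiv> word_prod U \<iota>"

lemma wt_word_prod: "w \<in> words \<Longrightarrow> wt w = word_prod T (\<lambda>x. wt [x]) w"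
proof (induct w)
  case (Cons a w)
  then show ?case using wt_append[of "[a]" w] by simp
qed (simp add: wt_Nil)

lemma uw_eq:
  assumes w: "w \<in> words"
  shows "uw w = I +>\<^bsub>T\<^esub> wt w"
proof -
  have "I +>\<^bsub>T\<^esub> word_prod T (\<lambda>x. wt [x]) w = word_prod U (\<lambda>x. I +>\<^bsub>T\<^esub> wt [x]) w"
    by (rule alg_hom_word_prod[OF proj_U assoc_alg_T]) (use w wt1_closed in auto)
  then show ?thesis
    unfolding wt_word_prod[OF w] env_gen_def[abs_def] by simp
qed

lemma uw_closed: "w \<in> words \<Longrightarrow> uw w \<in> carrier U"
  by (rule U.word_prod_closed) (auto intro: gen_closed)

lemma uw_append: "u \<in> words \<Longrightarrow> v \<in> words \<Longrightarrow> uw (u @ v) = uw u \<otimes>\<^bsub>U\<^esub> uw v"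
  by (rule U.word_prod_append) (auto intro: gen_closed)

lemma uw_snoc: "u \<in> words \<Longrightarrow> x \<in> carrier L \<Longrightarrow> uw (u @ [x]) = uw u \<otimes>\<^bsub>U\<^esub> \<iota> x"
  by (simp add: uw_append gen_closed)

lemma uw_subset: "uw ` {w \<in> words. P w} \<subseteq> carrier U"
  by (auto intro: uw_closed)

lemma uw_subset': "uw ` words \<subseteq> carrier U"
  by (auto intro: uw_closed)

lemma proj_image_wt_span:
  assumes "V \<subseteq> words"
  shows "(+>\<^bsub>T\<^esub>) I ` submodule_span R T (wt ` V) = submodule_span R U (uw ` V)"
proof -
  have "(+>\<^bsub>T\<^esub>) I ` wt ` V = uw ` V"
    using assms uw_eq by (force simp: image_image)
  moreover have "wt ` V \<subseteq> carrier T" using wt_closed[OF subsetD[OF assms]] by (rule image_subsetI)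
  ultimately show ?thesis
    using lin_hom_image_span[OF alg_homD(1)[OF proj_U] T.module_axioms' U.module_axioms'] by metis
qed

lemma uw_span: "submodule_span R U (uw ` words) = carrier U"
  using proj_image_wt_span[of words] UA.carrier_Q wt_span unfolding env_alg_def by simp

lemma tensor_power_eq: "tensor_power R L n = submodule_span R T (wt ` {w \<in> words. length w = n})"
  unfolding tensor_power_def by (rule arg_cong[where f = "submodule_span R T"]) auto

lemma tensor_upto_eq: "tensor_upto R L n = submodule_span R T (wt ` {w \<in> words. length w \<le> n})"
proof
  have sub: "wt ` {w \<in> words. P w} \<subseteq> carrier T" for P by (auto intro: wt_closed)
  note s = span_submodule[OF T.module_axioms' sub]
  show "tensor_upto R L n \<subseteq> submodule_span R T (wt ` {w \<in> words. length w \<le> n})"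
    unfolding tensor_upto_def tensor_power_eq
    by (intro span_minimal[OF s] UN_least span_mono image_mono) auto
  show "submodule_span R T (wt ` {w \<in> words. length w \<le> n}) \<subseteq> tensor_upto R L n"
    unfolding tensor_upto_def tensor_power_eq
  proof (intro span_mono subsetI)
    fix x assume "x \<in> wt ` {w \<in> words. length w \<le> n}"
    then obtain w where "w \<in> words" "length w \<le> n" "x = wt w" by blast
    then show "x \<in> (\<Union>i\<le>n. submodule_span R T (wt ` {w \<in> words. length w = i}))"
      by (intro UN_I[of "length w"] span_base) auto
  qed
qed

text \<open>From here on, statements about the filtration are checked on words of length at most
  \<open>n\<close>.\<close>

lemma env_filtration_eq: "env_filtration R L n = submodule_span R U (uw ` {w \<in> words. length w \<le> n})"
  unfolding env_filtration_def tensor_upto_eq by (rule proj_image_wt_span) auto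

text \<open>The kernel of the induced map on the tensor algebra is an ideal containing the
  relations, hence it contains \<open>I\<close>. The coproduct, the counit, the antipode, the
  canonical map, the derivations of Sym and the action on Sym are all obtained from this
  property.\<close>

lemma env_lift:
  assumes A: "assoc_alg R A" and f: "f \<in> lin_hom R L A"
    and rel: "\<And>x y. \<lbrakk>x \<in> carrier L; y \<in> carrier L\<rbrakk> \<Longrightarrow> f x \<otimes>\<^bsub>A\<^esub> f y \<ominus>\<^bsub>A\<^esub> f y \<otimes>\<^bsub>A\<^esub> f x = f (x \<otimes>\<^bsub>L\<^esub> y)"
  obtains h where "h \<in> alg_hom R U A" "\<And>x. x \<in> carrier L \<Longrightarrow> h (\<iota> x) = f x"
proof -
  interpret A: assoc_alg R A by fact
  obtain g where g: "g \<in> alg_hom R T A" and gw: "\<And>w. w \<in> words \<Longrightarrow> g (wt w) = word_prod A f w"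
    using tensor_alg_lift[OF A f] by blast
  note fc = lin_homD(1)[OF f]
  have g1: "g (wt [x]) = f x" if "x \<in> carrier L" for x
    using gw[of "[x]"] that fc by simp
  note gm = lin_hom_minus[OF alg_homD(1)[OF g] T.module_axioms' A.module_axioms']
  have "I \<subseteq> {x \<in> carrier T. g x = \<zero>\<^bsub>A\<^esub>}"
    unfolding env_ideal_eq
  proof (rule T.genideal_minimal[OF alg_hom_kernel_ideal[OF g assoc_alg_T A]], rule subsetI)
    fix r assume r: "r \<in> env_rels"
    then obtain x y where xy: "x \<in> carrier L" "y \<in> carrier L"
      "r = ((wt [x] \<otimes>\<^bsub>T\<^esub> wt [y]) \<ominus>\<^bsub>T\<^esub> (wt [y] \<otimes>\<^bsub>T\<^esub> wt [x])) \<ominus>\<^bsub>T\<^esub> wt [x \<otimes>\<^bsub>L\<^esub> y]"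
      unfolding env_rels_def by blast
    then have "g r = (f x \<otimes>\<^bsub>A\<^esub> f y \<ominus>\<^bsub>A\<^esub> f y \<otimes>\<^bsub>A\<^esub> f x) \<ominus>\<^bsub>A\<^esub> f (x \<otimes>\<^bsub>L\<^esub> y)"
      by (simp add: gm g1 alg_homD[OF g] wt1_closed bracket_closed T.m_minus_closed)
    then have "g r = \<zero>\<^bsub>A\<^esub>" using rel xy fc bracket_closed by (simp add: A.minus_self)
    then show "r \<in> {x \<in> carrier T. g x = \<zero>\<^bsub>A\<^esub>}" using r env_rels_subset by auto
  qed
  then have ker: "g x = \<zero>\<^bsub>A\<^esub>" if "x \<in> I" for x using that by blast
  show thesis
  proof
    show "coset_map g \<in> alg_hom R U A"
      unfolding env_alg_def by (rule UA.coset_map_alg_hom[OF g A.module_axioms' ker])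
    show "coset_map g (\<iota> x) = f x" if "x \<in> carrier L" for x
      unfolding env_gen_def
      using UA.coset_map_proj[OF alg_homD(1)[OF g] A.module_axioms' ker wt1_closed] g1 that by simp
  qed
qed

lemma lin_hom_U_eq:
  assumes "f \<in> lin_hom R U P" "g \<in> lin_hom R U P" "module R P"
    and "\<And>w. w \<in> words \<Longrightarrow> f (uw w) = g (uw w)" "u \<in> carrier U"
  shows "f u = g u"
  by (rule lin_hom_eq_on_span[OF assms(1,2) U.module_axioms' assms(3) uw_subset'])
    (use assms(4,5) in \<open>auto simp only: uw_span\<close>)

text \<open>The uniqueness half of the universal property: words span, and an algebra map is
  determined on words by its values on letters.\<close>

lemma alg_hom_U_eq:
  assumes f: "f \<in> alg_hom R U A" and g: "g \<in> alg_hom R U A" and A: "module R A"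
    and eq: "\<And>x. x \<in> carrier L \<Longrightarrow> f (\<iota> x) = g (\<iota> x)" and u: "u \<in> carrier U"
  shows "f u = g u"
proof (rule lin_hom_U_eq[OF alg_homD(1)[OF f] alg_homD(1)[OF g] A _ u])
  fix w assume w: "w \<in> words"
  then have c: "\<And>x. x \<in> set w \<Longrightarrow> \<iota> x \<in> carrier U" by (auto intro: gen_closed)
  have "f (uw w) = word_prod A (\<lambda>x. f (\<iota> x)) w" by (rule alg_hom_word_prod[OF f assoc_alg_U c])
  also have "\<dots> = word_prod A (\<lambda>x. g (\<iota> x)) w" by (rule word_prod_cong) (use w eq in auto)
  also have "\<dots> = g (uw w)" by (rule alg_hom_word_prod[OF g assoc_alg_U c, symmetric])
  finally show "f (uw w) = g (uw w)" .
qed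

end

text \<open>The symmetric algebra is the enveloping algebra of the zero bracket.\<close>

definition abelianize :: "('k, 'g, 'm) module_scheme \<Rightarrow> ('k, 'g, 'm) module_scheme" where
  "abelianize L = L\<lparr>mult := (\<lambda>x y. \<zero>\<^bsub>L\<^esub>)\<rparr>"

lemma abelianize_simps [simp]:
  "carrier (abelianize L) = carrier L" "add (abelianize L) = add L" "smult (abelianize L) = smult L"
  "zero (abelianize L) = zero L" "mult (abelianize L) = (\<lambda>x y. \<zero>\<^bsub>L\<^esub>)"
  by (simp_all add: abelianize_def)

lemma word_monoid_abelianize: "word_monoid (abelianize L) = word_monoid L"
  by (simp add: word_monoid_def)

lemma word_rels_abelianize: "word_rels R (abelianize L) = word_rels R L"
  by (simp add: word_rels_def multilinear_rels_def word_monoid_abelianize)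

lemma tensor_alg_abelianize: "tensor_alg R (abelianize L) = tensor_alg R L"
  by (simp add: tensor_alg_def word_monoid_abelianize word_rels_abelianize)

lemma word_tensor_abelianize: "word_tensor R (abelianize L) = word_tensor R L"
  by (simp add: word_tensor_def word_monoid_abelianize word_rels_abelianize fun_eq_iff)

lemma module_abelianize:
  assumes "module R L"
  shows "module R (abelianize L)"
proof -
  interpret module R L by fact
  show ?thesis
    by (intro moduleI abelian_groupI)
      (auto simp: R.is_cring smult_l_distr smult_r_distr smult_assoc1 M.a_ac
        intro: M.l_neg bexI[of _ "\<ominus>\<^bsub>L\<^esub> _"])
qed

context bracket_module
begin

lemma bracket_module_abelianize: "bracket_module R (abelianize L)"
  by (intro bracket_module.intro module_abelianize bracket_module_axioms.intro)
    (simp_all add: module_axioms)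

text \<open>The generators of the two ideals differ by the tensor of the one-letter word zero, which
  vanishes by linearity.\<close>

lemma sym_ideal_abelianize: "sym_ideal R L = env_ideal R (abelianize L)"
proof -
  have wt0: "wt [\<zero>\<^bsub>L\<^esub>] = \<zero>\<^bsub>T\<^esub>"
    using lin_hom_zero[OF wt_lin[of "[]" "[]"] module_axioms T.module_axioms'] by simp
  have "x \<ominus>\<^bsub>T\<^esub> wt [\<zero>\<^bsub>L\<^esub>] = x" if "x \<in> carrier T" for x
    using that by (simp add: wt0 a_minus_def)
  then show ?thesis
    unfolding sym_ideal_def env_ideal_def tensor_alg_abelianize word_tensor_abelianize Let_def abelianize_simps
    by (intro arg_cong[where f = "genideal T"] Collect_cong ex_cong1)
      (auto simp: wt1_closed T.m_minus_closed)
qed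

lemma sym_abelianize:
  "sym_alg R L = env_alg R (abelianize L)" "sym_gen R L = env_gen R (abelianize L)"
  "sym_filtration R L = env_filtration R (abelianize L)"
  "sym_comult R L = env_comult R (abelianize L)" "sym_counit R L = env_counit R (abelianize L)"
proof -
  show 1: "sym_alg R L = env_alg R (abelianize L)"
    by (simp add: sym_alg_def env_alg_def sym_ideal_abelianize tensor_alg_abelianize)
  show 2: "sym_gen R L = env_gen R (abelianize L)"
    by (simp add: fun_eq_iff sym_gen_def env_gen_def sym_ideal_abelianize tensor_alg_abelianize
        word_tensor_abelianize)
  show "sym_filtration R L = env_filtration R (abelianize L)"
    by (simp add: fun_eq_iff sym_filtration_def env_filtration_def sym_ideal_abelianize tensor_alg_abelianize
        tensor_upto_def tensor_power_def word_tensor_abelianize)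
  show "sym_comult R L = env_comult R (abelianize L)" "sym_counit R L = env_counit R (abelianize L)"
    by (simp_all add: sym_comult_def env_comult_def sym_counit_def env_counit_def 1 2)
qed

end

section \<open>The Hopf algebra structure of an enveloping algebra\<close>

lemma alg_hom_restrict:
  assumes h: "h \<in> alg_hom R A B" and A: "assoc_alg R A"
  shows "restrict h (carrier A) \<in> alg_hom R A B"
proof -
  interpret A: assoc_alg R A by fact
  show ?thesis
    by (intro alg_homI lin_homI) (auto simp: alg_homD[OF h] lin_homD[OF alg_homD(1)[OF h]])
qed

text \<open>Meant for the two summands 1 \<otimes> x and x \<otimes> 1 of a primitive element:
  different legs commute, so the mixed products cancel.\<close>

lemma (in ring) commutator_add:
  assumes "p \<in> carrier R" "q \<in> carrier R" "p' \<in> carrier R" "q' \<in> carrier R"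
    and "q' \<otimes> p = p \<otimes> q'" "p' \<otimes> q = q \<otimes> p'"
  shows "(p \<oplus> q) \<otimes> (p' \<oplus> q') \<ominus> (p' \<oplus> q') \<otimes> (p \<oplus> q) = (p \<otimes> p' \<ominus> p' \<otimes> p) \<oplus> (q \<otimes> q' \<ominus> q' \<otimes> q)"
proof -
  have *: "(a \<oplus> b \<oplus> (c \<oplus> d)) \<ominus> (a' \<oplus> c \<oplus> (b \<oplus> d')) = (a \<ominus> a') \<oplus> (d \<ominus> d')"
    if "a \<in> carrier R" "b \<in> carrier R" "c \<in> carrier R" "d \<in> carrier R" "a' \<in> carrier R" "d' \<in> carrier R"
    for a b c d a' d'
    using that by algebra
  have "(p \<oplus> q) \<otimes> (p' \<oplus> q') = p \<otimes> p' \<oplus> p \<otimes> q' \<oplus> (q \<otimes> p' \<oplus> q \<otimes> q')"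
    using assms(1-4) by (simp add: l_distr r_distr a_ac)
  moreover have "(p' \<oplus> q') \<otimes> (p \<oplus> q) = p' \<otimes> p \<oplus> q \<otimes> p' \<oplus> (p \<otimes> q' \<oplus> q' \<otimes> q)"
    using assms by (simp add: l_distr r_distr a_ac)
  ultimately show ?thesis using assms(1-4) by (simp add: *)
qed

text \<open>The antipode reverses products. It becomes an algebra map, and thus accessible to
  \<open>env_lift\<close>, once its target is the opposite algebra.\<close>

definition opp_alg :: "('k, 'a, 'm) module_scheme \<Rightarrow> ('k, 'a, 'm) module_scheme" where
  "opp_alg A = A\<lparr>mult := (\<lambda>x y. y \<otimes>\<^bsub>A\<^esub> x)\<rparr>"

lemma opp_alg_simps [simp]:
  "carrier (opp_alg A) = carrier A" "add (opp_alg A) = add A" "smult (opp_alg A) = smult A"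
  "zero (opp_alg A) = zero A" "one (opp_alg A) = one A" "mult (opp_alg A) = (\<lambda>x y. y \<otimes>\<^bsub>A\<^esub> x)"
  by (simp_all add: opp_alg_def)

lemma assoc_alg_opp:
  assumes "assoc_alg R A"
  shows "assoc_alg R (opp_alg A)"
proof -
  interpret A: assoc_alg R A by fact
  have g: "abelian_group (opp_alg A)"
    by (rule abelian_groupI) (auto simp: A.M.a_ac intro: A.M.l_neg bexI[of _ "\<ominus>\<^bsub>A\<^esub> _"])
  have "module R (opp_alg A)"
    by (intro moduleI g) (auto simp: A.R.is_cring A.smult_l_distr A.smult_r_distr A.smult_assoc1)
  moreover have "ring (opp_alg A)"
    by (intro ringI monoidI g) (auto simp: A.A.m_assoc A.A.l_distr A.A.r_distr)
  ultimately show ?thesis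
    unfolding assoc_alg_def assoc_alg_axioms_def by (auto simp: A.smult_mult_l A.smult_mult_r)
qed

lemma opp_alg_minus: "x \<ominus>\<^bsub>opp_alg A\<^esub> y = x \<ominus>\<^bsub>A\<^esub> y"
  by (simp add: a_minus_def a_inv_def m_inv_def)

lemma lin_hom_opp: "lin_hom R A (opp_alg B) = lin_hom R A B"
  by (simp add: lin_hom_def)

lemma (in module) smult_lcomm:
  "\<lbrakk>a \<in> carrier R; b \<in> carrier R; x \<in> carrier M\<rbrakk> \<Longrightarrow> a \<odot>\<^bsub>M\<^esub> (b \<odot>\<^bsub>M\<^esub> x) = b \<odot>\<^bsub>M\<^esub> (a \<odot>\<^bsub>M\<^esub> x)"
  by (simp add: smult_assoc1[symmetric] R.m_comm)

context bracket_module
begin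

sublocale UUU: three_algs R U U U
  by (intro three_algs.intro assoc_alg_U)

abbreviation "UU \<equiv> tensor R U U"
abbreviation "pure \<equiv> pure_tensor R U U"

lemma assoc_alg_UU: "assoc_alg R UU"
  by (rule UUU.AB.assoc_alg_T)

lemmas pure_l = lin_homD[OF bilin_mapD(1)[OF UUU.AB.pure_bilin]]
lemmas pure_r = lin_homD[OF bilin_mapD(3)[OF UUU.AB.pure_bilin]]
lemmas pure_closed = UUU.AB.pure_closed

text \<open>The value of the coproduct on a generator, defined on all of \<open>U\<close> so that it
  is a linear map and can be composed with \<open>\<iota>\<close>.\<close>

definition prim where
  "prim x = pure \<one>\<^bsub>U\<^esub> x \<oplus>\<^bsub>UU\<^esub> pure x \<one>\<^bsub>U\<^esub>"

lemma prim_closed: "x \<in> carrier U \<Longrightarrow> prim x \<in> carrier UU"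
  unfolding prim_def by (intro UUU.AB.T'.M.a_closed pure_closed) auto

lemma prim_lin: "prim \<in> lin_hom R U UU"
  unfolding prim_def
  by (intro lin_hom_addI[OF bilin_mapD(3)[OF UUU.AB.pure_bilin] bilin_mapD(1)[OF UUU.AB.pure_bilin]
        UUU.AB.module_T]) auto

lemma prim_mult_pure:
  assumes "x \<in> carrier U" "a \<in> carrier U" "b \<in> carrier U"
  shows "prim x \<otimes>\<^bsub>UU\<^esub> pure a b = pure a (x \<otimes>\<^bsub>U\<^esub> b) \<oplus>\<^bsub>UU\<^esub> pure (x \<otimes>\<^bsub>U\<^esub> a) b"
    and "pure a b \<otimes>\<^bsub>UU\<^esub> prim x = pure a (b \<otimes>\<^bsub>U\<^esub> x) \<oplus>\<^bsub>UU\<^esub> pure (a \<otimes>\<^bsub>U\<^esub> x) b"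
  unfolding prim_def using assms pure_closed
  by (simp_all add: UUU.AB.T'.l_distr UUU.AB.T'.r_distr UUU.AB.pure_mult)

text \<open>This is the relation that \<open>env_lift\<close> demands in order to extend
  \<open>prim\<close> from generators to a coproduct. It holds because the two legs contribute
  independent commutators.\<close>

lemma prim_rel:
  assumes x: "x \<in> carrier L" and y: "y \<in> carrier L"
  shows "prim (\<iota> x) \<otimes>\<^bsub>UU\<^esub> prim (\<iota> y) \<ominus>\<^bsub>UU\<^esub> prim (\<iota> y) \<otimes>\<^bsub>UU\<^esub> prim (\<iota> x) = prim (\<iota> (x \<otimes>\<^bsub>L\<^esub> y))"
proof -
  note g = gen_closed[OF x] gen_closed[OF y]
  have "prim (\<iota> x) \<otimes>\<^bsub>UU\<^esub> prim (\<iota> y) \<ominus>\<^bsub>UU\<^esub> prim (\<iota> y) \<otimes>\<^bsub>UU\<^esub> prim (\<iota> x) =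
      (pure \<one>\<^bsub>U\<^esub> (\<iota> x) \<otimes>\<^bsub>UU\<^esub> pure \<one>\<^bsub>U\<^esub> (\<iota> y) \<ominus>\<^bsub>UU\<^esub> pure \<one>\<^bsub>U\<^esub> (\<iota> y) \<otimes>\<^bsub>UU\<^esub> pure \<one>\<^bsub>U\<^esub> (\<iota> x)) \<oplus>\<^bsub>UU\<^esub>
      (pure (\<iota> x) \<one>\<^bsub>U\<^esub> \<otimes>\<^bsub>UU\<^esub> pure (\<iota> y) \<one>\<^bsub>U\<^esub> \<ominus>\<^bsub>UU\<^esub> pure (\<iota> y) \<one>\<^bsub>U\<^esub> \<otimes>\<^bsub>UU\<^esub> pure (\<iota> x) \<one>\<^bsub>U\<^esub>)"
    unfolding prim_def
    by (rule UUU.AB.T'.commutator_add) (simp_all add: g pure_closed UUU.AB.pure_mult)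
  also have "pure \<one>\<^bsub>U\<^esub> (\<iota> x) \<otimes>\<^bsub>UU\<^esub> pure \<one>\<^bsub>U\<^esub> (\<iota> y) \<ominus>\<^bsub>UU\<^esub> pure \<one>\<^bsub>U\<^esub> (\<iota> y) \<otimes>\<^bsub>UU\<^esub> pure \<one>\<^bsub>U\<^esub> (\<iota> x)
      = pure \<one>\<^bsub>U\<^esub> (\<iota> (x \<otimes>\<^bsub>L\<^esub> y))"
    unfolding gen_rel[OF x y, symmetric]
    by (subst lin_hom_minus[OF bilin_mapD(3)[OF UUU.AB.pure_bilin] U.module_axioms' UUU.AB.module_T])
      (simp_all add: g UUU.AB.pure_mult)
  also have "pure (\<iota> x) \<one>\<^bsub>U\<^esub> \<otimes>\<^bsub>UU\<^esub> pure (\<iota> y) \<one>\<^bsub>U\<^esub> \<ominus>\<^bsub>UU\<^esub> pure (\<iota> y) \<one>\<^bsub>U\<^esub> \<otimes>\<^bsub>UU\<^esub> pure (\<iota> x) \<one>\<^bsub>U\<^esub>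
      = pure (\<iota> (x \<otimes>\<^bsub>L\<^esub> y)) \<one>\<^bsub>U\<^esub>"
    unfolding gen_rel[OF x y, symmetric]
    by (subst lin_hom_minus[OF bilin_mapD(1)[OF UUU.AB.pure_bilin] U.module_axioms' UUU.AB.module_T])
      (simp_all add: g UUU.AB.pure_mult)
  finally show ?thesis unfolding prim_def .
qed

abbreviation "\<Delta> \<equiv> env_comult R L"
abbreviation "\<epsilon> \<equiv> env_counit R L"

text \<open>\<open>std_comult\<close> is a definite description, so unique existence has to be
  shown. Restriction to the carrier provides the extensional candidate, and two candidates agree on
  generators.\<close>

lemma comult_ex1:
  "\<exists>!D. D \<in> alg_hom R U UU \<inter> extensional (carrier U) \<and>
     (\<forall>x\<in>carrier L. D (\<iota> x) = pure \<one>\<^bsub>U\<^esub> (\<iota> x) \<oplus>\<^bsub>UU\<^esub> pure (\<iota> x) \<one>\<^bsub>U\<^esub>)"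
proof -
  obtain h where h: "h \<in> alg_hom R U UU" "\<And>x. x \<in> carrier L \<Longrightarrow> h (\<iota> x) = prim (\<iota> x)"
    using env_lift[OF assoc_alg_UU lin_hom_comp[OF gen_lin prim_lin] prim_rel] by metis
  show ?thesis
  proof (rule ex1I)
    show "restrict h (carrier U) \<in> alg_hom R U UU \<inter> extensional (carrier U) \<and>
      (\<forall>x\<in>carrier L. restrict h (carrier U) (\<iota> x) = pure \<one>\<^bsub>U\<^esub> (\<iota> x) \<oplus>\<^bsub>UU\<^esub> pure (\<iota> x) \<one>\<^bsub>U\<^esub>)"
      using alg_hom_restrict[OF h(1) assoc_alg_U] h(2) gen_closed by (simp add: prim_def)
    fix D assume D: "D \<in> alg_hom R U UU \<inter> extensional (carrier U) \<and>
      (\<forall>x\<in>carrier L. D (\<iota> x) = pure \<one>\<^bsub>U\<^esub> (\<iota> x) \<oplus>\<^bsub>UU\<^esub> pure (\<iota> x) \<one>\<^bsub>U\<^esub>)"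
    show "D = restrict h (carrier U)"
    proof (rule extensionalityI)
      show "D x = restrict h (carrier U) x" if "x \<in> carrier U" for x
        using alg_hom_U_eq[OF _ h(1) UUU.AB.module_T _ that] D h(2) that by (simp add: prim_def)
    qed (use D in auto)
  qed
qed

lemma comult_alg_hom: "\<Delta> \<in> alg_hom R U UU"
  and comult_gen: "x \<in> carrier L \<Longrightarrow> \<Delta> (\<iota> x) = prim (\<iota> x)"
  using theI'[OF comult_ex1] unfolding env_comult_def std_comult_def prim_def by blast+

lemma counit_ex1:
  "\<exists>!D. D \<in> alg_hom R U (ground_alg R) \<inter> extensional (carrier U) \<and> (\<forall>x\<in>carrier L. D (\<iota> x) = \<zero>\<^bsub>R\<^esub>)"
proof -
  note gr = assoc_alg_ground[OF R.is_cring]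
  interpret K: assoc_alg R "ground_alg R" by (rule gr)
  have l0: "(\<lambda>x. \<zero>\<^bsub>R\<^esub>) \<in> lin_hom R L (ground_alg R)" by (intro lin_homI) auto
  obtain h where h: "h \<in> alg_hom R U (ground_alg R)" "\<And>x. x \<in> carrier L \<Longrightarrow> h (\<iota> x) = \<zero>\<^bsub>R\<^esub>"
    by (rule env_lift[OF gr l0]) (use K.minus_self[of "\<zero>\<^bsub>R\<^esub>"] in auto)
  show ?thesis
  proof (rule ex1I)
    show "restrict h (carrier U) \<in> alg_hom R U (ground_alg R) \<inter> extensional (carrier U) \<and>
      (\<forall>x\<in>carrier L. restrict h (carrier U) (\<iota> x) = \<zero>\<^bsub>R\<^esub>)"
      using alg_hom_restrict[OF h(1) assoc_alg_U] h(2) gen_closed by simp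
    fix D assume D: "D \<in> alg_hom R U (ground_alg R) \<inter> extensional (carrier U) \<and>
      (\<forall>x\<in>carrier L. D (\<iota> x) = \<zero>\<^bsub>R\<^esub>)"
    show "D = restrict h (carrier U)"
    proof (rule extensionalityI)
      show "D x = restrict h (carrier U) x" if "x \<in> carrier U" for x
        using alg_hom_U_eq[OF _ h(1) K.module_axioms' _ that] D h(2) that by simp
    qed (use D in auto)
  qed
qed

lemma counit_alg_hom: "\<epsilon> \<in> alg_hom R U (ground_alg R)"
  and counit_gen: "x \<in> carrier L \<Longrightarrow> \<epsilon> (\<iota> x) = \<zero>\<^bsub>R\<^esub>"
  using theI'[OF counit_ex1] unfolding env_counit_def std_counit_def by blast+

lemmas comult_lin = alg_homD(1)[OF comult_alg_hom]
lemmas counit_lin = alg_homD(1)[OF counit_alg_hom]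

lemma counit_closed: "u \<in> carrier U \<Longrightarrow> \<epsilon> u \<in> carrier R"
  using alg_homD(4)[OF counit_alg_hom] by simp

lemma counit_mult: "u \<in> carrier U \<Longrightarrow> v \<in> carrier U \<Longrightarrow> \<epsilon> (u \<otimes>\<^bsub>U\<^esub> v) = \<epsilon> u \<otimes>\<^bsub>R\<^esub> \<epsilon> v"
  using alg_homD(3)[OF counit_alg_hom] by simp

lemma counit_one: "\<epsilon> \<one>\<^bsub>U\<^esub> = \<one>\<^bsub>R\<^esub>"
  using alg_homD(2)[OF counit_alg_hom] by simp

lemma coassociative:
  assumes u: "u \<in> carrier U"
  shows "tensor_assoc R U U U (tensor_map R UU U \<Delta> id (\<Delta> u)) = tensor_map R U UU id \<Delta> (\<Delta> u)"
proof (rule alg_hom_U_eq[OF _ _ UUU.ABC.module_T _ u])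
  note A = assoc_alg_U and AA = assoc_alg_UU
  show "(\<lambda>u. tensor_assoc R U U U (tensor_map R UU U \<Delta> id (\<Delta> u))) \<in> alg_hom R U (tensor R U UU)"
    by (intro alg_hom_comp[OF alg_hom_comp[OF comult_alg_hom tensor_map_alg_hom[OF A A AA A]]
          UUU.tensor_assoc_alg_hom] comult_alg_hom alg_hom_id)
  show "(\<lambda>u. tensor_map R U UU id \<Delta> (\<Delta> u)) \<in> alg_hom R U (tensor R U UU)"
    by (intro alg_hom_comp[OF comult_alg_hom tensor_map_alg_hom[OF A A A AA]] comult_alg_hom alg_hom_id)
  fix x assume "x \<in> carrier L"
  then have g: "\<iota> x \<in> carrier U" and D: "\<Delta> (\<iota> x) = prim (\<iota> x)" by (auto simp: gen_closed comult_gen)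
  note D1 = alg_homD(2)[OF comult_alg_hom, unfolded UUU.AB.tensor_one]
  have idl: "id \<in> lin_hom R U U" using alg_homD(1)[OF alg_hom_id] .
  note m = U.module_axioms' and mm = UUU.AB.module_T
  note t1 = tensor_map[OF m m mm m comult_lin idl] and t2 = tensor_map[OF m m m mm idl comult_lin]
  note as = alg_homD(1)[OF UUU.tensor_assoc_alg_hom]
  note p1 = lin_homD[OF bilin_mapD(1)[OF UUU.ABC'.pure_bilin]]
  note p2 = lin_homD[OF bilin_mapD(3)[OF UUU.ABC.pure_bilin]]
  note c = pure_closed UUU.ABC.pure_closed UUU.ABC'.pure_closed
  let ?x = "\<iota> x"
  have "tensor_assoc R U U U (tensor_map R UU U \<Delta> id (\<Delta> ?x)) =
    pure_tensor R U UU \<one>\<^bsub>U\<^esub> (pure \<one>\<^bsub>U\<^esub> ?x) \<oplus>\<^bsub>tensor R U UU\<^esub>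
    (pure_tensor R U UU \<one>\<^bsub>U\<^esub> (pure ?x \<one>\<^bsub>U\<^esub>) \<oplus>\<^bsub>tensor R U UU\<^esub> pure_tensor R U UU ?x (pure \<one>\<^bsub>U\<^esub> \<one>\<^bsub>U\<^esub>))"
    unfolding D unfolding prim_def
    using g by (simp add: lin_homD[OF t1(1)] t1(2) c D1 D prim_def p1 lin_homD[OF as] UUU.tensor_assoc_pure
        del: ring_record_simps)
  moreover have "tensor_map R U UU id \<Delta> (\<Delta> ?x) =
    (pure_tensor R U UU \<one>\<^bsub>U\<^esub> (pure \<one>\<^bsub>U\<^esub> ?x) \<oplus>\<^bsub>tensor R U UU\<^esub>
    pure_tensor R U UU \<one>\<^bsub>U\<^esub> (pure ?x \<one>\<^bsub>U\<^esub>)) \<oplus>\<^bsub>tensor R U UU\<^esub> pure_tensor R U UU ?x (pure \<one>\<^bsub>U\<^esub> \<one>\<^bsub>U\<^esub>)"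
    unfolding D unfolding prim_def
    using g by (simp add: lin_homD[OF t2(1)] t2(2) c D1 D prim_def p2)
  \<comment> \<open>The same three summands appear on both sides, bracketed differently.\<close>
  ultimately show "tensor_assoc R U U U (tensor_map R UU U \<Delta> id (\<Delta> ?x)) = tensor_map R U UU id \<Delta> (\<Delta> ?x)"
    using g c by (simp add: UUU.ABC.T'.M.a_assoc)
qed

text \<open>As \<open>\<epsilon>\<close> is an algebra map, so is the contraction of a \<otimes> b
  to \<epsilon>(a) b. The identity can therefore be tested on generators.\<close>

lemma counit_left:
  assumes u: "u \<in> carrier U"
  shows "tensor_lift R U (\<lambda>a b. \<epsilon> a \<odot>\<^bsub>U\<^esub> b) (\<Delta> u) = u"
proof -
  have b: "bilin_map R U U U (\<lambda>a b. \<epsilon> a \<odot>\<^bsub>U\<^esub> b)"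
    using lin_homD[OF counit_lin]
    by (intro bilin_mapI lin_homI)
      (auto simp: U.smult_l_distr U.smult_r_distr U.smult_assoc1[symmetric] R.m_comm)
  note t = UUU.AB.tensor_lift[OF U.module_axioms' b]
  have h: "tensor_lift R U (\<lambda>a b. \<epsilon> a \<odot>\<^bsub>U\<^esub> b) \<in> alg_hom R UU U"
    by (rule UUU.AB.tensor_alg_homI[OF t(1) assoc_alg_U])
      (simp_all add: t(2) counit_one counit_mult counit_closed U.smult_mult_l U.smult_mult_r
        U.smult_assoc1 U.smult_lcomm)
  have "tensor_lift R U (\<lambda>a b. \<epsilon> a \<odot>\<^bsub>U\<^esub> b) (\<Delta> u) = id u"
    by (rule alg_hom_U_eq[OF alg_hom_comp[OF comult_alg_hom h] alg_hom_id U.module_axioms' _ u])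
      (simp add: comult_gen prim_def lin_homD[OF t(1)] t(2) pure_closed gen_closed counit_one counit_gen)
  then show ?thesis by simp
qed

lemma counit_right:
  assumes u: "u \<in> carrier U"
  shows "tensor_lift R U (\<lambda>a b. \<epsilon> b \<odot>\<^bsub>U\<^esub> a) (\<Delta> u) = u"
proof -
  have b: "bilin_map R U U U (\<lambda>a b. \<epsilon> b \<odot>\<^bsub>U\<^esub> a)"
    using lin_homD[OF counit_lin]
    by (intro bilin_mapI lin_homI)
      (auto simp: U.smult_l_distr U.smult_r_distr U.smult_assoc1[symmetric] R.m_comm)
  note t = UUU.AB.tensor_lift[OF U.module_axioms' b]
  have h: "tensor_lift R U (\<lambda>a b. \<epsilon> b \<odot>\<^bsub>U\<^esub> a) \<in> alg_hom R UU U"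
    by (rule UUU.AB.tensor_alg_homI[OF t(1) assoc_alg_U])
      (simp_all add: t(2) counit_one counit_mult counit_closed U.smult_mult_l U.smult_mult_r
        U.smult_assoc1 U.smult_lcomm)
  have "tensor_lift R U (\<lambda>a b. \<epsilon> b \<odot>\<^bsub>U\<^esub> a) (\<Delta> u) = id u"
    by (rule alg_hom_U_eq[OF alg_hom_comp[OF comult_alg_hom h] alg_hom_id U.module_axioms' _ u])
      (simp add: comult_gen prim_def lin_homD[OF t(1)] t(2) pure_closed gen_closed counit_one counit_gen)
  then show ?thesis by simp
qed

lemma coalgebra_U: "coalgebra R U \<Delta> \<epsilon>"
  unfolding coalgebra_def
  using U.module_axioms' comult_lin counit_lin coassociative counit_left counit_right by blast

lemma bialgebra_U: "bialgebra R U \<Delta> \<epsilon>"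
  unfolding bialgebra_def assoc_algebra_iff
  using assoc_alg_U coalgebra_U comult_alg_hom counit_alg_hom by blast

text \<open>The two antipode identities peel off letters at opposite ends of a word, so the
  recursion for the coproduct is provided at both ends.\<close>

lemma comult_Cons:
  assumes "w \<in> words" "x \<in> carrier L"
  shows "\<Delta> (uw (x # w)) = prim (\<iota> x) \<otimes>\<^bsub>UU\<^esub> \<Delta> (uw w)"
  using assms by (simp add: alg_homD(3)[OF comult_alg_hom] comult_gen gen_closed uw_closed)

lemma comult_snoc:
  assumes "w \<in> words" "x \<in> carrier L"
  shows "\<Delta> (uw (w @ [x])) = \<Delta> (uw w) \<otimes>\<^bsub>UU\<^esub> prim (\<iota> x)"
  using assms by (simp add: uw_snoc alg_homD(3)[OF comult_alg_hom] comult_gen gen_closed uw_closed)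

lemma comult_Nil: "\<Delta> (uw []) = pure \<one>\<^bsub>U\<^esub> \<one>\<^bsub>U\<^esub>"
  by (simp add: alg_homD(2)[OF comult_alg_hom] UUU.AB.tensor_one)

lemma counit_Cons: "w \<in> words \<Longrightarrow> x \<in> carrier L \<Longrightarrow> \<epsilon> (uw (x # w)) = \<zero>\<^bsub>R\<^esub>"
  by (simp add: counit_mult gen_closed uw_closed counit_gen counit_closed)

lemma counit_snoc: "w \<in> words \<Longrightarrow> x \<in> carrier L \<Longrightarrow> \<epsilon> (uw (w @ [x])) = \<zero>\<^bsub>R\<^esub>"
  by (simp add: uw_snoc counit_mult gen_closed uw_closed counit_gen counit_closed)

section \<open>The length filtration and its compatibility with product and coproduct\<close>

abbreviation "Fil \<equiv> env_filtration R L"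

lemma Fil_submodule: "submodule (Fil n) R U"
  unfolding env_filtration_eq by (intro span_submodule U.module_axioms' uw_subset)

lemmas FilD = submoduleD[OF Fil_submodule]

lemma Fil_mono: "m \<le> n \<Longrightarrow> Fil m \<subseteq> Fil n"
  unfolding env_filtration_eq by (intro span_mono image_mono) auto

lemma uw_Fil: "w \<in> words \<Longrightarrow> length w \<le> n \<Longrightarrow> uw w \<in> Fil n"
  unfolding env_filtration_eq by (intro span_base) auto

lemma Fil_lin_hom_mem:
  assumes "f \<in> lin_hom R U P" "module R P" "submodule H R P"
    and "\<And>w. \<lbrakk>w \<in> words; length w \<le> n\<rbrakk> \<Longrightarrow> f (uw w) \<in> H" "u \<in> Fil n"
  shows "f u \<in> H"
  by (rule lin_hom_span[OF assms(1) U.module_axioms' assms(2,3) uw_subset])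
    (use assms(4,5) in \<open>auto simp: env_filtration_eq\<close>)

lemma Fil_mult:
  assumes "u \<in> Fil m" "v \<in> Fil n"
  shows "u \<otimes>\<^bsub>U\<^esub> v \<in> Fil (m + n)"
proof (rule bilin_map_span[OF U.mult_bilin U.module_axioms' U.module_axioms' U.module_axioms' uw_subset uw_subset
        Fil_submodule _ assms[unfolded env_filtration_eq]])
  fix x y assume "x \<in> uw ` {w \<in> words. length w \<le> m}" "y \<in> uw ` {w \<in> words. length w \<le> n}"
  then obtain v w where vw: "v \<in> words" "length v \<le> m" "x = uw v" "w \<in> words" "length w \<le> n" "y = uw w"
    by blast
  then show "x \<otimes>\<^bsub>U\<^esub> y \<in> Fil (m + n)"
    using uw_Fil[of "v @ w" "m + n"] uw_append[of v w] by simp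
qed

lemma gen_Fil: "x \<in> carrier L \<Longrightarrow> \<iota> x \<in> Fil 1"
  using uw_Fil[of "[x]" 1] gen_closed by simp

lemma Fil_gen_mult_r: "\<lbrakk>u \<in> Fil n; x \<in> carrier L\<rbrakk> \<Longrightarrow> u \<otimes>\<^bsub>U\<^esub> \<iota> x \<in> Fil (Suc n)"
  using Fil_mult[OF _ gen_Fil] by fastforce

lemma Fil_gen_mult_l: "\<lbrakk>u \<in> Fil n; x \<in> carrier L\<rbrakk> \<Longrightarrow> \<iota> x \<otimes>\<^bsub>U\<^esub> u \<in> Fil (Suc n)"
  using Fil_mult[OF gen_Fil] by fastforce

lemma Fil_one: "\<one>\<^bsub>U\<^esub> \<in> Fil n"
  using uw_Fil[of "[]" n] by simp

lemma Fil_Union: "(\<Union>n. Fil n) = carrier U"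
proof
  show "(\<Union>n. Fil n) \<subseteq> carrier U" using FilD(1) by auto
  \<comment> \<open>For the union of an ascending chain, two elements are compared in the piece with
    the larger index.\<close>
  have "submodule (\<Union>n. Fil n) R U"
  proof (rule U.submoduleI')
    fix a b assume "a \<in> (\<Union>n. Fil n)" "b \<in> (\<Union>n. Fil n)"
    then obtain m n where "a \<in> Fil m" "b \<in> Fil n" by blast
    then have "a \<in> Fil (max m n)" "b \<in> Fil (max m n)"
      using Fil_mono[of m "max m n"] Fil_mono[of n "max m n"] by auto
    then show "a \<oplus>\<^bsub>U\<^esub> b \<in> (\<Union>n. Fil n)" using FilD(3) by blast
  next
    show "a \<odot>\<^bsub>U\<^esub> x \<in> (\<Union>n. Fil n)" if "a \<in> carrier R" "x \<in> (\<Union>n. Fil n)" for a x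
      using that FilD(4) by blast
  qed (use FilD(1,2) in auto)
  then have "submodule_span R U (uw ` words) \<subseteq> (\<Union>n. Fil n)"
    by (rule span_minimal) (use uw_Fil in auto)
  then show "carrier U \<subseteq> (\<Union>n. Fil n)" by (simp only: uw_span)
qed

lemma module_filtration_U: "module_filtration R U Fil"
  unfolding module_filtration_def using Fil_submodule Fil_mono Fil_Union by auto

lemma filtered_algebra_U: "filtered_algebra R U Fil"
  unfolding filtered_algebra_def assoc_algebra_iff
  using assoc_alg_U module_filtration_U Fil_one Fil_mult by blast

abbreviation "TF \<equiv> tensor_filtration R U Fil"

lemma TF_gens: "{pure a b | a b i j. i + j = n \<and> a \<in> Fil i \<and> b \<in> Fil j} \<subseteq> carrier UU"
  using FilD(1) pure_closed by blast

lemma TF_submodule: "submodule (TF n) R UU"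
  unfolding tensor_filtration_def by (intro span_submodule UUU.AB.module_T TF_gens)

text \<open>Generators of \<open>TF n\<close> have indices adding up to exactly \<open>n\<close>, so
  the second index is raised to \<open>n - i\<close>.\<close>

lemma TF_pure:
  assumes "a \<in> Fil i" "b \<in> Fil j" "i + j \<le> n"
  shows "pure a b \<in> TF n"
proof -
  have "b \<in> Fil (n - i)" using Fil_mono[of j "n - i"] assms(2,3) by (simp add: le_diff_conv2 subset_iff)
  moreover have "i + (n - i) = n" using assms(3) by simp
  ultimately show ?thesis
    unfolding tensor_filtration_def using assms(1) by (intro span_base) blast
qed

text \<open>By \<open>prim_mult_pure\<close> the new letter enters one leg at a time and raises the
  index of that leg by one.\<close>

lemma TF_prim_mult:
  assumes x: "x \<in> carrier L" and t: "t \<in> TF n"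
  shows "prim (\<iota> x) \<otimes>\<^bsub>UU\<^esub> t \<in> TF (Suc n)"
proof (rule lin_hom_span[OF bilin_mapD(3)[OF UUU.AB.T'.mult_bilin] UUU.AB.module_T UUU.AB.module_T TF_submodule
      TF_gens _ t[unfolded tensor_filtration_def]])
  show "prim (\<iota> x) \<in> carrier UU" by (intro prim_closed gen_closed x)
  fix y assume "y \<in> {pure a b | a b i j. i + j = n \<and> a \<in> Fil i \<and> b \<in> Fil j}"
  then obtain a b i j where y: "y = pure a b" "i + j = n" "a \<in> Fil i" "b \<in> Fil j" by blast
  then have "a \<in> carrier U" "b \<in> carrier U" using FilD(1) by auto
  moreover have "pure a (\<iota> x \<otimes>\<^bsub>U\<^esub> b) \<in> TF (Suc n)"
    using y x by (intro TF_pure[of a i _ "Suc j"] Fil_gen_mult_l) auto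
  moreover have "pure (\<iota> x \<otimes>\<^bsub>U\<^esub> a) b \<in> TF (Suc n)"
    using y x by (intro TF_pure[of _ "Suc i" b j] Fil_gen_mult_l) auto
  ultimately show "prim (\<iota> x) \<otimes>\<^bsub>UU\<^esub> y \<in> TF (Suc n)"
    using gen_closed[OF x] submoduleD(3)[OF TF_submodule] by (simp add: y(1) prim_mult_pure)
qed

lemma TF_mono: "m \<le> n \<Longrightarrow> TF m \<subseteq> TF n"
  unfolding tensor_filtration_def[of _ _ _ m]
  by (rule span_minimal[OF TF_submodule]) (auto intro: TF_pure)

lemma comult_TF:
  assumes u: "u \<in> Fil n"
  shows "\<Delta> u \<in> TF n"
proof (rule Fil_lin_hom_mem[OF comult_lin UUU.AB.module_T TF_submodule _ u])
  have "\<Delta> (uw w) \<in> TF (length w)" if "w \<in> words" for w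
    using that
  proof (induct w)
    case Nil
    show ?case unfolding comult_Nil by (rule TF_pure[of _ 0 _ 0]) (auto intro: Fil_one)
  next
    case (Cons x w)
    then show ?case using TF_prim_mult[of x "\<Delta> (uw w)"] comult_Cons[of w x] by (simp del: word_prod_simps)
  qed
  then show "\<Delta> (uw w) \<in> TF n" if "w \<in> words" "length w \<le> n" for w
    using TF_mono that by blast
qed

lemma filtered_coalgebra_U: "filtered_coalgebra R U \<Delta> \<epsilon> Fil"
  unfolding filtered_coalgebra_def
  using coalgebra_U module_filtration_U comult_TF by blast

section \<open>The antipode\<close>

lemma antipode_ex:
  obtains S where "S \<in> lin_hom R U U" "S \<one>\<^bsub>U\<^esub> = \<one>\<^bsub>U\<^esub>"
    "\<And>u v. \<lbrakk>u \<in> carrier U; v \<in> carrier U\<rbrakk> \<Longrightarrow> S (u \<otimes>\<^bsub>U\<^esub> v) = S v \<otimes>\<^bsub>U\<^esub> S u"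
    "\<And>x. x \<in> carrier L \<Longrightarrow> S (\<iota> x) = \<ominus>\<^bsub>U\<^esub> \<iota> x"
proof -
  let ?f = "\<lambda>x. \<ominus>\<^bsub>U\<^esub> \<iota> x"
  have "(\<lambda>x. (\<ominus>\<^bsub>R\<^esub> \<one>\<^bsub>R\<^esub>) \<odot>\<^bsub>U\<^esub> \<iota> x) \<in> lin_hom R L U"
    by (intro lin_hom_smultI gen_lin U.module_axioms') auto
  then have "?f \<in> lin_hom R L U"
    by (rule lin_hom_cong[OF _ module_axioms]) (simp add: U.a_inv_eq_smult gen_closed)
  then have f: "?f \<in> lin_hom R L (opp_alg U)" by (simp add: lin_hom_opp)
  obtain S where S: "S \<in> alg_hom R U (opp_alg U)" "\<And>x. x \<in> carrier L \<Longrightarrow> S (\<iota> x) = \<ominus>\<^bsub>U\<^esub> \<iota> x"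
  proof (rule env_lift[OF assoc_alg_opp[OF assoc_alg_U] f])
    fix x y assume xy: "x \<in> carrier L" "y \<in> carrier L"
    \<comment> \<open>The relation in the opposite algebra: the two signs within each product
      cancel, and the reversed order supplies the single sign on the right.\<close>
    have "\<ominus>\<^bsub>U\<^esub> \<iota> y \<otimes>\<^bsub>U\<^esub> \<ominus>\<^bsub>U\<^esub> \<iota> x \<ominus>\<^bsub>U\<^esub> \<ominus>\<^bsub>U\<^esub> \<iota> x \<otimes>\<^bsub>U\<^esub> \<ominus>\<^bsub>U\<^esub> \<iota> y
      = \<ominus>\<^bsub>U\<^esub> (\<iota> x \<otimes>\<^bsub>U\<^esub> \<iota> y \<ominus>\<^bsub>U\<^esub> \<iota> y \<otimes>\<^bsub>U\<^esub> \<iota> x)"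
      using gen_closed[OF xy(1)] gen_closed[OF xy(2)] by algebra
    then show "?f x \<otimes>\<^bsub>opp_alg U\<^esub> ?f y \<ominus>\<^bsub>opp_alg U\<^esub> ?f y \<otimes>\<^bsub>opp_alg U\<^esub> ?f x = ?f (x \<otimes>\<^bsub>L\<^esub> y)"
      using xy by (simp add: opp_alg_minus gen_rel)
  qed (use that in auto)
  show thesis
    using that[of S] S alg_homD[OF S(1)] by (simp add: lin_hom_opp)
qed

lemma filtered_hopf_algebra_U: "filtered_hopf_algebra R U \<Delta> \<epsilon> Fil"
proof -
  obtain S where S: "S \<in> lin_hom R U U" and S1: "S \<one>\<^bsub>U\<^esub> = \<one>\<^bsub>U\<^esub>"
    and Sm: "\<And>u v. \<lbrakk>u \<in> carrier U; v \<in> carrier U\<rbrakk> \<Longrightarrow> S (u \<otimes>\<^bsub>U\<^esub> v) = S v \<otimes>\<^bsub>U\<^esub> S u"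
    and Sg: "\<And>x. x \<in> carrier L \<Longrightarrow> S (\<iota> x) = \<ominus>\<^bsub>U\<^esub> \<iota> x"
    using antipode_ex by metis
  note Sc = lin_homD(1)[OF S]
  have id: "(\<lambda>x. x) \<in> lin_hom R U U" by (intro lin_homI) auto
  note bX = bilin_map_comp[OF U.mult_bilin S id] and bY = bilin_map_comp[OF U.mult_bilin id S]
  note X = UUU.AB.tensor_lift[OF U.module_axioms' bX] and Y = UUU.AB.tensor_lift[OF U.module_axioms' bY]
  let ?X = "tensor_lift R U (\<lambda>a b. S a \<otimes>\<^bsub>U\<^esub> b)" and ?Y = "tensor_lift R U (\<lambda>a b. a \<otimes>\<^bsub>U\<^esub> S b)"
  \<comment> \<open>The convolution of \<open>S\<close> with the identity kills left multiples of a
    primitive generator: S(x a) b = - S(a) x b cancels against S(a) x b. Only the empty word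
    survives.\<close>
  have X0: "?X (prim (\<iota> x) \<otimes>\<^bsub>UU\<^esub> t) = \<zero>\<^bsub>U\<^esub>" if x: "x \<in> carrier L" and t: "t \<in> carrier UU" for x t
  proof -
    note g = gen_closed[OF x]
    have "?X (prim (\<iota> x) \<otimes>\<^bsub>UU\<^esub> t) \<in> {\<zero>\<^bsub>U\<^esub>}"
    proof (rule UUU.AB.tensor_hom_mem[OF lin_hom_comp[OF bilin_mapD(3)[OF UUU.AB.T'.mult_bilin] X(1)]
          U.module_axioms' U.zero_submodule _ t])
      fix a b assume ab: "a \<in> carrier U" "b \<in> carrier U"
      have "?X (prim (\<iota> x) \<otimes>\<^bsub>UU\<^esub> pure a b) = S a \<otimes>\<^bsub>U\<^esub> (\<iota> x \<otimes>\<^bsub>U\<^esub> b) \<oplus>\<^bsub>U\<^esub> (S a \<otimes>\<^bsub>U\<^esub> (\<ominus>\<^bsub>U\<^esub> \<iota> x)) \<otimes>\<^bsub>U\<^esub> b"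
        using ab g x by (simp add: prim_mult_pure lin_homD[OF X(1)] X(2) pure_closed Sm Sg)
      also have "\<dots> = \<zero>\<^bsub>U\<^esub>" using Sc[OF ab(1)] ab(2) g by algebra
      finally show "?X (prim (\<iota> x) \<otimes>\<^bsub>UU\<^esub> pure a b) \<in> {\<zero>\<^bsub>U\<^esub>}" by simp
    qed (intro prim_closed g)
    then show ?thesis by simp
  qed
  \<comment> \<open>The mirror image, for right multiples. Hence this identity is proved by peeling
    off the last letter and the other one by peeling off the first.\<close>
  have Y0: "?Y (t \<otimes>\<^bsub>UU\<^esub> prim (\<iota> x)) = \<zero>\<^bsub>U\<^esub>" if x: "x \<in> carrier L" and t: "t \<in> carrier UU" for x t
  proof -
    note g = gen_closed[OF x]
    have "?Y (t \<otimes>\<^bsub>UU\<^esub> prim (\<iota> x)) \<in> {\<zero>\<^bsub>U\<^esub>}"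
    proof (rule UUU.AB.tensor_hom_mem[OF lin_hom_comp[OF bilin_mapD(1)[OF UUU.AB.T'.mult_bilin] Y(1)]
          U.module_axioms' U.zero_submodule _ t])
      fix a b assume ab: "a \<in> carrier U" "b \<in> carrier U"
      have "?Y (pure a b \<otimes>\<^bsub>UU\<^esub> prim (\<iota> x)) = a \<otimes>\<^bsub>U\<^esub> ((\<ominus>\<^bsub>U\<^esub> \<iota> x) \<otimes>\<^bsub>U\<^esub> S b) \<oplus>\<^bsub>U\<^esub> (a \<otimes>\<^bsub>U\<^esub> \<iota> x) \<otimes>\<^bsub>U\<^esub> S b"
        using ab g x by (simp add: prim_mult_pure lin_homD[OF Y(1)] Y(2) pure_closed Sm Sg)
      also have "\<dots> = \<zero>\<^bsub>U\<^esub>" using Sc[OF ab(2)] ab(1) g by algebra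
      finally show "?Y (pure a b \<otimes>\<^bsub>UU\<^esub> prim (\<iota> x)) \<in> {\<zero>\<^bsub>U\<^esub>}" by simp
    qed (intro prim_closed g)
    then show ?thesis by simp
  qed
  have e: "(\<lambda>u. \<epsilon> u \<odot>\<^bsub>U\<^esub> \<one>\<^bsub>U\<^esub>) \<in> lin_hom R U U"
    using lin_homD[OF counit_lin] by (intro lin_homI) (auto simp: U.smult_l_distr U.smult_assoc1)
  have "is_antipode R U \<Delta> \<epsilon> S"
    unfolding is_antipode_def
  proof (intro conjI ballI S)
    fix u assume u: "u \<in> carrier U"
    show "?X (\<Delta> u) = \<epsilon> u \<odot>\<^bsub>U\<^esub> \<one>\<^bsub>U\<^esub>"
    proof (rule lin_hom_U_eq[OF lin_hom_comp[OF comult_lin X(1)] e U.module_axioms' _ u])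
      fix w assume w: "w \<in> words"
      show "?X (\<Delta> (uw w)) = \<epsilon> (uw w) \<odot>\<^bsub>U\<^esub> \<one>\<^bsub>U\<^esub>"
      proof (cases w)
        case Nil
        then show ?thesis unfolding Nil comult_Nil by (simp add: X(2) S1 counit_one)
      next
        case (Cons x v)
        then have xv: "v \<in> words" "x \<in> carrier L" using w by auto
        show ?thesis unfolding Cons comult_Cons[OF xv] counit_Cons[OF xv]
          using X0[OF xv(2) lin_homD(1)[OF comult_lin uw_closed[OF xv(1)]]] by simp
      qed
    qed
    show "?Y (\<Delta> u) = \<epsilon> u \<odot>\<^bsub>U\<^esub> \<one>\<^bsub>U\<^esub>"
    proof (rule lin_hom_U_eq[OF lin_hom_comp[OF comult_lin Y(1)] e U.module_axioms' _ u])
      fix w assume w: "w \<in> words"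
      show "?Y (\<Delta> (uw w)) = \<epsilon> (uw w) \<odot>\<^bsub>U\<^esub> \<one>\<^bsub>U\<^esub>"
      proof (cases w rule: rev_cases)
        case Nil
        then show ?thesis unfolding Nil comult_Nil by (simp add: Y(2) S1 counit_one)
      next
        case (snoc v x)
        then have xv: "v \<in> words" "x \<in> carrier L" using w by auto
        show ?thesis unfolding snoc comult_snoc[OF xv] counit_snoc[OF xv]
          using Y0[OF xv(2) lin_homD(1)[OF comult_lin uw_closed[OF xv(1)]]] by simp
      qed
    qed
  qed
  \<comment> \<open>On words \<open>S\<close> reverses the letters and inserts signs, so the length
    does not grow.\<close>
  moreover have "S u \<in> Fil n" if u: "u \<in> Fil n" for u n
  proof (rule Fil_lin_hom_mem[OF S U.module_axioms' Fil_submodule _ u])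
    have "S (uw w) \<in> Fil (length w)" if "w \<in> words" for w
      using that
    proof (induct w)
      case (Cons x w)
      then have "S (uw w) \<otimes>\<^bsub>U\<^esub> \<ominus>\<^bsub>U\<^esub> \<iota> x \<in> Fil (length w + 1)"
        by (intro Fil_mult FilD(5) gen_Fil) auto
      then show ?case using Cons by (simp add: Sm Sg gen_closed uw_closed)
    qed (simp add: S1 Fil_one)
    then show "S (uw w) \<in> Fil n" if "w \<in> words" "length w \<le> n" for w
      using Fil_mono that by blast
  qed
  ultimately show ?thesis
    unfolding filtered_hopf_algebra_def
    using bialgebra_U filtered_algebra_U filtered_coalgebra_U by blast
qed

end

section \<open>Associated graded algebras\<close>

locale filt_alg = assoc_alg R A for R (structure) and A (structure) +
  fixes F :: "nat \<Rightarrow> 'c set"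
  assumes F_submodule: "submodule (F n) R A"
    and F_Suc: "F n \<subseteq> F (Suc n)"
    and F_one: "\<one>\<^bsub>A\<^esub> \<in> F 0"
    and F_mult: "\<lbrakk>x \<in> F m; y \<in> F n\<rbrakk> \<Longrightarrow> x \<otimes>\<^bsub>A\<^esub> y \<in> F (m + n)"

lemma filtered_algebra_filt_alg: "filtered_algebra R A F \<Longrightarrow> filt_alg R A F"
  unfolding filtered_algebra_def module_filtration_def assoc_algebra_iff
  by (intro filt_alg.intro filt_alg_axioms.intro) auto

context filt_alg
begin

lemmas FD = submoduleD[OF F_submodule]

abbreviation "P \<equiv> filt_pred A F"

lemma P_0 [simp]: "P 0 = {\<zero>\<^bsub>A\<^esub>}" and P_Suc [simp]: "P (Suc n) = F n"
  by (simp_all add: filt_pred_def)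

lemma P_submodule: "submodule (P n) R A"
  by (cases n) (auto simp: zero_submodule F_submodule)

lemmas PD = submoduleD[OF P_submodule]

lemma P_subset: "P n \<subseteq> F n"
  using FD(2) F_Suc by (cases n) auto

text \<open>For \<open>i = 0\<close> the left factor is zero, as the piece below degree 0 is zero,
  and zero belongs to every \<open>P\<close>.\<close>

lemma P_mult_l: "\<lbrakk>x \<in> P i; y \<in> F j\<rbrakk> \<Longrightarrow> x \<otimes>\<^bsub>A\<^esub> y \<in> P (i + j)"
  using F_mult FD(1) PD(2) by (cases i) auto

lemma P_mult_r: "\<lbrakk>x \<in> F i; y \<in> P j\<rbrakk> \<Longrightarrow> x \<otimes>\<^bsub>A\<^esub> y \<in> P (i + j)"
  using F_mult FD(1) PD(2) by (cases j) auto

lemma quot_P: "mod_quot R A (P n)"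
  by (intro mod_quot.intro module_axioms P_submodule)

sublocale Q: mod_quot R A "P n" for n
  by (rule quot_P)

lemma P_coset_eq_iff:
  "\<lbrakk>x \<in> carrier A; y \<in> carrier A\<rbrakk> \<Longrightarrow> P n +>\<^bsub>A\<^esub> x = P n +>\<^bsub>A\<^esub> y \<longleftrightarrow> x \<ominus>\<^bsub>A\<^esub> y \<in> P n"
  by (rule Q.proj_eq_iff)

text \<open>The graded product is well defined because x' y' - x y = (x' - x) y' + x (y' - y), where
  each summand has one factor in the smaller piece. The union thus runs over equal cosets.\<close>

lemma P_coset_mult:
  assumes x: "x \<in> F i" and y: "y \<in> F j"
  shows "(\<Union>x'\<in>P i +>\<^bsub>A\<^esub> x. \<Union>y'\<in>P j +>\<^bsub>A\<^esub> y. P (i + j) +>\<^bsub>A\<^esub> (x' \<otimes>\<^bsub>A\<^esub> y')) = P (i + j) +>\<^bsub>A\<^esub> (x \<otimes>\<^bsub>A\<^esub> y)"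
proof -
  have c: "x \<in> carrier A" "y \<in> carrier A" using x y FD(1) by auto
  have eq: "P (i + j) +>\<^bsub>A\<^esub> (x' \<otimes>\<^bsub>A\<^esub> y') = P (i + j) +>\<^bsub>A\<^esub> (x \<otimes>\<^bsub>A\<^esub> y)"
    if x': "x' \<in> P i +>\<^bsub>A\<^esub> x" and y': "y' \<in> P j +>\<^bsub>A\<^esub> y" for x' y'
  proof -
    have xc: "x' \<in> carrier A" "x' \<ominus>\<^bsub>A\<^esub> x \<in> P i"
      using Q.mem_projD[OF x' c(1)] P_coset_eq_iff[of x' x i] c by blast+
    have yc: "y' \<in> carrier A" "y' \<ominus>\<^bsub>A\<^esub> y \<in> P j"
      using Q.mem_projD[OF y' c(2)] P_coset_eq_iff[of y' y j] c by blast+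
    \<comment> \<open>\<open>y'\<close> has to be placed in \<open>F j\<close> first: it multiplies
      \<open>x' - x\<close>, and \<open>P_mult_l\<close> asks for the degree of that factor.\<close>
    have "(y' \<ominus>\<^bsub>A\<^esub> y) \<oplus>\<^bsub>A\<^esub> y \<in> F j" using yc(2) P_subset y FD(3) by blast
    moreover have "(y' \<ominus>\<^bsub>A\<^esub> y) \<oplus>\<^bsub>A\<^esub> y = y'" using yc(1) c(2) by algebra
    ultimately have "y' \<in> F j" by simp
    then have "(x' \<ominus>\<^bsub>A\<^esub> x) \<otimes>\<^bsub>A\<^esub> y' \<oplus>\<^bsub>A\<^esub> x \<otimes>\<^bsub>A\<^esub> (y' \<ominus>\<^bsub>A\<^esub> y) \<in> P (i + j)"
      using P_mult_l[OF xc(2)] P_mult_r[OF x yc(2)] PD(3) by blast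
    moreover have "(x' \<ominus>\<^bsub>A\<^esub> x) \<otimes>\<^bsub>A\<^esub> y' \<oplus>\<^bsub>A\<^esub> x \<otimes>\<^bsub>A\<^esub> (y' \<ominus>\<^bsub>A\<^esub> y) = x' \<otimes>\<^bsub>A\<^esub> y' \<ominus>\<^bsub>A\<^esub> x \<otimes>\<^bsub>A\<^esub> y"
      using xc(1) yc(1) c by algebra
    ultimately show ?thesis using xc(1) yc(1) c by (subst P_coset_eq_iff) auto
  qed
  have "(\<Union>y'\<in>P j +>\<^bsub>A\<^esub> y. P (i + j) +>\<^bsub>A\<^esub> (x' \<otimes>\<^bsub>A\<^esub> y')) = P (i + j) +>\<^bsub>A\<^esub> (x \<otimes>\<^bsub>A\<^esub> y)"
    if "x' \<in> P i +>\<^bsub>A\<^esub> x" for x'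
    by (rule UN_constant_eq[OF Q.proj_self[OF c(2)]]) (rule ballI, rule eq[OF that])
  then show ?thesis
    by (intro UN_constant_eq[OF Q.proj_self[OF c(1)]] ballI)
qed

text \<open>The Rees algebra, through which the laws of the associated graded algebra are verified.\<close>

definition rees :: "('a, nat \<Rightarrow> 'c) module" where
  "rees = \<lparr>carrier = {f. (\<forall>n. f n \<in> F n) \<and> (\<exists>n. bound \<zero>\<^bsub>A\<^esub> n f)},
     mult = (\<lambda>f g n. \<Oplus>\<^bsub>A\<^esub>i\<in>{..n}. f i \<otimes>\<^bsub>A\<^esub> g (n - i)),
     one = (\<lambda>n. if n = 0 then \<one>\<^bsub>A\<^esub> else \<zero>\<^bsub>A\<^esub>),
     zero = (\<lambda>n. \<zero>\<^bsub>A\<^esub>), add = (\<lambda>f g n. f n \<oplus>\<^bsub>A\<^esub> g n), smult = (\<lambda>c f n. c \<odot>\<^bsub>A\<^esub> f n)\<rparr>"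

lemma rees_simps [simp]:
  "mult rees = (\<lambda>f g n. \<Oplus>\<^bsub>A\<^esub>i\<in>{..n}. f i \<otimes>\<^bsub>A\<^esub> g (n - i))"
  "one rees = (\<lambda>n. if n = 0 then \<one>\<^bsub>A\<^esub> else \<zero>\<^bsub>A\<^esub>)"
  "zero rees = (\<lambda>n. \<zero>\<^bsub>A\<^esub>)" "add rees = (\<lambda>f g n. f n \<oplus>\<^bsub>A\<^esub> g n)" "smult rees = (\<lambda>c f n. c \<odot>\<^bsub>A\<^esub> f n)"
  by (simp_all add: rees_def)

lemma rees_carrier: "f \<in> carrier rees \<longleftrightarrow> (\<forall>n. f n \<in> F n) \<and> (\<exists>n. bound \<zero>\<^bsub>A\<^esub> n f)"
  by (simp add: rees_def)

lemma rees_up: "f \<in> carrier rees \<Longrightarrow> f \<in> up A"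
  by (auto simp: rees_carrier up_def intro: FD(1))

lemma rees_F: "f \<in> carrier rees \<Longrightarrow> f n \<in> F n"
  by (simp add: rees_carrier)

lemma rees_closed: "f \<in> carrier rees \<Longrightarrow> f n \<in> carrier A"
  by (rule FD(1)[OF rees_F])

lemma finsum_F: "(\<And>i. i \<in> I \<Longrightarrow> f i \<in> F n) \<Longrightarrow> finite I \<Longrightarrow> (\<Oplus>\<^bsub>A\<^esub>i\<in>I. f i) \<in> F n"
proof (induct I rule: infinite_finite_induct)
  case (insert x I)
  then have "f \<in> I \<rightarrow> carrier A" "f x \<in> carrier A" using FD(1) by blast+
  with insert show ?case by (simp add: FD(3))
qed (auto simp: FD(2))

lemma rees_mult_closed:
  assumes f: "f \<in> carrier rees" and g: "g \<in> carrier rees"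
  shows "f \<otimes>\<^bsub>rees\<^esub> g \<in> carrier rees"
  unfolding rees_carrier
proof
  show "\<forall>n. (f \<otimes>\<^bsub>rees\<^esub> g) n \<in> F n"
  proof (rule allI, simp, rule finsum_F)
    show "f i \<otimes>\<^bsub>A\<^esub> g (n - i) \<in> F n" if "i \<in> {..n}" for i n
      using F_mult[OF rees_F[OF f, of i] rees_F[OF g, of "n - i"]] that by simp
  qed simp
  show "\<exists>n. bound \<zero>\<^bsub>A\<^esub> n (f \<otimes>\<^bsub>rees\<^esub> g)"
    using A.bound_upD[OF A.up_mult_closed[OF rees_up[OF f] rees_up[OF g]]] by simp
qed

text \<open>The Rees algebra lies inside the polynomials over \<open>A\<close>, with
  \<open>f n\<close> as the coefficient of degree \<open>n\<close>. Unit laws, associativity and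
  distributivity are inherited from there.\<close>

lemma rees_mult_UP:
  assumes "f \<in> carrier rees" "g \<in> carrier rees"
  shows "f \<otimes>\<^bsub>rees\<^esub> g = f \<otimes>\<^bsub>UP A\<^esub> g"
  using assms rees_up by (simp add: UP_def)

lemma UP_ring_A: "UP_ring A"
  by (rule UP_ring.intro) (rule A.ring_axioms)

lemma assoc_alg_rees: "assoc_alg R rees"
proof -
  interpret UPA: ring "UP A"
    by (rule UP_ring.UP_ring[OF UP_ring_A])
  have up: "f \<in> carrier (UP A)" if "f \<in> carrier rees" for f
    using rees_up[OF that] by (simp add: UP_def)
  have add: "f \<oplus>\<^bsub>rees\<^esub> g = f \<oplus>\<^bsub>UP A\<^esub> g" if "f \<in> carrier rees" "g \<in> carrier rees" for f g
    using that rees_up by (simp add: UP_def)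
  have one: "\<one>\<^bsub>rees\<^esub> = \<one>\<^bsub>UP A\<^esub>" by (simp add: UP_def)
  have addc: "f \<oplus>\<^bsub>rees\<^esub> g \<in> carrier rees" if "f \<in> carrier rees" "g \<in> carrier rees" for f g
    unfolding rees_carrier
    using A.bound_upD[OF A.up_add_closed[OF rees_up[OF that(1)] rees_up[OF that(2)]]] that
    by (auto intro: FD(3) rees_F)
  have smultc: "c \<odot>\<^bsub>rees\<^esub> f \<in> carrier rees" if c: "c \<in> carrier R" and f: "f \<in> carrier rees" for c f
  proof -
    obtain n where "bound \<zero>\<^bsub>A\<^esub> n f" using f by (auto simp: rees_carrier)
    then have "bound \<zero>\<^bsub>A\<^esub> n (c \<odot>\<^bsub>rees\<^esub> f)" using c by (auto simp: bound_def)
    then show ?thesis using c f by (auto simp: rees_carrier intro: FD(4))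
  qed
  have onec: "\<one>\<^bsub>rees\<^esub> \<in> carrier rees"
    unfolding rees_carrier using F_one FD(2) by (auto intro!: exI[of _ 0])
  have zeroc: "\<zero>\<^bsub>rees\<^esub> \<in> carrier rees"
    unfolding rees_carrier using FD(2) by auto
  have g: "abelian_group rees"
  proof (rule abelian_groupI)
    fix f assume f: "f \<in> carrier rees"
    show "\<exists>g\<in>carrier rees. g \<oplus>\<^bsub>rees\<^esub> f = \<zero>\<^bsub>rees\<^esub>"
    proof (rule bexI)
      show "((\<ominus>\<^bsub>R\<^esub> \<one>\<^bsub>R\<^esub>) \<odot>\<^bsub>rees\<^esub> f) \<oplus>\<^bsub>rees\<^esub> f = \<zero>\<^bsub>rees\<^esub>"
        using rees_closed[OF f] by (auto simp: a_inv_eq_smult[symmetric] M.l_neg)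
      show "(\<ominus>\<^bsub>R\<^esub> \<one>\<^bsub>R\<^esub>) \<odot>\<^bsub>rees\<^esub> f \<in> carrier rees" by (rule smultc[OF _ f]) simp
    qed
  next
    fix f h k assume f: "f \<in> carrier rees" and h: "h \<in> carrier rees" and k: "k \<in> carrier rees"
    show "(f \<oplus>\<^bsub>rees\<^esub> h) \<oplus>\<^bsub>rees\<^esub> k = f \<oplus>\<^bsub>rees\<^esub> (h \<oplus>\<^bsub>rees\<^esub> k)"
      using rees_closed[OF f] rees_closed[OF h] rees_closed[OF k] by (simp add: M.a_assoc)
  next
    fix f assume f: "f \<in> carrier rees"
    show "\<zero>\<^bsub>rees\<^esub> \<oplus>\<^bsub>rees\<^esub> f = f" using rees_closed[OF f] by simp
    fix h assume h: "h \<in> carrier rees"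
    show "f \<oplus>\<^bsub>rees\<^esub> h \<in> carrier rees" by (rule addc[OF f h])
    show "f \<oplus>\<^bsub>rees\<^esub> h = h \<oplus>\<^bsub>rees\<^esub> f" using rees_closed[OF f] rees_closed[OF h] by (simp add: M.a_comm)
  qed (rule zeroc)
  have m: "module R rees"
  proof (rule moduleI[OF R.is_cring g smultc])
    fix f assume f: "f \<in> carrier rees"
    note cl = rees_closed[OF f]
    show "\<one>\<^bsub>R\<^esub> \<odot>\<^bsub>rees\<^esub> f = f" using cl by simp
    fix c assume c: "c \<in> carrier R"
    show "c \<odot>\<^bsub>rees\<^esub> (f \<oplus>\<^bsub>rees\<^esub> h) = c \<odot>\<^bsub>rees\<^esub> f \<oplus>\<^bsub>rees\<^esub> c \<odot>\<^bsub>rees\<^esub> h" if h: "h \<in> carrier rees" for h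
      using c cl rees_closed[OF h] by (simp add: smult_r_distr)
    fix d assume d: "d \<in> carrier R"
    show "(c \<oplus>\<^bsub>R\<^esub> d) \<odot>\<^bsub>rees\<^esub> f = c \<odot>\<^bsub>rees\<^esub> f \<oplus>\<^bsub>rees\<^esub> d \<odot>\<^bsub>rees\<^esub> f"
      "(c \<otimes>\<^bsub>R\<^esub> d) \<odot>\<^bsub>rees\<^esub> f = c \<odot>\<^bsub>rees\<^esub> (d \<odot>\<^bsub>rees\<^esub> f)"
      using c d cl by (simp_all add: smult_l_distr smult_assoc1)
  qed
  have r: "ring rees"
  proof (rule ringI[OF g])
    show "monoid rees"
    proof (rule monoidI)
      fix f assume f: "f \<in> carrier rees"
      show "\<one>\<^bsub>rees\<^esub> \<otimes>\<^bsub>rees\<^esub> f = f"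
        unfolding rees_mult_UP[OF onec f] unfolding one by (rule UPA.l_one[OF up[OF f]])
      show "f \<otimes>\<^bsub>rees\<^esub> \<one>\<^bsub>rees\<^esub> = f"
        unfolding rees_mult_UP[OF f onec] unfolding one by (rule UPA.r_one[OF up[OF f]])
      fix h k assume h: "h \<in> carrier rees" and k: "k \<in> carrier rees"
      show "(f \<otimes>\<^bsub>rees\<^esub> h) \<otimes>\<^bsub>rees\<^esub> k = f \<otimes>\<^bsub>rees\<^esub> (h \<otimes>\<^bsub>rees\<^esub> k)"
        unfolding rees_mult_UP[OF rees_mult_closed[OF f h] k] rees_mult_UP[OF f rees_mult_closed[OF h k]]
        unfolding rees_mult_UP[OF f h] rees_mult_UP[OF h k]
        by (rule UPA.m_assoc[OF up[OF f] up[OF h] up[OF k]])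
    qed (rule rees_mult_closed onec; assumption)+
  next
    fix f h k assume f: "f \<in> carrier rees" and h: "h \<in> carrier rees" and k: "k \<in> carrier rees"
    have "(f \<oplus>\<^bsub>rees\<^esub> h) \<otimes>\<^bsub>rees\<^esub> k = (f \<oplus>\<^bsub>UP A\<^esub> h) \<otimes>\<^bsub>UP A\<^esub> k"
      unfolding rees_mult_UP[OF addc[OF f h] k] unfolding add[OF f h] by (rule refl)
    also have "\<dots> = f \<otimes>\<^bsub>UP A\<^esub> k \<oplus>\<^bsub>UP A\<^esub> h \<otimes>\<^bsub>UP A\<^esub> k"
      by (rule UPA.l_distr[OF up[OF f] up[OF h] up[OF k]])
    also have "\<dots> = f \<otimes>\<^bsub>rees\<^esub> k \<oplus>\<^bsub>UP A\<^esub> h \<otimes>\<^bsub>rees\<^esub> k"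
      by (simp only: rees_mult_UP[OF f k] rees_mult_UP[OF h k])
    also have "\<dots> = f \<otimes>\<^bsub>rees\<^esub> k \<oplus>\<^bsub>rees\<^esub> h \<otimes>\<^bsub>rees\<^esub> k"
      by (rule add[OF rees_mult_closed[OF f k] rees_mult_closed[OF h k], symmetric])
    finally show "(f \<oplus>\<^bsub>rees\<^esub> h) \<otimes>\<^bsub>rees\<^esub> k = f \<otimes>\<^bsub>rees\<^esub> k \<oplus>\<^bsub>rees\<^esub> h \<otimes>\<^bsub>rees\<^esub> k" .
    have "k \<otimes>\<^bsub>rees\<^esub> (f \<oplus>\<^bsub>rees\<^esub> h) = k \<otimes>\<^bsub>UP A\<^esub> (f \<oplus>\<^bsub>UP A\<^esub> h)"
      unfolding rees_mult_UP[OF k addc[OF f h]] unfolding add[OF f h] by (rule refl)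
    also have "\<dots> = k \<otimes>\<^bsub>UP A\<^esub> f \<oplus>\<^bsub>UP A\<^esub> k \<otimes>\<^bsub>UP A\<^esub> h"
      by (rule UPA.r_distr[OF up[OF f] up[OF h] up[OF k]])
    also have "\<dots> = k \<otimes>\<^bsub>rees\<^esub> f \<oplus>\<^bsub>UP A\<^esub> k \<otimes>\<^bsub>rees\<^esub> h"
      by (simp only: rees_mult_UP[OF k f] rees_mult_UP[OF k h])
    also have "\<dots> = k \<otimes>\<^bsub>rees\<^esub> f \<oplus>\<^bsub>rees\<^esub> k \<otimes>\<^bsub>rees\<^esub> h"
      by (rule add[OF rees_mult_closed[OF k f] rees_mult_closed[OF k h], symmetric])
    finally show "k \<otimes>\<^bsub>rees\<^esub> (f \<oplus>\<^bsub>rees\<^esub> h) = k \<otimes>\<^bsub>rees\<^esub> f \<oplus>\<^bsub>rees\<^esub> k \<otimes>\<^bsub>rees\<^esub> h" .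
  qed
  show ?thesis
    unfolding assoc_alg_def assoc_alg_axioms_def
  proof (intro conjI m r allI impI)
    fix c f h assume c: "c \<in> carrier R" and f: "f \<in> carrier rees" and h: "h \<in> carrier rees"
    note cl = rees_closed[OF f] rees_closed[OF h]
    show "(c \<odot>\<^bsub>rees\<^esub> f) \<otimes>\<^bsub>rees\<^esub> h = c \<odot>\<^bsub>rees\<^esub> (f \<otimes>\<^bsub>rees\<^esub> h)"
      "f \<otimes>\<^bsub>rees\<^esub> (c \<odot>\<^bsub>rees\<^esub> h) = c \<odot>\<^bsub>rees\<^esub> (f \<otimes>\<^bsub>rees\<^esub> h)"
      unfolding rees_simps using c cl
      by (intro ext; subst finsum_smult_ldistr; auto simp: smult_mult_l smult_mult_r intro!: M.finsum_cong')+
  qed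
qed

section \<open>The associated graded algebra as an image of the Rees algebra\<close>

abbreviation "Gr \<equiv> gr_alg A F"

lemma gr_simps:
  "carrier Gr = {f. (\<forall>n. \<exists>x\<in>F n. f n = P n +>\<^bsub>A\<^esub> x) \<and> finite {n. f n \<noteq> P n}}"
  "f \<otimes>\<^bsub>Gr\<^esub> g = (\<lambda>n. \<Oplus>\<^bsub>quot_alg A (P n)\<^esub>i\<in>{..n}.
     \<Union>x\<in>f i. \<Union>y\<in>g (n - i). P n +>\<^bsub>A\<^esub> (x \<otimes>\<^bsub>A\<^esub> y))"
  "\<one>\<^bsub>Gr\<^esub> = (\<lambda>n. if n = 0 then P n +>\<^bsub>A\<^esub> \<one>\<^bsub>A\<^esub> else P n)"
  "\<zero>\<^bsub>Gr\<^esub> = P" "f \<oplus>\<^bsub>Gr\<^esub> g = (\<lambda>n. f n <+>\<^bsub>A\<^esub> g n)"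
  "c \<odot>\<^bsub>Gr\<^esub> f = (\<lambda>n. \<Union>x\<in>f n. P n +>\<^bsub>A\<^esub> (c \<odot>\<^bsub>A\<^esub> x))"
  by (simp_all add: gr_alg_def Let_def)

definition gr_proj where
  "gr_proj f = (\<lambda>n. P n +>\<^bsub>A\<^esub> f n)"

lemma P_coset_zero: "P n +>\<^bsub>A\<^esub> \<zero>\<^bsub>A\<^esub> = P n"
  using Q.proj_zero_iff[OF M.zero_closed] PD(2) by blast

text \<open>Reducing each coefficient modulo the preceding piece respects products by
  \<open>P_coset_mult\<close>. Together with \<open>gr_proj_surj\<close>, this lets
  \<open>assoc_alg_transport\<close> carry the algebra laws over to \<open>Gr\<close>.\<close>

lemma gr_proj_alg_hom: "gr_proj \<in> alg_hom R rees Gr"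
proof (rule alg_homI)
  show "gr_proj \<in> lin_hom R rees Gr"
  proof (rule lin_homI)
    fix f assume f: "f \<in> carrier rees"
    then obtain N where "bound \<zero>\<^bsub>A\<^esub> N f" by (auto simp: rees_carrier)
    then have "{n. gr_proj f n \<noteq> P n} \<subseteq> {..N}"
      unfolding gr_proj_def using P_coset_zero by (auto simp: bound_def linorder_not_le[symmetric])
    then have "finite {n. gr_proj f n \<noteq> P n}" by (rule finite_subset) simp
    then show "gr_proj f \<in> carrier Gr"
      unfolding gr_simps using rees_F[OF f] by (auto simp: gr_proj_def)
    show "gr_proj (f \<oplus>\<^bsub>rees\<^esub> g) = gr_proj f \<oplus>\<^bsub>Gr\<^esub> gr_proj g" if "g \<in> carrier rees" for g
      unfolding gr_simps gr_proj_def using rees_closed[OF f] rees_closed[OF that]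
      by (simp add: Q.Q.a_rcos_sum)
    show "gr_proj (c \<odot>\<^bsub>rees\<^esub> f) = c \<odot>\<^bsub>Gr\<^esub> gr_proj f" if "c \<in> carrier R" for c
      unfolding gr_simps gr_proj_def using Q.proj_smult[OF that rees_closed[OF f]]
      by (simp add: quot_alg_simps)
  qed
  show "gr_proj \<one>\<^bsub>rees\<^esub> = \<one>\<^bsub>Gr\<^esub>"
    unfolding gr_simps gr_proj_def by (rule ext) (simp add: P_coset_zero)
  fix f g assume f: "f \<in> carrier rees" and g: "g \<in> carrier rees"
  show "gr_proj (f \<otimes>\<^bsub>rees\<^esub> g) = gr_proj f \<otimes>\<^bsub>Gr\<^esub> gr_proj g"
  proof
    fix n
    interpret Qn: module R "quot_alg A (P n)" by (rule Q.module_Q)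
    have cl: "f i \<otimes>\<^bsub>A\<^esub> g (n - i) \<in> carrier A" for i
      using rees_closed[OF f] rees_closed[OF g] by simp
    have "gr_proj (f \<otimes>\<^bsub>rees\<^esub> g) n = (\<Oplus>\<^bsub>quot_alg A (P n)\<^esub>i\<in>{..n}. P n +>\<^bsub>A\<^esub> (f i \<otimes>\<^bsub>A\<^esub> g (n - i)))"
      unfolding gr_proj_def rees_simps
      by (rule lin_hom_finsum[OF Q.proj_lin module_axioms Q.module_Q]) (use cl in auto)
    also have "\<dots> = (gr_proj f \<otimes>\<^bsub>Gr\<^esub> gr_proj g) n"
      unfolding gr_simps gr_proj_def
    proof (rule Qn.M.finsum_cong'[OF refl])
      have eq: "P n +>\<^bsub>A\<^esub> (f i \<otimes>\<^bsub>A\<^esub> g (n - i)) =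
         (\<Union>x\<in>P i +>\<^bsub>A\<^esub> f i. \<Union>y\<in>P (n - i) +>\<^bsub>A\<^esub> g (n - i). P n +>\<^bsub>A\<^esub> x \<otimes>\<^bsub>A\<^esub> y)" if "i \<in> {..n}" for i
        using P_coset_mult[OF rees_F[OF f, of i] rees_F[OF g, of "n - i"]] that by simp
      then show "i \<in> {..n} \<Longrightarrow> P n +>\<^bsub>A\<^esub> (f i \<otimes>\<^bsub>A\<^esub> g (n - i)) =
         (\<Union>x\<in>P i +>\<^bsub>A\<^esub> f i. \<Union>y\<in>P (n - i) +>\<^bsub>A\<^esub> g (n - i). P n +>\<^bsub>A\<^esub> x \<otimes>\<^bsub>A\<^esub> y)" for i .
      show "(\<lambda>i. \<Union>x\<in>P i +>\<^bsub>A\<^esub> f i. \<Union>y\<in>P (n - i) +>\<^bsub>A\<^esub> g (n - i). P n +>\<^bsub>A\<^esub> x \<otimes>\<^bsub>A\<^esub> y)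
        \<in> {..n} \<rightarrow> carrier (quot_alg A (P n))"
        using Q.proj_closed[OF cl] by (simp add: eq[symmetric])
    qed
    finally show "gr_proj (f \<otimes>\<^bsub>rees\<^esub> g) n = (gr_proj f \<otimes>\<^bsub>Gr\<^esub> gr_proj g) n" .
  qed
qed

lemma gr_proj_surj:
  assumes h: "h \<in> carrier Gr"
  shows "\<exists>f\<in>carrier rees. gr_proj f = h"
proof -
  \<comment> \<open>The representative zero is chosen wherever the coset is trivial; otherwise the
    chosen family need not be eventually zero and could fall outside the Rees algebra.\<close>
  have "\<forall>n. \<exists>x. x \<in> F n \<and> h n = P n +>\<^bsub>A\<^esub> x \<and> (h n = P n \<longrightarrow> x = \<zero>\<^bsub>A\<^esub>)"
  proof
    fix n
    obtain x where x: "x \<in> F n" "h n = P n +>\<^bsub>A\<^esub> x" using h unfolding gr_simps by blast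
    show "\<exists>x. x \<in> F n \<and> h n = P n +>\<^bsub>A\<^esub> x \<and> (h n = P n \<longrightarrow> x = \<zero>\<^bsub>A\<^esub>)"
      by (rule exI[of _ "if h n = P n then \<zero>\<^bsub>A\<^esub> else x"]) (use x FD(2) P_coset_zero in auto)
  qed
  then obtain f where f: "\<And>n. f n \<in> F n" "\<And>n. h n = P n +>\<^bsub>A\<^esub> f n" "\<And>n. h n = P n \<Longrightarrow> f n = \<zero>\<^bsub>A\<^esub>"
    by metis
  have "finite {n. h n \<noteq> P n}" using h unfolding gr_simps by simp
  then obtain N where N: "\<And>n. h n \<noteq> P n \<Longrightarrow> n \<le> N"
    using finite_nat_set_iff_bounded_le by auto
  have "bound \<zero>\<^bsub>A\<^esub> N f"
    using N f(3) by (meson bound.intro linorder_not_le)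
  then have "f \<in> carrier rees" using f(1) by (auto simp: rees_carrier)
  moreover have "gr_proj f = h" using f(2) by (auto simp: gr_proj_def)
  ultimately show ?thesis by blast
qed

lemma assoc_alg_gr: "assoc_alg R Gr"
  by (rule assoc_alg_transport[OF assoc_alg_rees gr_proj_surj gr_proj_alg_hom])
    (auto simp: gr_simps gr_proj_def P_coset_zero)

definition homog where
  "homog n x = (\<lambda>m. if m = n then x else \<zero>\<^bsub>A\<^esub>)"

lemma homog_closed: "x \<in> F n \<Longrightarrow> homog n x \<in> carrier rees"
  unfolding rees_carrier homog_def using FD(2) by (auto intro!: exI[of _ n])

lemma gr_class_homog: "gr_class A F n x = gr_proj (homog n x)"
  by (rule ext) (simp add: gr_class_def gr_proj_def homog_def P_coset_zero)

lemma gr_class_closed: "x \<in> F n \<Longrightarrow> gr_class A F n x \<in> carrier Gr"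
  unfolding gr_class_homog by (rule alg_homD(4)[OF gr_proj_alg_hom homog_closed])

lemma gr_class_add:
  assumes "x \<in> F n" "y \<in> F n"
  shows "gr_class A F n (x \<oplus>\<^bsub>A\<^esub> y) = gr_class A F n x \<oplus>\<^bsub>Gr\<^esub> gr_class A F n y"
proof -
  have "homog n (x \<oplus>\<^bsub>A\<^esub> y) = homog n x \<oplus>\<^bsub>rees\<^esub> homog n y" by (auto simp: homog_def)
  then show ?thesis
    unfolding gr_class_homog using lin_homD(2)[OF alg_homD(1)[OF gr_proj_alg_hom]] homog_closed assms by metis
qed

lemma gr_class_smult:
  assumes "c \<in> carrier R" "x \<in> F n"
  shows "gr_class A F n (c \<odot>\<^bsub>A\<^esub> x) = c \<odot>\<^bsub>Gr\<^esub> gr_class A F n x"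
proof -
  have "homog n (c \<odot>\<^bsub>A\<^esub> x) = c \<odot>\<^bsub>rees\<^esub> homog n x" using assms by (auto simp: homog_def)
  then show ?thesis
    unfolding gr_class_homog using lin_homD(3)[OF alg_homD(1)[OF gr_proj_alg_hom]] homog_closed assms by metis
qed

lemma gr_class_mult:
  assumes x: "x \<in> F i" and y: "y \<in> F j"
  shows "gr_class A F i x \<otimes>\<^bsub>Gr\<^esub> gr_class A F j y = gr_class A F (i + j) (x \<otimes>\<^bsub>A\<^esub> y)"
proof -
  have c: "x \<in> carrier A" "y \<in> carrier A" using x y FD(1) by auto
  have "homog i x \<otimes>\<^bsub>rees\<^esub> homog j y = homog (i + j) (x \<otimes>\<^bsub>A\<^esub> y)"
  proof
    fix n
    \<comment> \<open>Only the index \<open>k = i\<close> can contribute to the convolution, and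
      then only in degree \<open>n = i + j\<close>.\<close>
    have "homog i x k \<otimes>\<^bsub>A\<^esub> homog j y (n - k)
      = (if i = k then (if n = i + j then x \<otimes>\<^bsub>A\<^esub> y else \<zero>\<^bsub>A\<^esub>) else \<zero>\<^bsub>A\<^esub>)" if "k \<le> n" for k
      using c that by (auto simp: homog_def)
    then have "(homog i x \<otimes>\<^bsub>rees\<^esub> homog j y) n
      = (\<Oplus>\<^bsub>A\<^esub>k\<in>{..n}. if i = k then (if n = i + j then x \<otimes>\<^bsub>A\<^esub> y else \<zero>\<^bsub>A\<^esub>) else \<zero>\<^bsub>A\<^esub>)"
      using c unfolding rees_simps by (intro M.finsum_cong') auto
    also have "\<dots> = homog (i + j) (x \<otimes>\<^bsub>A\<^esub> y) n"
    proof (cases "i \<le> n")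
      case True
      then show ?thesis
        using M.add.finprod_singleton[of i "{..n}" "\<lambda>k. if n = i + j then x \<otimes>\<^bsub>A\<^esub> y else \<zero>\<^bsub>A\<^esub>"] c
        by (auto simp: homog_def)
    next
      case False
      then have "(\<Oplus>\<^bsub>A\<^esub>k\<in>{..n}. if i = k then (if n = i + j then x \<otimes>\<^bsub>A\<^esub> y else \<zero>\<^bsub>A\<^esub>) else \<zero>\<^bsub>A\<^esub>)
        = (\<Oplus>\<^bsub>A\<^esub>k\<in>{..n}. \<zero>\<^bsub>A\<^esub>)"
        by (intro M.finsum_cong') auto
      then show ?thesis using False by (auto simp: homog_def)
    qed
    finally show "(homog i x \<otimes>\<^bsub>rees\<^esub> homog j y) n = homog (i + j) (x \<otimes>\<^bsub>A\<^esub> y) n" .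
  qed
  then show ?thesis
    unfolding gr_class_homog using alg_homD(3)[OF gr_proj_alg_hom homog_closed[OF x] homog_closed[OF y]] by metis
qed

lemma gr_class_eq_zero:
  assumes "x \<in> P n"
  shows "gr_class A F n x = \<zero>\<^bsub>Gr\<^esub>"
  unfolding gr_simps gr_class_def using assms PD(1) Q.proj_zero_iff by (auto simp: fun_eq_iff)

lemma gr_one: "\<one>\<^bsub>Gr\<^esub> = gr_class A F 0 \<one>\<^bsub>A\<^esub>"
  unfolding gr_simps gr_class_def by auto

end

section \<open>The canonical map\<close>

text \<open>Two copies of the theory of enveloping algebras over the same module: unqualified for
  the given bracket, and with prefix \<open>S\<close> for the zero bracket, that is, for
  Sym.\<close>

locale sym_env = bracket_module R L + S: bracket_module R "abelianize L" for R (structure) and L (structure)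
begin

abbreviation "S \<equiv> S.U"
abbreviation "\<sigma> \<equiv> S.\<iota>"
abbreviation "sw \<equiv> S.uw"
abbreviation "SFil \<equiv> S.Fil"

lemma sgen_closed: "x \<in> carrier L \<Longrightarrow> \<sigma> x \<in> carrier S"
  using S.gen_closed by simp

lemma sgen_lin: "\<sigma> \<in> lin_hom R L S"
  using S.gen_lin by (simp add: lin_hom_def)

lemma sgen_comm: "\<lbrakk>x \<in> carrier L; y \<in> carrier L\<rbrakk> \<Longrightarrow> \<sigma> x \<otimes>\<^bsub>S\<^esub> \<sigma> y = \<sigma> y \<otimes>\<^bsub>S\<^esub> \<sigma> x"
  using S.gen_rel[of x y] S.U.minus_eq_zero_iff[of "\<sigma> x \<otimes>\<^bsub>S\<^esub> \<sigma> y" "\<sigma> y \<otimes>\<^bsub>S\<^esub> \<sigma> x"] sgen_closed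
    lin_hom_zero[OF sgen_lin module_axioms S.U.module_axioms'] by simp

sublocale filt_alg R U Fil
  by (rule filtered_algebra_filt_alg[OF filtered_algebra_U])

lemma gr_gen_lin: "(\<lambda>x. gr_class U Fil 1 (\<iota> x)) \<in> lin_hom R L Gr"
  by (intro lin_homI)
    (simp_all add: lin_homD[OF gen_lin] gr_class_closed gr_class_add gr_class_smult gen_Fil[simplified])

text \<open>Classes of degree 1 commute in \<open>Gr\<close>: their commutator is the class in
  degree 2 of the image of the bracket, and this image already lies in \<open>Fil 1\<close>. That is
  the relation which the universal property of Sym demands.\<close>

lemma canonical_ex:
  obtains h where "h \<in> alg_hom R S Gr" "\<And>x. x \<in> carrier L \<Longrightarrow> h (\<sigma> x) = gr_class U Fil 1 (\<iota> x)"
proof -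
  interpret Gr: assoc_alg R Gr by (rule assoc_alg_gr)
  let ?f = "\<lambda>x. gr_class U Fil 1 (\<iota> x)"
  have f: "?f \<in> lin_hom R (abelianize L) Gr" using gr_gen_lin by (simp add: lin_hom_def)
  have rel: "?f x \<otimes>\<^bsub>Gr\<^esub> ?f y \<ominus>\<^bsub>Gr\<^esub> ?f y \<otimes>\<^bsub>Gr\<^esub> ?f x = ?f (x \<otimes>\<^bsub>abelianize L\<^esub> y)"
    if "x \<in> carrier (abelianize L)" "y \<in> carrier (abelianize L)" for x y
  proof -
    have xy: "x \<in> carrier L" "y \<in> carrier L" using that by auto
    let ?a = "\<iota> x \<otimes>\<^bsub>U\<^esub> \<iota> y" and ?b = "\<iota> y \<otimes>\<^bsub>U\<^esub> \<iota> x"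
    have ab: "?a \<in> Fil 2" "?b \<in> Fil 2"
      using Fil_gen_mult_r[OF gen_Fil] xy by (simp_all add: numeral_2_eq_2)
    then have nb: "(\<ominus>\<^bsub>R\<^esub> \<one>\<^bsub>R\<^esub>) \<odot>\<^bsub>U\<^esub> ?b \<in> Fil 2" by (intro FilD(4)) auto
    have bc: "?b \<in> carrier U" using ab FilD(1) by blast
    have "?f x \<otimes>\<^bsub>Gr\<^esub> ?f y = gr_class U Fil 2 ?a" "?f y \<otimes>\<^bsub>Gr\<^esub> ?f x = gr_class U Fil 2 ?b"
      using gr_class_mult[OF gen_Fil gen_Fil] xy by (simp_all add: numeral_2_eq_2)
    then have "?f x \<otimes>\<^bsub>Gr\<^esub> ?f y \<ominus>\<^bsub>Gr\<^esub> ?f y \<otimes>\<^bsub>Gr\<^esub> ?f x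
      = gr_class U Fil 2 (?a \<oplus>\<^bsub>U\<^esub> (\<ominus>\<^bsub>R\<^esub> \<one>\<^bsub>R\<^esub>) \<odot>\<^bsub>U\<^esub> ?b)"
      using ab nb gr_class_closed by (simp add: a_minus_def Gr.a_inv_eq_smult gr_class_add gr_class_smult)
    also have "?a \<oplus>\<^bsub>U\<^esub> (\<ominus>\<^bsub>R\<^esub> \<one>\<^bsub>R\<^esub>) \<odot>\<^bsub>U\<^esub> ?b = \<iota> (x \<otimes>\<^bsub>L\<^esub> y)"
      unfolding gen_rel[OF xy, symmetric] U.a_inv_eq_smult[OF bc, symmetric] by (simp add: a_minus_def)
    also have "gr_class U Fil 2 (\<iota> (x \<otimes>\<^bsub>L\<^esub> y)) = \<zero>\<^bsub>Gr\<^esub>"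
      using gen_Fil[OF bracket_closed[OF xy]] by (intro gr_class_eq_zero) (simp add: numeral_2_eq_2)
    also have "\<zero>\<^bsub>Gr\<^esub> = ?f (x \<otimes>\<^bsub>abelianize L\<^esub> y)"
      using lin_hom_zero[OF gr_gen_lin module_axioms Gr.module_axioms'] by simp
    finally show ?thesis .
  qed
  obtain h where "h \<in> alg_hom R S Gr" "\<And>x. x \<in> carrier (abelianize L) \<Longrightarrow> h (\<sigma> x) = ?f x"
    using S.env_lift[OF assoc_alg_gr f rel] by metis
  then show thesis using that by simp
qed

lemma canonical_ex1:
  "\<exists>!h. h \<in> alg_hom R S Gr \<inter> extensional (carrier S) \<and>
     (\<forall>x\<in>carrier L. h (\<sigma> x) = gr_class U Fil 1 (\<iota> x))"
proof -
  interpret Gr: assoc_alg R Gr by (rule assoc_alg_gr)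
  obtain h where h: "h \<in> alg_hom R S Gr" "\<And>x. x \<in> carrier L \<Longrightarrow> h (\<sigma> x) = gr_class U Fil 1 (\<iota> x)"
    using canonical_ex by metis
  show ?thesis
  proof (rule ex1I)
    show "restrict h (carrier S) \<in> alg_hom R S Gr \<inter> extensional (carrier S) \<and>
      (\<forall>x\<in>carrier L. restrict h (carrier S) (\<sigma> x) = gr_class U Fil 1 (\<iota> x))"
      using alg_hom_restrict[OF h(1) S.assoc_alg_U] h(2) sgen_closed by simp
    fix D assume D: "D \<in> alg_hom R S Gr \<inter> extensional (carrier S) \<and>
      (\<forall>x\<in>carrier L. D (\<sigma> x) = gr_class U Fil 1 (\<iota> x))"
    show "D = restrict h (carrier S)"
    proof (rule extensionalityI)
      show "D x = restrict h (carrier S) x" if "x \<in> carrier S" for x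
        using S.alg_hom_U_eq[OF _ h(1) Gr.module_axioms' _ that] D h(2) that by simp
    qed (use D in auto)
  qed
qed

abbreviation "can \<equiv> canonical_map R L"

lemma canonical_eq: "can = (THE h. h \<in> alg_hom R S Gr \<inter> extensional (carrier S) \<and>
    (\<forall>x\<in>carrier L. h (\<sigma> x) = gr_class U Fil 1 (\<iota> x)))"
  unfolding canonical_map_def gr_env_def sym_abelianize ..

lemma can_alg_hom: "can \<in> alg_hom R S Gr"
  and can_gen: "x \<in> carrier L \<Longrightarrow> can (\<sigma> x) = gr_class U Fil 1 (\<iota> x)"
  using theI'[OF canonical_ex1] unfolding canonical_eq by blast+

lemma sw_closed: "w \<in> words \<Longrightarrow> sw w \<in> carrier S"
  using S.uw_closed by simp

text \<open>The class is taken in degree \<open>length w\<close>, even if \<open>uw w\<close>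
  happens to lie in a smaller piece and the class is zero.\<close>

lemma can_word: "w \<in> words \<Longrightarrow> can (sw w) = gr_class U Fil (length w) (uw w)"
proof (induct w)
  case Nil
  show ?case by (simp add: alg_homD(2)[OF can_alg_hom] gr_one)
next
  case (Cons x w)
  then show ?case
    using gr_class_mult[OF gen_Fil uw_Fil[of w "length w"], of x]
    by (simp add: alg_homD(3)[OF can_alg_hom] can_gen sgen_closed sw_closed)
qed

end

section \<open>Derivations of the symmetric algebra\<close>

text \<open>A derivation is the second component of an algebra map into the dual numbers.\<close>

definition dual_alg :: "('k, 'a, 'm) module_scheme \<Rightarrow> ('k, 'a \<times> 'a) module" where
  "dual_alg A = \<lparr>carrier = carrier A \<times> carrier A,
     mult = (\<lambda>(a, b) (c, d). (a \<otimes>\<^bsub>A\<^esub> c, a \<otimes>\<^bsub>A\<^esub> d \<oplus>\<^bsub>A\<^esub> b \<otimes>\<^bsub>A\<^esub> c)), one = (\<one>\<^bsub>A\<^esub>, \<zero>\<^bsub>A\<^esub>),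
     zero = (\<zero>\<^bsub>A\<^esub>, \<zero>\<^bsub>A\<^esub>), add = (\<lambda>(a, b) (c, d). (a \<oplus>\<^bsub>A\<^esub> c, b \<oplus>\<^bsub>A\<^esub> d)),
     smult = (\<lambda>k (a, b). (k \<odot>\<^bsub>A\<^esub> a, k \<odot>\<^bsub>A\<^esub> b))\<rparr>"

lemma dual_alg_simps [simp]:
  "carrier (dual_alg A) = carrier A \<times> carrier A"
  "(a, b) \<otimes>\<^bsub>dual_alg A\<^esub> (c, d) = (a \<otimes>\<^bsub>A\<^esub> c, a \<otimes>\<^bsub>A\<^esub> d \<oplus>\<^bsub>A\<^esub> b \<otimes>\<^bsub>A\<^esub> c)"
  "\<one>\<^bsub>dual_alg A\<^esub> = (\<one>\<^bsub>A\<^esub>, \<zero>\<^bsub>A\<^esub>)" "\<zero>\<^bsub>dual_alg A\<^esub> = (\<zero>\<^bsub>A\<^esub>, \<zero>\<^bsub>A\<^esub>)"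
  "(a, b) \<oplus>\<^bsub>dual_alg A\<^esub> (c, d) = (a \<oplus>\<^bsub>A\<^esub> c, b \<oplus>\<^bsub>A\<^esub> d)"
  "k \<odot>\<^bsub>dual_alg A\<^esub> (a, b) = (k \<odot>\<^bsub>A\<^esub> a, k \<odot>\<^bsub>A\<^esub> b)"
  by (simp_all add: dual_alg_def)

lemma assoc_alg_dual:
  assumes "assoc_alg R A"
  shows "assoc_alg R (dual_alg A)"
proof -
  interpret A: assoc_alg R A by fact
  have g: "abelian_group (dual_alg A)"
  proof (rule abelian_groupI)
    fix x assume "x \<in> carrier (dual_alg A)"
    then show "\<exists>y\<in>carrier (dual_alg A). y \<oplus>\<^bsub>dual_alg A\<^esub> x = \<zero>\<^bsub>dual_alg A\<^esub>"
      by (intro bexI[of _ "(\<ominus>\<^bsub>A\<^esub> fst x, \<ominus>\<^bsub>A\<^esub> snd x)"]) (auto simp: A.M.l_neg)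
  qed (auto simp: A.M.a_ac)
  have m: "module R (dual_alg A)"
    by (rule moduleI[OF A.R.is_cring g])
      (auto simp: A.smult_l_distr A.smult_r_distr A.smult_assoc1)
  have r: "ring (dual_alg A)"
    by (rule ringI[OF g]; (rule monoidI)?)
      (auto simp: A.A.m_assoc[symmetric] A.A.l_distr A.A.r_distr A.M.a_ac)
  show ?thesis
    unfolding assoc_alg_def assoc_alg_axioms_def
    using m r by (auto simp: A.smult_mult_l A.smult_mult_r A.smult_r_distr)
qed

text \<open>The product is composition in the opposite order, so that algebra maps into it are right actions.\<close>

definition end_alg :: "('k, 'r) ring_scheme \<Rightarrow> ('k, 'a, 'm) module_scheme \<Rightarrow> ('k, 'a \<Rightarrow> 'a) module" where
  "end_alg R M = \<lparr>carrier = lin_hom R M M \<inter> extensional (carrier M),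
     mult = (\<lambda>f g. \<lambda>x\<in>carrier M. g (f x)), one = (\<lambda>x\<in>carrier M. x),
     zero = (\<lambda>x\<in>carrier M. \<zero>\<^bsub>M\<^esub>), add = (\<lambda>f g. \<lambda>x\<in>carrier M. f x \<oplus>\<^bsub>M\<^esub> g x),
     smult = (\<lambda>c f. \<lambda>x\<in>carrier M. c \<odot>\<^bsub>M\<^esub> f x)\<rparr>"

lemma end_alg_simps [simp]:
  "carrier (end_alg R M) = lin_hom R M M \<inter> extensional (carrier M)"
  "mult (end_alg R M) = (\<lambda>f g. \<lambda>x\<in>carrier M. g (f x))" "one (end_alg R M) = (\<lambda>x\<in>carrier M. x)"
  "zero (end_alg R M) = (\<lambda>x\<in>carrier M. \<zero>\<^bsub>M\<^esub>)"
  "add (end_alg R M) = (\<lambda>f g. \<lambda>x\<in>carrier M. f x \<oplus>\<^bsub>M\<^esub> g x)"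
  "smult (end_alg R M) = (\<lambda>c f. \<lambda>x\<in>carrier M. c \<odot>\<^bsub>M\<^esub> f x)"
  by (simp_all add: end_alg_def)

lemma restrict_end_alg:
  assumes "module R M" "f \<in> lin_hom R M M"
  shows "(\<lambda>x\<in>carrier M. f x) \<in> carrier (end_alg R M)"
  using lin_hom_cong[OF assms(2,1), of "restrict f (carrier M)"] by simp

lemma end_alg_eqI:
  assumes "f \<in> carrier (end_alg R M)" "g \<in> carrier (end_alg R M)" "\<And>x. x \<in> carrier M \<Longrightarrow> f x = g x"
  shows "f = g"
  using assms by (intro extensionalityI[of f "carrier M" g]) auto

lemma assoc_alg_end:
  assumes M: "module R M"
  shows "assoc_alg R (end_alg R M)"
proof -
  interpret M: module R M by fact
  let ?E = "end_alg R M"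
  have L: "f \<in> lin_hom R M M" if "f \<in> carrier ?E" for f using that by simp
  have add: "f \<oplus>\<^bsub>?E\<^esub> g \<in> carrier ?E" if "f \<in> carrier ?E" "g \<in> carrier ?E" for f g
    using restrict_end_alg[OF M lin_hom_addI[OF L[OF that(1)] L[OF that(2)] M]] by simp
  have smult: "c \<odot>\<^bsub>?E\<^esub> f \<in> carrier ?E" if "c \<in> carrier R" "f \<in> carrier ?E" for c f
    using restrict_end_alg[OF M lin_hom_smultI[OF L[OF that(2)] M that(1)]] by simp
  have mult: "f \<otimes>\<^bsub>?E\<^esub> g \<in> carrier ?E" if "f \<in> carrier ?E" "g \<in> carrier ?E" for f g
    using restrict_end_alg[OF M lin_hom_comp[OF L[OF that(1)] L[OF that(2)]]] by simp
  have one: "\<one>\<^bsub>?E\<^esub> \<in> carrier ?E"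
    using restrict_end_alg[OF M alg_homD(1)[OF alg_hom_id]] by (simp add: id_def)
  have "(\<lambda>x. \<zero>\<^bsub>M\<^esub>) \<in> lin_hom R M M" by (intro lin_homI) auto
  then have zero: "\<zero>\<^bsub>?E\<^esub> \<in> carrier ?E" using restrict_end_alg[OF M] by simp
  have cl: "f x \<in> carrier M" if "f \<in> carrier ?E" "x \<in> carrier M" for f x
    using lin_homD(1)[OF L[OF that(1)] that(2)] .
  have ext: "f x = undefined" if "f \<in> carrier ?E" "x \<notin> carrier M" for f x
    using that by (auto simp: extensional_def)
  have g: "abelian_group ?E"
  proof (rule abelian_groupI)
    fix f assume f: "f \<in> carrier ?E"
    show "\<zero>\<^bsub>?E\<^esub> \<oplus>\<^bsub>?E\<^esub> f = f"
      by (rule end_alg_eqI[OF add[OF zero f] f]) (simp add: cl[OF f])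
    show "\<exists>g\<in>carrier ?E. g \<oplus>\<^bsub>?E\<^esub> f = \<zero>\<^bsub>?E\<^esub>"
    proof (rule bexI)
      show c: "(\<ominus>\<^bsub>R\<^esub> \<one>\<^bsub>R\<^esub>) \<odot>\<^bsub>?E\<^esub> f \<in> carrier ?E" by (rule smult[OF _ f]) simp
      show "((\<ominus>\<^bsub>R\<^esub> \<one>\<^bsub>R\<^esub>) \<odot>\<^bsub>?E\<^esub> f) \<oplus>\<^bsub>?E\<^esub> f = \<zero>\<^bsub>?E\<^esub>"
        by (rule end_alg_eqI[OF add[OF c f] zero])
          (simp add: M.a_inv_eq_smult[symmetric] cl[OF f] M.M.l_neg)
    qed
    fix h assume h: "h \<in> carrier ?E"
    show "f \<oplus>\<^bsub>?E\<^esub> h \<in> carrier ?E" by (rule add[OF f h])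
    show "f \<oplus>\<^bsub>?E\<^esub> h = h \<oplus>\<^bsub>?E\<^esub> f"
      by (rule end_alg_eqI[OF add[OF f h] add[OF h f]]) (simp add: cl[OF f] cl[OF h] M.M.a_comm)
    fix k assume k: "k \<in> carrier ?E"
    show "(f \<oplus>\<^bsub>?E\<^esub> h) \<oplus>\<^bsub>?E\<^esub> k = f \<oplus>\<^bsub>?E\<^esub> (h \<oplus>\<^bsub>?E\<^esub> k)"
      by (rule end_alg_eqI[OF add[OF add[OF f h] k] add[OF f add[OF h k]]])
        (simp add: cl[OF f] cl[OF h] cl[OF k] M.M.a_assoc)
  qed (rule zero)
  have m: "module R ?E"
  proof (rule moduleI[OF M.R.is_cring g smult])
    fix f assume f: "f \<in> carrier ?E"
    note fc = cl[OF f]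
    show "\<one>\<^bsub>R\<^esub> \<odot>\<^bsub>?E\<^esub> f = f"
      by (rule end_alg_eqI[OF smult[OF _ f] f]) (simp_all add: fc)
    fix c assume c: "c \<in> carrier R"
    show "c \<odot>\<^bsub>?E\<^esub> (f \<oplus>\<^bsub>?E\<^esub> h) = c \<odot>\<^bsub>?E\<^esub> f \<oplus>\<^bsub>?E\<^esub> c \<odot>\<^bsub>?E\<^esub> h" if h: "h \<in> carrier ?E" for h
      by (rule end_alg_eqI[OF smult[OF c add[OF f h]] add[OF smult[OF c f] smult[OF c h]]])
        (simp add: fc cl[OF h] c M.smult_r_distr)
    fix d assume d: "d \<in> carrier R"
    have cd: "c \<oplus>\<^bsub>R\<^esub> d \<in> carrier R" "c \<otimes>\<^bsub>R\<^esub> d \<in> carrier R" using c d by auto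
    show "(c \<oplus>\<^bsub>R\<^esub> d) \<odot>\<^bsub>?E\<^esub> f = c \<odot>\<^bsub>?E\<^esub> f \<oplus>\<^bsub>?E\<^esub> d \<odot>\<^bsub>?E\<^esub> f"
      by (rule end_alg_eqI[OF smult[OF cd(1) f] add[OF smult[OF c f] smult[OF d f]]])
        (simp add: fc c d M.smult_l_distr)
    show "(c \<otimes>\<^bsub>R\<^esub> d) \<odot>\<^bsub>?E\<^esub> f = c \<odot>\<^bsub>?E\<^esub> (d \<odot>\<^bsub>?E\<^esub> f)"
      by (rule end_alg_eqI[OF smult[OF cd(2) f] smult[OF c smult[OF d f]]])
        (simp add: fc c d M.smult_assoc1)
  qed
  have r: "ring ?E"
  proof (rule ringI[OF g])
    show "monoid ?E"
    proof (rule monoidI)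
      fix f assume f: "f \<in> carrier ?E"
      note fc = cl[OF f]
      show "\<one>\<^bsub>?E\<^esub> \<otimes>\<^bsub>?E\<^esub> f = f"
        by (rule end_alg_eqI[OF mult[OF one f] f]) simp
      show "f \<otimes>\<^bsub>?E\<^esub> \<one>\<^bsub>?E\<^esub> = f"
        by (rule end_alg_eqI[OF mult[OF f one] f]) (simp add: fc)
      fix h assume h: "h \<in> carrier ?E"
      show "f \<otimes>\<^bsub>?E\<^esub> h \<in> carrier ?E" by (rule mult[OF f h])
      fix k assume k: "k \<in> carrier ?E"
      show "(f \<otimes>\<^bsub>?E\<^esub> h) \<otimes>\<^bsub>?E\<^esub> k = f \<otimes>\<^bsub>?E\<^esub> (h \<otimes>\<^bsub>?E\<^esub> k)"
        by (rule end_alg_eqI[OF mult[OF mult[OF f h] k] mult[OF f mult[OF h k]]]) (simp add: fc)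
    qed (rule one)
  next
    fix f h k assume f: "f \<in> carrier ?E" and h: "h \<in> carrier ?E" and k: "k \<in> carrier ?E"
    note c = cl[OF f] cl[OF h] cl[OF k]
    show "(f \<oplus>\<^bsub>?E\<^esub> h) \<otimes>\<^bsub>?E\<^esub> k = f \<otimes>\<^bsub>?E\<^esub> k \<oplus>\<^bsub>?E\<^esub> h \<otimes>\<^bsub>?E\<^esub> k"
      by (rule end_alg_eqI[OF mult[OF add[OF f h] k] add[OF mult[OF f k] mult[OF h k]]])
        (simp add: c lin_homD[OF L[OF k]])
    show "k \<otimes>\<^bsub>?E\<^esub> (f \<oplus>\<^bsub>?E\<^esub> h) = k \<otimes>\<^bsub>?E\<^esub> f \<oplus>\<^bsub>?E\<^esub> k \<otimes>\<^bsub>?E\<^esub> h"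
      by (rule end_alg_eqI[OF mult[OF k add[OF f h]] add[OF mult[OF k f] mult[OF k h]]])
        (simp add: c)
  qed
  show ?thesis
    unfolding assoc_alg_def assoc_alg_axioms_def
  proof (intro conjI m r allI impI)
    fix c f h assume c: "c \<in> carrier R" and f: "f \<in> carrier ?E" and h: "h \<in> carrier ?E"
    show "(c \<odot>\<^bsub>?E\<^esub> f) \<otimes>\<^bsub>?E\<^esub> h = c \<odot>\<^bsub>?E\<^esub> (f \<otimes>\<^bsub>?E\<^esub> h)"
      by (rule end_alg_eqI[OF mult[OF smult[OF c f] h] smult[OF c mult[OF f h]]])
        (simp add: cl[OF f] c lin_homD[OF L[OF h]])
    show "f \<otimes>\<^bsub>?E\<^esub> (c \<odot>\<^bsub>?E\<^esub> h) = c \<odot>\<^bsub>?E\<^esub> (f \<otimes>\<^bsub>?E\<^esub> h)"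
      by (rule end_alg_eqI[OF mult[OF f smult[OF c h]] smult[OF c mult[OF f h]]])
        (simp add: cl[OF f] c)
  qed
qed

section \<open>Commutativity and derivations of Sym\<close>

context sym_env
begin

lemma sw_snoc: "w \<in> words \<Longrightarrow> x \<in> carrier L \<Longrightarrow> sw (w @ [x]) = sw w \<otimes>\<^bsub>S\<^esub> \<sigma> x"
  using S.uw_snoc by simp

lemma sgen_word_comm: "\<lbrakk>x \<in> carrier L; w \<in> words\<rbrakk> \<Longrightarrow> \<sigma> x \<otimes>\<^bsub>S\<^esub> sw w = sw w \<otimes>\<^bsub>S\<^esub> \<sigma> x"
proof (induct w)
  case Nil then show ?case by (simp add: sgen_closed)
next
  case (Cons y w)
  then have c: "\<sigma> x \<in> carrier S" "\<sigma> y \<in> carrier S" "sw w \<in> carrier S" by (auto simp: sgen_closed sw_closed)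
  have "\<sigma> x \<otimes>\<^bsub>S\<^esub> sw (y # w) = \<sigma> y \<otimes>\<^bsub>S\<^esub> \<sigma> x \<otimes>\<^bsub>S\<^esub> sw w"
    using Cons(2,3) c sgen_comm[of x y] by (simp add: S.U.A.m_assoc[symmetric])
  also have "\<dots> = \<sigma> y \<otimes>\<^bsub>S\<^esub> (sw w \<otimes>\<^bsub>S\<^esub> \<sigma> x)"
    using Cons c by (simp add: S.U.A.m_assoc)
  finally show ?case using c by (simp add: S.U.A.m_assoc)
qed

lemma word_comm: "\<lbrakk>v \<in> words; w \<in> words\<rbrakk> \<Longrightarrow> sw v \<otimes>\<^bsub>S\<^esub> sw w = sw w \<otimes>\<^bsub>S\<^esub> sw v"
proof (induct v)
  case Nil then show ?case by (simp add: sw_closed)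
next
  case (Cons y v)
  then have c: "sw v \<in> carrier S" "\<sigma> y \<in> carrier S" "sw w \<in> carrier S" by (auto simp: sgen_closed sw_closed)
  have "sw (y # v) \<otimes>\<^bsub>S\<^esub> sw w = \<sigma> y \<otimes>\<^bsub>S\<^esub> sw w \<otimes>\<^bsub>S\<^esub> sw v"
    using Cons c by (simp add: S.U.A.m_assoc)
  also have "\<dots> = sw w \<otimes>\<^bsub>S\<^esub> \<sigma> y \<otimes>\<^bsub>S\<^esub> sw v" using Cons sgen_word_comm[of y w] by simp
  finally show ?case using c by (simp add: S.U.A.m_assoc)
qed

text \<open>Letters commute because the bracket is zero; this spreads to words by induction and to
  all elements by bilinearity.\<close>

lemma S_comm:
  assumes "s \<in> carrier S" "t \<in> carrier S"
  shows "s \<otimes>\<^bsub>S\<^esub> t = t \<otimes>\<^bsub>S\<^esub> s"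
proof (rule bilin_map_eq_on_span[OF S.U.mult_bilin _ S.U.module_axioms' S.U.module_axioms' S.U.module_axioms'
      S.uw_subset' S.uw_subset' _ assms[folded S.uw_span]])
  show "bilin_map R S S S (\<lambda>a b. b \<otimes>\<^bsub>S\<^esub> a)"
    using S.U.mult_bilin by (auto simp: bilin_map_def)
  show "x \<otimes>\<^bsub>S\<^esub> y = y \<otimes>\<^bsub>S\<^esub> x" if "x \<in> sw ` S.words" "y \<in> sw ` S.words" for x y
    using that word_comm by auto
qed

lemma cring_S: "cring S"
  by (intro cring.intro S.U.ring_axioms' comm_monoid.intro comm_monoid_axioms.intro S_comm)
    (rule S.U.A.monoid_axioms)

sublocale SC: cring S
  by (rule cring_S)

definition derivs where
  "derivs = {d \<in> lin_hom R S S. \<forall>s\<in>carrier S. \<forall>t\<in>carrier S. d (s \<otimes>\<^bsub>S\<^esub> t) = s \<otimes>\<^bsub>S\<^esub> d t \<oplus>\<^bsub>S\<^esub> d s \<otimes>\<^bsub>S\<^esub> t}"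

lemma derivsD:
  assumes "d \<in> derivs"
  shows "d \<in> lin_hom R S S" "\<lbrakk>s \<in> carrier S; t \<in> carrier S\<rbrakk> \<Longrightarrow> d (s \<otimes>\<^bsub>S\<^esub> t) = s \<otimes>\<^bsub>S\<^esub> d t \<oplus>\<^bsub>S\<^esub> d s \<otimes>\<^bsub>S\<^esub> t"
    "s \<in> carrier S \<Longrightarrow> d s \<in> carrier S"
  using assms lin_homD(1) by (auto simp: derivs_def)

text \<open>Applied to 1 = 1 1, the Leibniz rule gives d(1) = d(1) + d(1).\<close>

lemma derivs_one:
  assumes d: "d \<in> derivs"
  shows "d \<one>\<^bsub>S\<^esub> = \<zero>\<^bsub>S\<^esub>"
proof -
  have c: "d \<one>\<^bsub>S\<^esub> \<in> carrier S" by (intro derivsD(3)[OF d] S.U.A.one_closed)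
  then have "d \<one>\<^bsub>S\<^esub> = d \<one>\<^bsub>S\<^esub> \<oplus>\<^bsub>S\<^esub> d \<one>\<^bsub>S\<^esub>"
    using derivsD(2)[OF d S.U.A.one_closed S.U.A.one_closed] by simp
  then show ?thesis using c by (metis S.U.M.add.r_cancel_one)
qed

text \<open>The Leibniz rule determines a derivation on words by its values on letters. Identities
  such as the additivity of \<open>D\<close> in its index thus become identities in
  \<open>L\<close>.\<close>

lemma derivs_eq:
  assumes d: "d \<in> derivs" and e: "e \<in> derivs" and eq: "\<And>x. x \<in> carrier L \<Longrightarrow> d (\<sigma> x) = e (\<sigma> x)"
    and s: "s \<in> carrier S"
  shows "d s = e s"
proof (rule S.lin_hom_U_eq[OF derivsD(1)[OF d] derivsD(1)[OF e] S.U.module_axioms' _ s])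
  fix w assume "w \<in> S.words"
  then show "d (sw w) = e (sw w)"
  proof (induct w)
    case Nil then show ?case by (simp add: derivs_one d e)
  next
    case (Cons x w)
    then have "\<sigma> x \<in> carrier S" "sw w \<in> carrier S" by (auto simp: sgen_closed sw_closed)
    then show ?case using Cons eq[of x] by (simp add: derivsD(2)[OF d] derivsD(2)[OF e])
  qed
qed

lemma derivs_exist:
  assumes f: "f \<in> lin_hom R L S"
  obtains d where "d \<in> derivs" "\<And>x. x \<in> carrier L \<Longrightarrow> d (\<sigma> x) = f x"
proof -
  note fD = lin_homD[OF f]
  note dual = assoc_alg_dual[OF S.assoc_alg_U]
  interpret D: assoc_alg R "dual_alg S" by (rule dual)
  let ?g = "\<lambda>x. (\<sigma> x, f x)"
  have g: "?g \<in> lin_hom R (abelianize L) (dual_alg S)"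
    by (intro lin_homI) (simp_all add: fD lin_homD[OF sgen_lin])
  have "\<exists>h. h \<in> alg_hom R S (dual_alg S) \<and> (\<forall>x\<in>carrier (abelianize L). h (\<sigma> x) = ?g x)"
  proof (rule S.env_lift[OF dual g])
    fix x y assume "x \<in> carrier (abelianize L)" "y \<in> carrier (abelianize L)"
    then have xy: "x \<in> carrier L" "y \<in> carrier L" by auto
    note c = xy[THEN sgen_closed] xy[THEN fD(1)]
    \<comment> \<open>The images of generators commute since Sym is commutative; this is the
      relation for the zero bracket.\<close>
    have "?g x \<otimes>\<^bsub>dual_alg S\<^esub> ?g y = ?g y \<otimes>\<^bsub>dual_alg S\<^esub> ?g x"
      using c by (simp add: S_comm[of "\<sigma> x"] S_comm[of "f x"] S.U.M.a_comm)
    moreover have "?g x \<otimes>\<^bsub>dual_alg S\<^esub> ?g y \<in> carrier (dual_alg S)" using c by simp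
    moreover have "?g (x \<otimes>\<^bsub>abelianize L\<^esub> y) = \<zero>\<^bsub>dual_alg S\<^esub>"
      using lin_hom_zero[OF sgen_lin module_axioms S.U.module_axioms']
        lin_hom_zero[OF f module_axioms S.U.module_axioms'] by simp
    ultimately show "?g x \<otimes>\<^bsub>dual_alg S\<^esub> ?g y \<ominus>\<^bsub>dual_alg S\<^esub> ?g y \<otimes>\<^bsub>dual_alg S\<^esub> ?g x = ?g (x \<otimes>\<^bsub>abelianize L\<^esub> y)"
      by (metis D.minus_self)
  qed blast
  then obtain h where h: "h \<in> alg_hom R S (dual_alg S)" "\<And>x. x \<in> carrier L \<Longrightarrow> h (\<sigma> x) = ?g x" by auto
  have hc: "fst (h s) \<in> carrier S" "snd (h s) \<in> carrier S" if "s \<in> carrier S" for s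
    using alg_homD(4)[OF h(1) that] by auto
  have p: "fst (a \<otimes>\<^bsub>dual_alg S\<^esub> b) = fst a \<otimes>\<^bsub>S\<^esub> fst b"
    "snd (a \<otimes>\<^bsub>dual_alg S\<^esub> b) = fst a \<otimes>\<^bsub>S\<^esub> snd b \<oplus>\<^bsub>S\<^esub> snd a \<otimes>\<^bsub>S\<^esub> fst b"
    "fst (a \<oplus>\<^bsub>dual_alg S\<^esub> b) = fst a \<oplus>\<^bsub>S\<^esub> fst b" "snd (a \<oplus>\<^bsub>dual_alg S\<^esub> b) = snd a \<oplus>\<^bsub>S\<^esub> snd b"
    "fst (c \<odot>\<^bsub>dual_alg S\<^esub> a) = c \<odot>\<^bsub>S\<^esub> fst a" "snd (c \<odot>\<^bsub>dual_alg S\<^esub> a) = c \<odot>\<^bsub>S\<^esub> snd a" for a b c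
    by (cases a; cases b; simp)+
  note hD = alg_homD(2,3)[OF h(1)] lin_homD(2,3)[OF alg_homD(1)[OF h(1)]]
  have "(\<lambda>s. fst (h s)) \<in> alg_hom R S S"
    by (intro alg_homI lin_homI) (simp_all add: hc hD p)
  \<comment> \<open>The first component is an algebra endomorphism fixing the generators, hence the
    identity. Multiplicativity in the second component then reads as the Leibniz rule.\<close>
  then have fst: "fst (h s) = id s" if "s \<in> carrier S" for s
    using S.alg_hom_U_eq[OF _ alg_hom_id S.U.module_axioms' _ that, of "\<lambda>s. fst (h s)"] h(2) by simp
  have "(\<lambda>s. snd (h s)) \<in> derivs"
    unfolding derivs_def
    by (rule CollectI, rule conjI, rule lin_homI) (simp_all add: hc hD p fst)
  then show thesis using that[of "\<lambda>s. snd (h s)"] h(2) by simp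
qed

end

section \<open>The pre-Lie action on the symmetric algebra\<close>

text \<open>The product slot of \<open>L\<close> holds the Lie bracket, so the pre-Lie product
  enters as a separate operation on the same module.\<close>

locale prelie_env = sym_env R L for R (structure) and L (structure) +
  fixes circ :: "'c \<Rightarrow> 'c \<Rightarrow> 'c" (infixl \<open>\<bullet>\<close> 70)
  assumes circ_bilin: "bilin_map R L L L (\<bullet>)"
    and bracket_eq: "\<lbrakk>x \<in> carrier L; y \<in> carrier L\<rbrakk> \<Longrightarrow> x \<otimes>\<^bsub>L\<^esub> y = x \<bullet> y \<ominus>\<^bsub>L\<^esub> y \<bullet> x"
    and prelie: "\<lbrakk>x \<in> carrier L; y \<in> carrier L; z \<in> carrier L\<rbrakk> \<Longrightarrow>
      x \<bullet> (y \<bullet> z) \<ominus>\<^bsub>L\<^esub> x \<bullet> y \<bullet> z = x \<bullet> (z \<bullet> y) \<ominus>\<^bsub>L\<^esub> x \<bullet> z \<bullet> y"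
begin

lemma circ_closed: "\<lbrakk>x \<in> carrier L; y \<in> carrier L\<rbrakk> \<Longrightarrow> x \<bullet> y \<in> carrier L"
  by (rule bilin_map_closed[OF circ_bilin])

lemmas circ_r = lin_homD[OF bilin_mapD(3)[OF circ_bilin]]
lemmas sgen_D = lin_homD[OF sgen_lin]

definition D where
  "D x = (SOME d. d \<in> derivs \<and> (\<forall>y\<in>carrier L. d (\<sigma> y) = \<sigma> (y \<bullet> x)))"

lemma D:
  assumes x: "x \<in> carrier L"
  shows D_derivs: "D x \<in> derivs" and D_gen: "y \<in> carrier L \<Longrightarrow> D x (\<sigma> y) = \<sigma> (y \<bullet> x)"
proof -
  have "(\<lambda>y. \<sigma> (y \<bullet> x)) \<in> lin_hom R L S"
    by (rule lin_hom_comp[OF bilin_mapD(1)[OF circ_bilin x] sgen_lin])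
  then obtain d where "d \<in> derivs" "\<And>y. y \<in> carrier L \<Longrightarrow> d (\<sigma> y) = \<sigma> (y \<bullet> x)"
    using derivs_exist by metis
  then have "\<exists>d. d \<in> derivs \<and> (\<forall>y\<in>carrier L. d (\<sigma> y) = \<sigma> (y \<bullet> x))" by blast
  from someI_ex[OF this] show "D x \<in> derivs" "y \<in> carrier L \<Longrightarrow> D x (\<sigma> y) = \<sigma> (y \<bullet> x)"
    unfolding D_def by blast+
qed

lemmas D_lin = derivsD(1)[OF D_derivs]
lemmas D_mult = derivsD(2)[OF D_derivs]
lemmas D_closed = derivsD(3)[OF D_derivs]
lemmas D_one = derivs_one[OF D_derivs]

text \<open>Both sides are derivations in \<open>s\<close>. On letters the claim is additivity of
  \<open>\<bullet>\<close> in its right argument.\<close>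

lemma D_add:
  assumes x: "x \<in> carrier L" and y: "y \<in> carrier L" and s: "s \<in> carrier S"
  shows "D (x \<oplus>\<^bsub>L\<^esub> y) s = D x s \<oplus>\<^bsub>S\<^esub> D y s"
proof -
  have xy: "x \<oplus>\<^bsub>L\<^esub> y \<in> carrier L" using x y by simp
  have "(\<lambda>s. D x s \<oplus>\<^bsub>S\<^esub> D y s) \<in> derivs"
    unfolding derivs_def
  proof (intro CollectI conjI ballI)
    show "(\<lambda>s. D x s \<oplus>\<^bsub>S\<^esub> D y s) \<in> lin_hom R S S"
      by (rule lin_hom_addI[OF D_lin[OF x] D_lin[OF y] S.U.module_axioms'])
    fix s t assume s: "s \<in> carrier S" and t: "t \<in> carrier S"
    show "D x (s \<otimes>\<^bsub>S\<^esub> t) \<oplus>\<^bsub>S\<^esub> D y (s \<otimes>\<^bsub>S\<^esub> t) = s \<otimes>\<^bsub>S\<^esub> (D x t \<oplus>\<^bsub>S\<^esub> D y t) \<oplus>\<^bsub>S\<^esub> (D x s \<oplus>\<^bsub>S\<^esub> D y s) \<otimes>\<^bsub>S\<^esub> t"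
      unfolding D_mult[OF x s t] D_mult[OF y s t]
      using s t D_closed[OF x s] D_closed[OF x t] D_closed[OF y s] D_closed[OF y t] by algebra
  qed
  from derivs_eq[OF D_derivs[OF xy] this _ s] show ?thesis
    using x y by (simp add: D_gen xy circ_r sgen_D circ_closed)
qed

lemma D_smult:
  assumes c: "c \<in> carrier R" and x: "x \<in> carrier L" and s: "s \<in> carrier S"
  shows "D (c \<odot>\<^bsub>L\<^esub> x) s = c \<odot>\<^bsub>S\<^esub> D x s"
proof -
  have cx: "c \<odot>\<^bsub>L\<^esub> x \<in> carrier L" using c x by simp
  have "(\<lambda>s. c \<odot>\<^bsub>S\<^esub> D x s) \<in> derivs"
    unfolding derivs_def
  proof (intro CollectI conjI ballI)
    show "(\<lambda>s. c \<odot>\<^bsub>S\<^esub> D x s) \<in> lin_hom R S S"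
      by (rule lin_hom_smultI[OF D_lin[OF x] S.U.module_axioms' c])
    fix s t assume s: "s \<in> carrier S" and t: "t \<in> carrier S"
    show "c \<odot>\<^bsub>S\<^esub> D x (s \<otimes>\<^bsub>S\<^esub> t) = s \<otimes>\<^bsub>S\<^esub> (c \<odot>\<^bsub>S\<^esub> D x t) \<oplus>\<^bsub>S\<^esub> (c \<odot>\<^bsub>S\<^esub> D x s) \<otimes>\<^bsub>S\<^esub> t"
      unfolding D_mult[OF x s t]
      using s t c D_closed[OF x s] D_closed[OF x t]
      by (simp add: S.U.smult_r_distr S.U.smult_mult_l S.U.smult_mult_r)
  qed
  from derivs_eq[OF D_derivs[OF cx] this _ s] show ?thesis
    using x c by (simp add: D_gen cx circ_r sgen_D circ_closed)
qed

lemma sgen_minus: "\<lbrakk>x \<in> carrier L; y \<in> carrier L\<rbrakk> \<Longrightarrow> \<sigma> (x \<ominus>\<^bsub>L\<^esub> y) = \<sigma> x \<ominus>\<^bsub>S\<^esub> \<sigma> y"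
  by (rule lin_hom_minus[OF sgen_lin module_axioms S.U.module_axioms'])

text \<open>The pre-Lie identity says exactly that \<open>D\<close> is an action of the Lie algebra on generators.\<close>

lemma D_bracket:
  assumes x: "x \<in> carrier L" and y: "y \<in> carrier L" and s: "s \<in> carrier S"
  shows "D y (D x s) \<ominus>\<^bsub>S\<^esub> D x (D y s) = D (x \<otimes>\<^bsub>L\<^esub> y) s"
proof -
  have xy: "x \<otimes>\<^bsub>L\<^esub> y \<in> carrier L" by (rule bracket_closed[OF x y])
  have "(\<lambda>s. D y (D x s) \<ominus>\<^bsub>S\<^esub> D x (D y s)) \<in> derivs"
    unfolding derivs_def
  proof (intro CollectI conjI ballI)
    show "(\<lambda>s. D y (D x s) \<ominus>\<^bsub>S\<^esub> D x (D y s)) \<in> lin_hom R S S"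
      by (rule lin_hom_minusI[OF lin_hom_comp[OF D_lin[OF x] D_lin[OF y]] lin_hom_comp[OF D_lin[OF y] D_lin[OF x]]
            S.U.module_axioms'])
    fix s t assume s: "s \<in> carrier S" and t: "t \<in> carrier S"
    note cs = D_closed[OF x s] D_closed[OF x t] D_closed[OF y s] D_closed[OF y t]
    note cc = cs(1,2)[THEN D_closed[OF y]] cs(3,4)[THEN D_closed[OF x]]
    note ad = lin_homD(2)[OF D_lin]
    \<comment> \<open>The cross terms are the same for both orders of composition and cancel, so the
      commutator of two derivations is again a derivation.\<close>
    have "D y (D x (s \<otimes>\<^bsub>S\<^esub> t))
      = s \<otimes>\<^bsub>S\<^esub> D y (D x t) \<oplus>\<^bsub>S\<^esub> D y s \<otimes>\<^bsub>S\<^esub> D x t \<oplus>\<^bsub>S\<^esub> (D x s \<otimes>\<^bsub>S\<^esub> D y t \<oplus>\<^bsub>S\<^esub> D y (D x s) \<otimes>\<^bsub>S\<^esub> t)"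
      using cs s t by (simp add: D_mult[OF x] D_mult[OF y] ad[OF y])
    moreover have "D x (D y (s \<otimes>\<^bsub>S\<^esub> t))
      = s \<otimes>\<^bsub>S\<^esub> D x (D y t) \<oplus>\<^bsub>S\<^esub> D x s \<otimes>\<^bsub>S\<^esub> D y t \<oplus>\<^bsub>S\<^esub> (D y s \<otimes>\<^bsub>S\<^esub> D x t \<oplus>\<^bsub>S\<^esub> D x (D y s) \<otimes>\<^bsub>S\<^esub> t)"
      using cs s t by (simp add: D_mult[OF x] D_mult[OF y] ad[OF x])
    ultimately show "D y (D x (s \<otimes>\<^bsub>S\<^esub> t)) \<ominus>\<^bsub>S\<^esub> D x (D y (s \<otimes>\<^bsub>S\<^esub> t))
      = s \<otimes>\<^bsub>S\<^esub> (D y (D x t) \<ominus>\<^bsub>S\<^esub> D x (D y t)) \<oplus>\<^bsub>S\<^esub> (D y (D x s) \<ominus>\<^bsub>S\<^esub> D x (D y s)) \<otimes>\<^bsub>S\<^esub> t"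
      using s t cs cc by simp algebra
  qed
  then show ?thesis
  proof (rule derivs_eq[OF _ D_derivs[OF xy] _ s])
    fix z assume z: "z \<in> carrier L"
    note c = circ_closed[OF x y] circ_closed[OF y x] circ_closed[OF z x] circ_closed[OF z y]
    have "z \<bullet> (x \<otimes>\<^bsub>L\<^esub> y) = z \<bullet> (x \<bullet> y) \<ominus>\<^bsub>L\<^esub> z \<bullet> (y \<bullet> x)"
      unfolding bracket_eq[OF x y]
      by (rule lin_hom_minus[OF bilin_mapD(3)[OF circ_bilin z] module_axioms module_axioms c(1,2)])
    also have "\<dots> = z \<bullet> x \<bullet> y \<ominus>\<^bsub>L\<^esub> z \<bullet> y \<bullet> x"
    proof -
      \<comment> \<open>\<open>prelie\<close> has the form a - p = b - q, with \<open>a\<close>,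
        \<open>b\<close> the right-nested and \<open>p\<close>, \<open>q\<close> the left-nested
        products. Exchanging \<open>p\<close> and \<open>b\<close> equates a - b, on which the
        bracket acts, with p - q, the commutator evaluated at a letter.\<close>
      have *: "a \<ominus>\<^bsub>L\<^esub> b = p \<ominus>\<^bsub>L\<^esub> q"
        if "a \<ominus>\<^bsub>L\<^esub> p = b \<ominus>\<^bsub>L\<^esub> q" "a \<in> carrier L" "b \<in> carrier L" "p \<in> carrier L" "q \<in> carrier L" for a b p q
      proof -
        have "a \<ominus>\<^bsub>L\<^esub> b = (a \<ominus>\<^bsub>L\<^esub> p) \<oplus>\<^bsub>L\<^esub> (p \<ominus>\<^bsub>L\<^esub> b)"
          using that(2-) by (simp add: a_minus_def M.a_assoc M.r_neg1)
        also have "\<dots> = (b \<ominus>\<^bsub>L\<^esub> q) \<oplus>\<^bsub>L\<^esub> (p \<ominus>\<^bsub>L\<^esub> b)" by (simp only: that(1))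
        also have "\<dots> = (p \<ominus>\<^bsub>L\<^esub> b) \<oplus>\<^bsub>L\<^esub> (b \<ominus>\<^bsub>L\<^esub> q)" using that(2-) by (simp add: M.a_comm m_minus_closed)
        also have "\<dots> = p \<ominus>\<^bsub>L\<^esub> q" using that(2-) by (simp add: a_minus_def M.a_assoc M.r_neg1)
        finally show ?thesis .
      qed
      show ?thesis
        by (rule *[OF prelie[OF z x y]]) (intro circ_closed x y z)+
    qed
    finally show "D y (D x (\<sigma> z)) \<ominus>\<^bsub>S\<^esub> D x (D y (\<sigma> z)) = D (x \<otimes>\<^bsub>L\<^esub> y) (\<sigma> z)"
      using c by (simp add: D_gen x y z xy sgen_minus circ_closed)
  qed
qed

section \<open>The right action on Sym and the map \<open>\<Psi>\<close>\<close>

definition rho where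
  "rho x = (\<lambda>s. s \<otimes>\<^bsub>S\<^esub> \<sigma> x \<oplus>\<^bsub>S\<^esub> D x s)"

lemma rho_lin: "x \<in> carrier L \<Longrightarrow> rho x \<in> lin_hom R S S"
  unfolding rho_def
  by (intro lin_hom_addI bilin_mapD(1)[OF S.U.mult_bilin] D_lin S.U.module_axioms' sgen_closed)
    (auto intro: lin_hom_cong[OF D_lin S.U.module_axioms'])

lemma rho_closed: "\<lbrakk>x \<in> carrier L; s \<in> carrier S\<rbrakk> \<Longrightarrow> rho x s \<in> carrier S"
  by (rule lin_homD(1)[OF rho_lin])

text \<open>When \<open>rho x\<close> is followed by \<open>rho y\<close>, the term with both
  letters and the two terms with one letter and one derivation are symmetric in \<open>x\<close> and
  \<open>y\<close>, so they cancel in the difference. What remains is \<open>s\<close> times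
  \<sigma>(x \<bullet> y) - \<sigma>(y \<bullet> x), plus the commutator of the derivations, which
  \<open>D_bracket\<close> evaluates.\<close>

lemma rho_bracket:
  assumes x: "x \<in> carrier L" and y: "y \<in> carrier L" and s: "s \<in> carrier S"
  shows "rho y (rho x s) \<ominus>\<^bsub>S\<^esub> rho x (rho y s) = rho (x \<otimes>\<^bsub>L\<^esub> y) s"
proof -
  note g = sgen_closed[OF x] sgen_closed[OF y]
  note c = D_closed[OF x s] D_closed[OF y s]
  note cc = D_closed[OF y c(1)] D_closed[OF x c(2)]
  note k = circ_closed[OF x y] circ_closed[OF y x]
  have 1: "rho b (rho a s) = (s \<otimes>\<^bsub>S\<^esub> \<sigma> a \<oplus>\<^bsub>S\<^esub> D a s) \<otimes>\<^bsub>S\<^esub> \<sigma> b \<oplus>\<^bsub>S\<^esub>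
      (s \<otimes>\<^bsub>S\<^esub> \<sigma> (a \<bullet> b) \<oplus>\<^bsub>S\<^esub> D b s \<otimes>\<^bsub>S\<^esub> \<sigma> a \<oplus>\<^bsub>S\<^esub> D b (D a s))"
    if a: "a \<in> carrier L" and b: "b \<in> carrier L" for a b
    unfolding rho_def
    using D_closed[OF a s] D_closed[OF b s] s sgen_closed[OF a]
    by (simp add: lin_homD(2)[OF D_lin[OF b]] D_mult[OF b] D_gen[OF b a])
  have "rho (x \<otimes>\<^bsub>L\<^esub> y) s
    = s \<otimes>\<^bsub>S\<^esub> (\<sigma> (x \<bullet> y) \<ominus>\<^bsub>S\<^esub> \<sigma> (y \<bullet> x)) \<oplus>\<^bsub>S\<^esub> (D y (D x s) \<ominus>\<^bsub>S\<^esub> D x (D y s))"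
    unfolding rho_def D_bracket[OF x y s] unfolding bracket_eq[OF x y] sgen_minus[OF k] ..
  then show ?thesis
    unfolding 1[OF x y] 1[OF y x]
    using s g c cc k[THEN sgen_closed] by simp algebra
qed

abbreviation "E \<equiv> end_alg R S"

text \<open>By \<open>rho_bracket\<close> the operators \<open>rho x\<close> satisfy the relations
  of U inside \<open>end_alg\<close>, so they extend to U; the map is evaluation of this action at
  1. The product of \<open>end_alg\<close> applies its left factor first, so a generator on the
  right acts last.\<close>

lemma action_ex:
  "\<exists>\<Psi>. \<Psi> \<in> lin_hom R U S \<and> \<Psi> \<one>\<^bsub>U\<^esub> = \<one>\<^bsub>S\<^esub> \<and>
     (\<forall>u\<in>carrier U. \<forall>x\<in>carrier L. \<Psi> (u \<otimes>\<^bsub>U\<^esub> \<iota> x) = rho x (\<Psi> u))"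
proof -
  note mS = S.U.module_axioms'
  note aE = assoc_alg_end[OF mS]
  interpret E: assoc_alg R E by (rule aE)
  let ?r = "\<lambda>x. \<lambda>s\<in>carrier S. rho x s"
  have rc: "?r x \<in> carrier E" if "x \<in> carrier L" for x by (rule restrict_end_alg[OF mS rho_lin[OF that]])
  have r: "?r \<in> lin_hom R L E"
  proof (rule lin_homI)
    fix x assume x: "x \<in> carrier L"
    show "?r x \<in> carrier E" by (rule rc[OF x])
    show "?r (x \<oplus>\<^bsub>L\<^esub> y) = ?r x \<oplus>\<^bsub>E\<^esub> ?r y" if y: "y \<in> carrier L" for y
    proof (rule end_alg_eqI[OF rc[OF M.a_closed[OF x y]] E.M.a_closed[OF rc[OF x] rc[OF y]]])
      fix s assume s: "s \<in> carrier S"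
      then show "?r (x \<oplus>\<^bsub>L\<^esub> y) s = (?r x \<oplus>\<^bsub>E\<^esub> ?r y) s"
        using D_closed[OF x s] D_closed[OF y s] sgen_closed[OF x] sgen_closed[OF y]
        by (simp add: rho_def D_add[OF x y] sgen_D(2)[OF x y] S.U.A.r_distr S.U.M.a_ac)
    qed
    show "?r (c \<odot>\<^bsub>L\<^esub> x) = c \<odot>\<^bsub>E\<^esub> ?r x" if c: "c \<in> carrier R" for c
    proof (rule end_alg_eqI[OF rc[OF smult_closed[OF c x]] E.smult_closed[OF c rc[OF x]]])
      fix s assume s: "s \<in> carrier S"
      then show "?r (c \<odot>\<^bsub>L\<^esub> x) s = (c \<odot>\<^bsub>E\<^esub> ?r x) s"
        using D_closed[OF x s] sgen_closed[OF x] c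
        by (simp add: rho_def D_smult[OF c x] sgen_D(3)[OF c x] S.U.smult_mult_r S.U.smult_r_distr)
    qed
  qed
  have rel: "?r x \<otimes>\<^bsub>E\<^esub> ?r y \<ominus>\<^bsub>E\<^esub> ?r y \<otimes>\<^bsub>E\<^esub> ?r x = ?r (x \<otimes>\<^bsub>L\<^esub> y)" if x: "x \<in> carrier L" and y: "y \<in> carrier L" for x y
  proof (rule end_alg_eqI[OF E.m_minus_closed[OF E.A.m_closed[OF rc[OF x] rc[OF y]] E.A.m_closed[OF rc[OF y] rc[OF x]]]
        rc[OF bracket_closed[OF x y]]])
    fix s assume s: "s \<in> carrier S"
    have yx: "?r y \<otimes>\<^bsub>E\<^esub> ?r x \<in> carrier E" by (rule E.A.m_closed[OF rc[OF y] rc[OF x]])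
    have "(?r x \<otimes>\<^bsub>E\<^esub> ?r y \<ominus>\<^bsub>E\<^esub> ?r y \<otimes>\<^bsub>E\<^esub> ?r x) s = rho y (rho x s) \<ominus>\<^bsub>S\<^esub> rho x (rho y s)"
      unfolding a_minus_def[of E] E.a_inv_eq_smult[OF yx]
      using s rho_closed[OF x s] rho_closed[OF y s] rho_closed[OF x] rho_closed[OF y]
      by (simp add: a_minus_def S.U.a_inv_eq_smult)
    then show "(?r x \<otimes>\<^bsub>E\<^esub> ?r y \<ominus>\<^bsub>E\<^esub> ?r y \<otimes>\<^bsub>E\<^esub> ?r x) s = ?r (x \<otimes>\<^bsub>L\<^esub> y) s"
      using rho_bracket[OF x y s] s by simp
  qed
  obtain h where h: "h \<in> alg_hom R U E" "\<And>x. x \<in> carrier L \<Longrightarrow> h (\<iota> x) = ?r x"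
    using env_lift[OF aE r rel] by metis
  note hD = lin_homD(2,3)[OF alg_homD(1)[OF h(1)]] alg_homD(2,3)[OF h(1)]
  have hc: "h u \<one>\<^bsub>S\<^esub> \<in> carrier S" if "u \<in> carrier U" for u
    using alg_homD(4)[OF h(1) that] lin_homD(1)[of "h u" R S S "\<one>\<^bsub>S\<^esub>"] by simp
  have "(\<lambda>u. h u \<one>\<^bsub>S\<^esub>) \<in> lin_hom R U S"
    by (rule lin_homI) (simp_all add: hc hD)
  moreover have "h \<one>\<^bsub>U\<^esub> \<one>\<^bsub>S\<^esub> = \<one>\<^bsub>S\<^esub>" by (simp add: hD)
  moreover have "h (u \<otimes>\<^bsub>U\<^esub> \<iota> x) \<one>\<^bsub>S\<^esub> = rho x (h u \<one>\<^bsub>S\<^esub>)" if "u \<in> carrier U" "x \<in> carrier L" for u x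
    using that hc by (simp add: hD gen_closed h(2))
  ultimately show ?thesis by (intro exI[of _ "\<lambda>u. h u \<one>\<^bsub>S\<^esub>"]) simp
qed

text \<open>The choice is forced on words: the empty word goes to 1, and appending a letter
  \<open>x\<close> applies \<open>rho x\<close>.\<close>

definition Psi (\<open>\<Psi>\<close>) where
  "\<Psi> = (SOME f. f \<in> lin_hom R U S \<and> f \<one>\<^bsub>U\<^esub> = \<one>\<^bsub>S\<^esub> \<and>
     (\<forall>u\<in>carrier U. \<forall>x\<in>carrier L. f (u \<otimes>\<^bsub>U\<^esub> \<iota> x) = rho x (f u)))"

lemma Psi_spec: "\<Psi> \<in> lin_hom R U S \<and> \<Psi> \<one>\<^bsub>U\<^esub> = \<one>\<^bsub>S\<^esub> \<and>
    (\<forall>u\<in>carrier U. \<forall>x\<in>carrier L. \<Psi> (u \<otimes>\<^bsub>U\<^esub> \<iota> x) = rho x (\<Psi> u))"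
  unfolding Psi_def by (rule someI_ex[OF action_ex])

lemma Psi_lin: "\<Psi> \<in> lin_hom R U S"
  and Psi_one: "\<Psi> \<one>\<^bsub>U\<^esub> = \<one>\<^bsub>S\<^esub>"
  and Psi_mult_gen: "\<lbrakk>u \<in> carrier U; x \<in> carrier L\<rbrakk> \<Longrightarrow> \<Psi> (u \<otimes>\<^bsub>U\<^esub> \<iota> x) = \<Psi> u \<otimes>\<^bsub>S\<^esub> \<sigma> x \<oplus>\<^bsub>S\<^esub> D x (\<Psi> u)"
  using Psi_spec by (auto simp: rho_def)

lemma Psi_closed: "u \<in> carrier U \<Longrightarrow> \<Psi> u \<in> carrier S"
  by (rule lin_homD(1)[OF Psi_lin])

lemma Psi_snoc:
  "\<lbrakk>w \<in> words; x \<in> carrier L\<rbrakk> \<Longrightarrow> \<Psi> (uw (w @ [x])) = \<Psi> (uw w) \<otimes>\<^bsub>S\<^esub> \<sigma> x \<oplus>\<^bsub>S\<^esub> D x (\<Psi> (uw w))"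
  by (simp add: uw_snoc Psi_mult_gen uw_closed)

section \<open>Leading terms of \<open>\<Psi>\<close>\<close>

lemma sw_SFil: "w \<in> words \<Longrightarrow> length w \<le> n \<Longrightarrow> sw w \<in> SFil n"
  using S.uw_Fil by simp

text \<open>By the Leibniz rule \<open>D x\<close> replaces the letters of a word one at a time by
  other letters, so the length does not grow.\<close>

lemma D_SFil:
  assumes x: "x \<in> carrier L" and s: "s \<in> SFil n"
  shows "D x s \<in> SFil n"
proof (rule S.Fil_lin_hom_mem[OF D_lin[OF x] S.U.module_axioms' S.Fil_submodule _ s])
  have "D x (sw w) \<in> SFil (length w)" if "w \<in> words" for w
    using that
  proof (induct w)
    case Nil
    show ?case using S.FilD(2) by (simp add: D_one[OF x])
  next
    case (Cons y w)
    then have y: "y \<in> carrier L" and w: "w \<in> words" and IH: "D x (sw w) \<in> SFil (length w)" by auto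
    have "\<sigma> y \<otimes>\<^bsub>S\<^esub> D x (sw w) \<in> SFil (Suc (length w))"
      using S.Fil_gen_mult_l[OF IH, of y] y by simp
    moreover have "\<sigma> (y \<bullet> x) \<otimes>\<^bsub>S\<^esub> sw w \<in> SFil (Suc (length w))"
      using S.Fil_gen_mult_l[OF sw_SFil[OF w le_refl], of "y \<bullet> x"] circ_closed[OF y x] by simp
    ultimately show ?case
      using S.FilD(3) by (simp add: D_mult[OF x] sgen_closed[OF y] sw_closed[OF w] D_gen[OF x y])
  qed
  then show "D x (sw w) \<in> SFil n" if "w \<in> S.words" "length w \<le> n" for w
    using that S.Fil_mono[of "length w" n] by auto
qed

sublocale SF: filt_alg R S SFil
  by (rule filtered_algebra_filt_alg[OF S.filtered_algebra_U])

lemma SP_mono: "m \<le> n \<Longrightarrow> SF.P m \<subseteq> SF.P n"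
  using S.Fil_mono S.FilD(2) by (cases m; cases n) auto

text \<open>Appending \<open>x\<close> multiplies the previous error by \<sigma> x and adds
  \<open>D x\<close> of an element whose degree is at most the old length. Both terms stay below the
  new length, as \<open>SF.P (Suc n)\<close> is all of \<open>SFil n\<close>. For the empty word the
  error is 0, which is all that \<open>SF.P 0\<close> allows.\<close>

lemma Psi_word_leading: "w \<in> words \<Longrightarrow> \<Psi> (uw w) \<ominus>\<^bsub>S\<^esub> sw w \<in> SF.P (length w)"
proof (induct w rule: rev_induct)
  case Nil
  show ?case by (simp add: Psi_one S.U.minus_self)
next
  case (snoc x w)
  then have x: "x \<in> carrier L" and w: "w \<in> words" and l: "\<Psi> (uw w) \<ominus>\<^bsub>S\<^esub> sw w \<in> SF.P (length w)" by auto
  note c = Psi_closed[OF uw_closed[OF w]] sw_closed[OF w] sgen_closed[OF x]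
  have "(\<Psi> (uw w) \<ominus>\<^bsub>S\<^esub> sw w) \<oplus>\<^bsub>S\<^esub> sw w \<in> SFil (length w)"
    using l SF.P_subset sw_SFil[OF w le_refl] S.FilD(3) by blast
  moreover have "(\<Psi> (uw w) \<ominus>\<^bsub>S\<^esub> sw w) \<oplus>\<^bsub>S\<^esub> sw w = \<Psi> (uw w)" using c by algebra
  ultimately have "D x (\<Psi> (uw w)) \<in> SFil (length w)" using D_SFil[OF x] by simp
  then have "(\<Psi> (uw w) \<ominus>\<^bsub>S\<^esub> sw w) \<otimes>\<^bsub>S\<^esub> \<sigma> x \<oplus>\<^bsub>S\<^esub> D x (\<Psi> (uw w)) \<in> SF.P (length w + 1)"
    using SF.P_mult_l[OF l S.gen_Fil[of x]] x by (intro SF.PD(3)) auto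
  moreover have "\<Psi> (uw (w @ [x])) \<ominus>\<^bsub>S\<^esub> sw (w @ [x])
    = (\<Psi> (uw w) \<ominus>\<^bsub>S\<^esub> sw w) \<otimes>\<^bsub>S\<^esub> \<sigma> x \<oplus>\<^bsub>S\<^esub> D x (\<Psi> (uw w))"
    unfolding Psi_snoc[OF w x] sw_snoc[OF w x] using c D_closed[OF x c(1)] by algebra
  ultimately show ?case by simp
qed

lemma Psi_word_SFil:
  assumes w: "w \<in> words" "length w \<le> n"
  shows "\<Psi> (uw w) \<in> SFil n"
proof -
  have "(\<Psi> (uw w) \<ominus>\<^bsub>S\<^esub> sw w) \<oplus>\<^bsub>S\<^esub> sw w \<in> SFil (length w)"
    using Psi_word_leading[OF w(1)] SF.P_subset sw_SFil[OF w(1) le_refl] S.FilD(3) by blast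
  moreover have "(\<Psi> (uw w) \<ominus>\<^bsub>S\<^esub> sw w) \<oplus>\<^bsub>S\<^esub> sw w = \<Psi> (uw w)"
    using Psi_closed[OF uw_closed[OF w(1)]] sw_closed[OF w(1)] by algebra
  ultimately show ?thesis using S.Fil_mono[OF w(2)] by auto
qed

lemma Psi_SFil: "u \<in> Fil n \<Longrightarrow> \<Psi> u \<in> SFil n"
  by (rule Fil_lin_hom_mem[OF Psi_lin S.U.module_axioms' S.Fil_submodule Psi_word_SFil])

lemma Psi_image_submodule: "submodule (\<Psi> ` Fil n) R S"
  unfolding env_filtration_eq lin_hom_image_span[OF Psi_lin U.module_axioms' S.U.module_axioms' uw_subset]
  by (intro span_submodule S.U.module_axioms') (auto intro!: Psi_closed uw_closed)

text \<open>Triangularity: a word of Sym is the image of the same word of U minus an error in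
  \<open>SF.P n\<close>, and the error lies in the image by induction on \<open>n\<close>.\<close>

lemma Psi_image: "\<Psi> ` Fil n = SFil n"
proof
  show "\<Psi> ` Fil n \<subseteq> SFil n" using Psi_SFil by auto
  note I = submoduleD[OF Psi_image_submodule]
  have step: "SFil n \<subseteq> \<Psi> ` Fil n" if P: "SF.P n \<subseteq> \<Psi> ` Fil n" for n
    unfolding S.env_filtration_eq
  proof (rule span_minimal[OF Psi_image_submodule], rule image_subsetI)
    fix w assume "w \<in> {w \<in> S.words. length w \<le> n}"
    then have w: "w \<in> words" "length w \<le> n" by auto
    have "\<Psi> (uw w) \<ominus>\<^bsub>S\<^esub> sw w \<in> \<Psi> ` Fil n"
      using Psi_word_leading[OF w(1)] SP_mono[OF w(2)] P by blast
    then have "\<Psi> (uw w) \<ominus>\<^bsub>S\<^esub> (\<Psi> (uw w) \<ominus>\<^bsub>S\<^esub> sw w) \<in> \<Psi> ` Fil n"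
      by (rule I(6)[OF imageI[OF uw_Fil[OF w]]])
    moreover have "\<Psi> (uw w) \<ominus>\<^bsub>S\<^esub> (\<Psi> (uw w) \<ominus>\<^bsub>S\<^esub> sw w) = sw w"
      using Psi_closed[OF uw_closed[OF w(1)]] sw_closed[OF w(1)] by algebra
    ultimately show "sw w \<in> \<Psi> ` Fil n" by simp
  qed
  show "SFil n \<subseteq> \<Psi> ` Fil n"
  proof (induct n)
    case 0
    show ?case by (rule step) (use I(2) in auto)
  next
    case (Suc n)
    show ?case by (rule step) (use Suc Fil_mono[of n "Suc n"] in auto)
  qed
qed

end

section \<open>Bijectivity of \<open>\<Psi>\<close> and of the canonical map\<close>

context prelie_env
begin

text \<open>Each degree has its own quotient as target. The canonical map is analysed one component
  at a time, so that linear arguments on words apply in a fixed module.\<close>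

lemma coeff_lin: "(\<lambda>s. can s n) \<in> lin_hom R S (quot_alg U (P n))"
proof -
  have "(\<lambda>f. f n) \<in> lin_hom R Gr (quot_alg U (P n))"
  proof (rule lin_homI)
    fix f assume "f \<in> carrier Gr"
    then obtain x where "x \<in> Fil n" "f n = P n +>\<^bsub>U\<^esub> x" unfolding gr_simps by blast
    then show "f n \<in> carrier (quot_alg U (P n))" using Q.proj_closed FilD(1) by simp
  qed (simp_all add: gr_simps quot_alg_simps)
  then show ?thesis by (rule lin_hom_comp[OF alg_homD(1)[OF can_alg_hom]])
qed

lemma can_word_coeff: "w \<in> words \<Longrightarrow> can (sw w) n = (if n = length w then P n +>\<^bsub>U\<^esub> uw w else P n)"
  by (simp add: can_word gr_class_def)

text \<open>The set \<open>X\<close> covers two situations: words shorter than \<open>n\<close>, and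
  words of one fixed length different from \<open>n\<close>.\<close>

lemma can_coeff_zero:
  assumes "X \<subseteq> sw ` {w \<in> words. length w \<noteq> n}" "s \<in> submodule_span R S X"
  shows "can s n = P n"
proof -
  interpret Qn: module R "quot_alg U (P n)" by (rule Q.module_Q)
  have "can s n \<in> {\<zero>\<^bsub>quot_alg U (P n)\<^esub>}"
  proof (rule lin_hom_span[OF coeff_lin S.U.module_axioms' Q.module_Q Qn.zero_submodule _ _ assms(2)])
    show "X \<subseteq> carrier S" using assms(1) sw_closed by auto
    fix x assume "x \<in> X"
    then obtain w where "w \<in> words" "length w \<noteq> n" "x = sw w" using assms(1) by blast
    then show "can x n \<in> {\<zero>\<^bsub>quot_alg U (P n)\<^esub>}"
      by (simp add: can_word_coeff quot_alg_simps)
  qed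
  then show ?thesis by (simp add: quot_alg_simps)
qed

lemma can_coeff_SP: "s \<in> SF.P n \<Longrightarrow> can s n = P n"
proof (cases n)
  case 0
  assume "s \<in> SF.P n"
  then show ?thesis using lin_hom_zero[OF coeff_lin S.U.module_axioms' Q.module_Q] 0
    by (simp add: quot_alg_simps)
next
  case (Suc m)
  assume "s \<in> SF.P n"
  then have "s \<in> submodule_span R S (sw ` {w \<in> words. length w \<le> m})"
    using Suc S.env_filtration_eq[of m] by simp
  then show ?thesis by (rule can_coeff_zero[rotated]) (use Suc in auto)
qed

text \<open>Both sides are linear in \<open>u\<close>, so words decide. For a word of length
  \<open>n\<close> the error term of \<open>\<Psi>\<close> contributes nothing in degree
  \<open>n\<close>; for a shorter word both sides are the trivial coset.\<close>

lemma can_Psi_coeff: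
  assumes u: "u \<in> Fil n"
  shows "can (\<Psi> u) n = P n +>\<^bsub>U\<^esub> u"
proof (rule lin_hom_eq_on_span[OF lin_hom_comp[OF Psi_lin coeff_lin] Q.proj_lin U.module_axioms' Q.module_Q uw_subset
      _ u[unfolded env_filtration_eq]])
  interpret Qn: module R "quot_alg U (P n)" by (rule Q.module_Q)
  fix x assume "x \<in> uw ` {w \<in> words. length w \<le> n}"
  then obtain w where w: "w \<in> words" "length w \<le> n" "x = uw w" by blast
  note c = Psi_closed[OF uw_closed[OF w(1)]] sw_closed[OF w(1)]
  show "can (\<Psi> x) n = P n +>\<^bsub>U\<^esub> x"
  proof (cases "length w = n")
    case True
    have "can (\<Psi> (uw w)) n \<ominus>\<^bsub>quot_alg U (P n)\<^esub> can (sw w) n = can (\<Psi> (uw w) \<ominus>\<^bsub>S\<^esub> sw w) n"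
      by (rule lin_hom_minus[OF coeff_lin S.U.module_axioms' Q.module_Q c, symmetric])
    also have "\<dots> = \<zero>\<^bsub>quot_alg U (P n)\<^esub>"
      using can_coeff_SP Psi_word_leading[OF w(1)] True by (simp add: quot_alg_simps)
    finally have "can (\<Psi> (uw w)) n = can (sw w) n"
      using Qn.minus_eq_zero_iff lin_homD(1)[OF coeff_lin] c by blast
    then show ?thesis using True w by (simp add: can_word_coeff)
  next
    case False
    then obtain m where m: "n = Suc m" "length w \<le> m" using w(2) by (cases n) auto
    then have "can (\<Psi> (uw w)) n = P n"
      using Psi_word_SFil[OF w(1)] by (intro can_coeff_SP) auto
    moreover have "uw w \<in> P n" using uw_Fil[OF w(1)] m by simp
    then have "P n +>\<^bsub>U\<^esub> uw w = P n" using Q.proj_zero_iff uw_closed[OF w(1)] by blast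
    ultimately show ?thesis using w(3) by simp
  qed
qed

lemma Psi_surj: "\<Psi> ` carrier U = carrier S"
  unfolding Fil_Union[symmetric] S.Fil_Union[symmetric] image_UN Psi_image ..

text \<open>Whenever \<open>u\<close> lies in \<open>Fil n\<close>, the vanishing of component
  \<open>n\<close> moves it down to \<open>P n\<close>. The descent ends in \<open>P 0\<close>,
  which is zero.\<close>

lemma can_Psi_zero:
  assumes u: "u \<in> carrier U" and 0: "can (\<Psi> u) = \<zero>\<^bsub>Gr\<^esub>"
  shows "u = \<zero>\<^bsub>U\<^esub>"
proof -
  have P: "u \<in> P n" if "u \<in> Fil n" for n
    using can_Psi_coeff[OF that] unfolding 0 gr_simps using Q.proj_zero_iff[OF u] by metis
  have "u = \<zero>\<^bsub>U\<^esub>" if "u \<in> Fil n" for n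
    using that
  proof (induct n)
    case 0 then show ?case using P[of 0] by simp
  next
    case (Suc n) then show ?case using P[of "Suc n"] by simp
  qed
  then show ?thesis using u Fil_Union by blast
qed

lemma Psi_inj: "inj_on \<Psi> (carrier U)"
proof (rule inj_onI)
  fix u v assume u: "u \<in> carrier U" and v: "v \<in> carrier U" and eq: "\<Psi> u = \<Psi> v"
  interpret Gr: assoc_alg R Gr by (rule assoc_alg_gr)
  have "\<Psi> (u \<ominus>\<^bsub>U\<^esub> v) = \<zero>\<^bsub>S\<^esub>"
    using lin_hom_minus[OF Psi_lin U.module_axioms' S.U.module_axioms' u v] eq Psi_closed[OF v]
    by (simp add: S.U.minus_self)
  then have "u \<ominus>\<^bsub>U\<^esub> v = \<zero>\<^bsub>U\<^esub>"
    using lin_hom_zero[OF alg_homD(1)[OF can_alg_hom] S.U.module_axioms' Gr.module_axioms'] u v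
    by (intro can_Psi_zero) (auto simp: U.m_minus_closed)
  then show "u = v" using U.minus_eq_zero_iff u v by blast
qed

text \<open>As \<open>\<Psi>\<close> is surjective, every element of Sym has the form
  \<open>\<Psi> u\<close>, and \<open>can_Psi_zero\<close> applies to differences.\<close>

lemma can_inj: "inj_on can (carrier S)"
proof (rule inj_onI)
  fix s t assume s: "s \<in> carrier S" and t: "t \<in> carrier S" and eq: "can s = can t"
  interpret Gr: assoc_alg R Gr by (rule assoc_alg_gr)
  have st: "s \<ominus>\<^bsub>S\<^esub> t \<in> carrier S" using s t by (rule S.U.m_minus_closed)
  then obtain u where u: "u \<in> carrier U" "\<Psi> u = s \<ominus>\<^bsub>S\<^esub> t" using Psi_surj by (metis imageE)
  have "can (\<Psi> u) = \<zero>\<^bsub>Gr\<^esub>"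
    using u lin_hom_minus[OF alg_homD(1)[OF can_alg_hom] S.U.module_axioms' Gr.module_axioms' s t] eq
      alg_homD(4)[OF can_alg_hom t] by (simp add: Gr.minus_self)
  then have "u = \<zero>\<^bsub>U\<^esub>" by (rule can_Psi_zero[OF u(1)])
  then have "s \<ominus>\<^bsub>S\<^esub> t = \<zero>\<^bsub>S\<^esub>" using u lin_hom_zero[OF Psi_lin U.module_axioms' S.U.module_axioms'] by simp
  then show "s = t" using S.U.minus_eq_zero_iff s t by blast
qed

lemma can_image_submodule: "submodule (can ` carrier S) R Gr"
proof -
  interpret Gr: assoc_alg R Gr by (rule assoc_alg_gr)
  have "can ` carrier S = submodule_span R Gr (can ` sw ` S.words)"
    using lin_hom_image_span[OF alg_homD(1)[OF can_alg_hom] S.U.module_axioms' Gr.module_axioms' S.uw_subset']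
    by (simp only: S.uw_span)
  moreover have "can ` sw ` S.words \<subseteq> carrier Gr"
    using alg_homD(4)[OF can_alg_hom] S.uw_closed by blast
  ultimately show ?thesis using span_submodule[OF Gr.module_axioms'] by simp
qed

text \<open>Words of length \<open>n\<close> are covered by \<open>can_word\<close>, and shorter
  words have class zero in degree \<open>n\<close>. The elements whose class is hit form a
  submodule, so the span of these words follows.\<close>

lemma gr_class_in_image:
  assumes u: "u \<in> Fil n"
  shows "gr_class U Fil n u \<in> can ` carrier S"
proof -
  interpret Gr: assoc_alg R Gr by (rule assoc_alg_gr)
  note I = submoduleD[OF can_image_submodule]
  let ?H = "{u \<in> Fil n. gr_class U Fil n u \<in> can ` carrier S}"
  have low: "gr_class U Fil n u \<in> can ` carrier S" if "u \<in> P n" for u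
    using I(2) gr_class_eq_zero[OF that] by simp
  have "submodule ?H R U"
  proof (rule U.submoduleI')
    show "\<zero>\<^bsub>U\<^esub> \<in> ?H" using low[OF PD(2)] FilD(2) by simp
  qed (use FilD(1,3,4) I(3,4) in \<open>auto simp: gr_class_add gr_class_smult\<close>)
  moreover have "uw ` {w \<in> words. length w \<le> n} \<subseteq> ?H"
  proof (rule image_subsetI)
    fix w assume "w \<in> {w \<in> words. length w \<le> n}"
    then have w: "w \<in> words" "length w \<le> n" by auto
    have "gr_class U Fil n (uw w) \<in> can ` carrier S"
    proof (cases "length w = n")
      case True
      then show ?thesis using can_word[OF w(1)] sw_closed[OF w(1)] by (metis imageI)
    next
      case False
      then show ?thesis using w uw_Fil[OF w(1)] by (intro low) (cases n, auto)
    qed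
    then show "uw w \<in> ?H" using uw_Fil[OF w] by simp
  qed
  ultimately have "Fil n \<subseteq> ?H" unfolding env_filtration_eq[of n] by (rule span_minimal)
  then show ?thesis using u by blast
qed

lemma can_surj: "can ` carrier S = carrier Gr"
proof
  interpret Gr: assoc_alg R Gr by (rule assoc_alg_gr)
  show "can ` carrier S \<subseteq> carrier Gr" using alg_homD(4)[OF can_alg_hom] by blast
  note I = submoduleD[OF can_image_submodule]
  note pD = lin_homD(2)[OF alg_homD(1)[OF gr_proj_alg_hom]]
  \<comment> \<open>The induction is on a bound for the degrees that occur. The component in the top
    degree \<open>N\<close> is split off as a homogeneous class.\<close>
  have *: "gr_proj f \<in> can ` carrier S" if "f \<in> carrier rees" "\<forall>n\<ge>N. f n = \<zero>\<^bsub>U\<^esub>" for N f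
    using that
  proof (induct N arbitrary: f)
    case 0
    then have "gr_proj f = \<zero>\<^bsub>Gr\<^esub>" by (simp add: gr_proj_def gr_simps P_coset_zero)
    then show ?case using I(2) by simp
  next
    case (Suc N)
    let ?g = "f(N := \<zero>\<^bsub>U\<^esub>)"
    have g: "?g \<in> carrier rees"
      unfolding rees_carrier using rees_F[OF Suc(2)] FD(2) Suc(3)
      by (auto intro!: exI[of _ N])
    have fN: "f N \<in> Fil N" by (rule rees_F[OF Suc(2)])
    have "f = ?g \<oplus>\<^bsub>rees\<^esub> homog N (f N)"
      using rees_closed[OF Suc(2)] by (intro ext) (simp add: homog_def)
    then have "gr_proj f = gr_proj ?g \<oplus>\<^bsub>Gr\<^esub> gr_class U Fil N (f N)"
      unfolding gr_class_homog using pD[OF g homog_closed[OF fN]] by simp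
    moreover have "gr_proj ?g \<in> can ` carrier S"
      by (rule Suc(1)[OF g]) (use Suc(3) in \<open>auto simp: Suc_le_eq\<close>)
    ultimately show ?case using I(3) gr_class_in_image[OF fN] by simp
  qed
  show "carrier Gr \<subseteq> can ` carrier S"
  proof
    fix h assume "h \<in> carrier Gr"
    then obtain f where f: "f \<in> carrier rees" "gr_proj f = h" using gr_proj_surj by blast
    then obtain N where "bound \<zero>\<^bsub>U\<^esub> N f" by (auto simp: rees_carrier)
    then have "\<forall>n\<ge>Suc N. f n = \<zero>\<^bsub>U\<^esub>" by (auto simp: bound_def)
    then show "h \<in> can ` carrier S" using *[OF f(1)] f(2) by blast
  qed
qed

lemma can_alg_iso: "can \<in> alg_iso R (sym_alg R L) (gr_env R L)"
  unfolding alg_iso_def gr_env_def sym_abelianize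
  using can_alg_hom can_inj can_surj by (simp add: bij_betw_def)

section \<open>Compatibility of \<open>\<Psi>\<close> with coproduct and counit\<close>

abbreviation "SS \<equiv> S.UU"
abbreviation "spure \<equiv> S.pure"
abbreviation "PP \<equiv> tensor_map R S S \<Psi> \<Psi>"
text \<open>The derivation induced by \<open>D x\<close> on the tensor square. That
  \<open>D x\<close> is a coderivation means that the coproduct intertwines \<open>D x\<close> with
  it.\<close>

abbreviation "DD x \<equiv> (\<lambda>t. tensor_map R S S id (D x) t \<oplus>\<^bsub>SS\<^esub> tensor_map R S S (D x) id t)"

lemma PP: "PP \<in> lin_hom R UU SS" "\<lbrakk>a \<in> carrier U; b \<in> carrier U\<rbrakk> \<Longrightarrow> PP (pure a b) = spure (\<Psi> a) (\<Psi> b)"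
  using tensor_map[OF U.module_axioms' U.module_axioms' S.U.module_axioms' S.U.module_axioms' Psi_lin Psi_lin]
  by auto

lemma DD:
  assumes x: "x \<in> carrier L"
  shows "DD x \<in> lin_hom R SS SS"
    and "\<lbrakk>a \<in> carrier S; b \<in> carrier S\<rbrakk> \<Longrightarrow> DD x (spure a b) = spure a (D x b) \<oplus>\<^bsub>SS\<^esub> spure (D x a) b"
proof -
  note m = S.U.module_axioms'
  note idl = alg_homD(1)[OF alg_hom_id[of R S]]
  note t1 = tensor_map[OF m m m m idl D_lin[OF x]] and t2 = tensor_map[OF m m m m D_lin[OF x] idl]
  show "DD x \<in> lin_hom R SS SS" by (rule lin_hom_addI[OF t1(1) t2(1) S.UUU.AB.module_T])
  show "\<lbrakk>a \<in> carrier S; b \<in> carrier S\<rbrakk> \<Longrightarrow> DD x (spure a b) = spure a (D x b) \<oplus>\<^bsub>SS\<^esub> spure (D x a) b"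
    by (simp add: t1(2) t2(2))
qed

text \<open>The Leibniz rule in each leg, together with the fact that the primitive element of
  \<open>y\<close> is taken to that of \<open>y \<bullet> x\<close>. Left factors of this kind arise
  when the coproduct of a word is unfolded from its first letter.\<close>

lemma DD_prim:
  assumes x: "x \<in> carrier L" and y: "y \<in> carrier L" and t: "t \<in> carrier SS"
  shows "DD x (S.prim (\<sigma> y) \<otimes>\<^bsub>SS\<^esub> t) = S.prim (\<sigma> y) \<otimes>\<^bsub>SS\<^esub> DD x t \<oplus>\<^bsub>SS\<^esub> S.prim (\<sigma> (y \<bullet> x)) \<otimes>\<^bsub>SS\<^esub> t"
proof (rule S.UUU.AB.tensor_hom_eq[OF _ _ S.UUU.AB.module_T _ t])
  note mult = S.UUU.AB.T'.mult_bilin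
  note g = sgen_closed[OF y] sgen_closed[OF circ_closed[OF y x]]
  show "(\<lambda>t. DD x (S.prim (\<sigma> y) \<otimes>\<^bsub>SS\<^esub> t)) \<in> lin_hom R SS SS"
    by (rule lin_hom_comp[OF bilin_mapD(3)[OF mult S.prim_closed[OF g(1)]] DD(1)[OF x]])
  show "(\<lambda>t. S.prim (\<sigma> y) \<otimes>\<^bsub>SS\<^esub> DD x t \<oplus>\<^bsub>SS\<^esub> S.prim (\<sigma> (y \<bullet> x)) \<otimes>\<^bsub>SS\<^esub> t) \<in> lin_hom R SS SS"
    by (rule lin_hom_addI[OF lin_hom_comp[OF DD(1)[OF x] bilin_mapD(3)[OF mult S.prim_closed[OF g(1)]]]
          bilin_mapD(3)[OF mult S.prim_closed[OF g(2)]] S.UUU.AB.module_T])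
  fix a b assume a: "a \<in> carrier S" and b: "b \<in> carrier S"
  note d = D_closed[OF x a] D_closed[OF x b] D_closed[OF x g(1)]
  show "DD x (S.prim (\<sigma> y) \<otimes>\<^bsub>SS\<^esub> spure a b)
      = S.prim (\<sigma> y) \<otimes>\<^bsub>SS\<^esub> DD x (spure a b) \<oplus>\<^bsub>SS\<^esub> S.prim (\<sigma> (y \<bullet> x)) \<otimes>\<^bsub>SS\<^esub> spure a b"
    unfolding S.prim_mult_pure(1)[OF g(1) a b] S.prim_mult_pure(1)[OF g(2) a b] DD(2)[OF x a b]
    using a b g d
    by (simp add: lin_homD(2)[OF DD(1)[OF x]] S.pure_closed DD(2)[OF x] D_mult[OF x] D_gen[OF x y]
        S.prim_closed S.UUU.AB.T'.A.r_distr S.prim_mult_pure S.pure_l(2) S.pure_r(2) S.UUU.AB.T'.M.a_ac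
        del: id_apply)
qed

text \<open>Along the letters of a word both sides obey the same Leibniz recursion with primitive
  factors, by \<open>DD_prim\<close>; on the empty word both vanish.\<close>

lemma D_coderivation:
  assumes x: "x \<in> carrier L" and s: "s \<in> carrier S"
  shows "S.\<Delta> (D x s) = DD x (S.\<Delta> s)"
proof (rule S.lin_hom_U_eq[OF lin_hom_comp[OF D_lin[OF x] S.comult_lin] lin_hom_comp[OF S.comult_lin DD(1)[OF x]]
      S.UUU.AB.module_T _ s])
  fix w assume "w \<in> S.words"
  then show "S.\<Delta> (D x (sw w)) = DD x (S.\<Delta> (sw w))"
  proof (induct w)
    case Nil
    have "spure \<one>\<^bsub>S\<^esub> \<zero>\<^bsub>S\<^esub> = \<zero>\<^bsub>SS\<^esub>" "spure \<zero>\<^bsub>S\<^esub> \<one>\<^bsub>S\<^esub> = \<zero>\<^bsub>SS\<^esub>"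
      using lin_hom_zero[OF bilin_mapD(3)[OF S.UUU.AB.pure_bilin] S.U.module_axioms' S.UUU.AB.module_T]
        lin_hom_zero[OF bilin_mapD(1)[OF S.UUU.AB.pure_bilin] S.U.module_axioms' S.UUU.AB.module_T]
      by simp_all
    then show ?case
      unfolding S.comult_Nil DD(2)[OF x S.U.A.one_closed S.U.A.one_closed]
      using lin_hom_zero[OF S.comult_lin S.U.module_axioms' S.UUU.AB.module_T]
      by (simp add: D_one[OF x])
  next
    case (Cons y w)
    then have y: "y \<in> carrier L" and w: "w \<in> words" by auto
    have IH: "S.\<Delta> (D x (sw w)) = DD x (S.\<Delta> (sw w))" by (rule Cons)
    note c = sgen_closed[OF y] sw_closed[OF w] sgen_closed[OF circ_closed[OF y x]] D_closed[OF x sw_closed[OF w]]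
    note \<Delta>D = lin_homD(2)[OF S.comult_lin] alg_homD(3)[OF S.comult_alg_hom]
    have "S.\<Delta> (D x (sw (y # w)))
      = S.prim (\<sigma> y) \<otimes>\<^bsub>SS\<^esub> S.\<Delta> (D x (sw w)) \<oplus>\<^bsub>SS\<^esub> S.prim (\<sigma> (y \<bullet> x)) \<otimes>\<^bsub>SS\<^esub> S.\<Delta> (sw w)"
      using c by (simp add: D_mult[OF x] D_gen[OF x y] \<Delta>D S.comult_gen circ_closed x y)
    also have "\<dots> = DD x (S.prim (\<sigma> y) \<otimes>\<^bsub>SS\<^esub> S.\<Delta> (sw w))"
      unfolding IH by (rule DD_prim[OF x y lin_homD(1)[OF S.comult_lin c(2)], symmetric])
    also have "S.prim (\<sigma> y) \<otimes>\<^bsub>SS\<^esub> S.\<Delta> (sw w) = S.\<Delta> (sw (y # w))"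
      using S.comult_Cons[of w y] w y by simp
    finally show ?case .
  qed
qed

text \<open>On a pure tensor the new letter enters one leg at a time, and there the recursion of
  \<open>\<Psi>\<close> applies. The two legs together give multiplication by the primitive element
  plus \<open>DD x\<close>.\<close>

lemma PP_prim:
  assumes x: "x \<in> carrier L" and t: "t \<in> carrier UU"
  shows "PP (t \<otimes>\<^bsub>UU\<^esub> prim (\<iota> x)) = PP t \<otimes>\<^bsub>SS\<^esub> S.prim (\<sigma> x) \<oplus>\<^bsub>SS\<^esub> DD x (PP t)"
proof (rule UUU.AB.tensor_hom_eq[OF _ _ S.UUU.AB.module_T _ t])
  note g = gen_closed[OF x] and sg = sgen_closed[OF x]
  show "(\<lambda>t. PP (t \<otimes>\<^bsub>UU\<^esub> prim (\<iota> x))) \<in> lin_hom R UU SS"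
    by (rule lin_hom_comp[OF bilin_mapD(1)[OF UUU.AB.T'.mult_bilin prim_closed[OF g]] PP(1)])
  show "(\<lambda>t. PP t \<otimes>\<^bsub>SS\<^esub> S.prim (\<sigma> x) \<oplus>\<^bsub>SS\<^esub> DD x (PP t)) \<in> lin_hom R UU SS"
    by (rule lin_hom_addI[OF lin_hom_comp[OF PP(1) bilin_mapD(1)[OF S.UUU.AB.T'.mult_bilin S.prim_closed[OF sg]]]
          lin_hom_comp[OF PP(1) DD(1)[OF x]] S.UUU.AB.module_T])
  fix a b assume a: "a \<in> carrier U" and b: "b \<in> carrier U"
  note p = Psi_closed[OF a] Psi_closed[OF b]
  note d = p[THEN D_closed[OF x]]
  show "PP (pure a b \<otimes>\<^bsub>UU\<^esub> prim (\<iota> x)) = PP (pure a b) \<otimes>\<^bsub>SS\<^esub> S.prim (\<sigma> x) \<oplus>\<^bsub>SS\<^esub> DD x (PP (pure a b))"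
    unfolding prim_mult_pure(2)[OF g a b] PP(2)[OF a b] S.prim_mult_pure(2)[OF sg p] DD(2)[OF x p]
    using a b g sg p d x
    by (simp add: lin_homD(2)[OF PP(1)] PP(2) pure_closed S.pure_closed Psi_mult_gen S.pure_l(2) S.pure_r(2)
        S.UUU.AB.T'.M.a_ac)
qed

text \<open>Appending a letter produces a product and a derivation on the side of Sym. The coproduct
  respects the first as an algebra map and the second by \<open>D_coderivation\<close>, and
  \<open>PP_prim\<close> shows the same recursion on the other side.\<close>

lemma Psi_comult:
  assumes u: "u \<in> carrier U"
  shows "S.\<Delta> (\<Psi> u) = PP (\<Delta> u)"
proof (rule lin_hom_U_eq[OF lin_hom_comp[OF Psi_lin S.comult_lin] lin_hom_comp[OF comult_lin PP(1)]
      S.UUU.AB.module_T _ u])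
  fix w assume "w \<in> words"
  then show "S.\<Delta> (\<Psi> (uw w)) = PP (\<Delta> (uw w))"
  proof (induct w rule: rev_induct)
    case Nil
    show ?case unfolding comult_Nil using S.comult_Nil by (simp add: Psi_one PP(2))
  next
    case (snoc x w)
    then have x: "x \<in> carrier L" and w: "w \<in> words" by auto
    note c = Psi_closed[OF uw_closed[OF w]] sgen_closed[OF x]
    have "S.\<Delta> (\<Psi> (uw (w @ [x]))) = S.\<Delta> (\<Psi> (uw w)) \<otimes>\<^bsub>SS\<^esub> S.prim (\<sigma> x) \<oplus>\<^bsub>SS\<^esub> DD x (S.\<Delta> (\<Psi> (uw w)))"
      unfolding Psi_snoc[OF w x] D_coderivation[OF x c(1), symmetric]
      using c D_closed[OF x c(1)] x
      by (simp add: lin_homD(2)[OF S.comult_lin] alg_homD(3)[OF S.comult_alg_hom] S.comult_gen)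
    also have "\<dots> = PP (\<Delta> (uw w) \<otimes>\<^bsub>UU\<^esub> prim (\<iota> x))"
      using snoc PP_prim[OF x lin_homD(1)[OF comult_lin uw_closed[OF w]]] by simp
    finally show ?case unfolding comult_snoc[OF w x] .
  qed
qed

text \<open>\<open>D x\<close> kills 1, and on a nonempty word each Leibniz summand contains a
  generator as a factor, where the counit vanishes.\<close>

lemma counit_D:
  assumes x: "x \<in> carrier L" and s: "s \<in> carrier S"
  shows "S.\<epsilon> (D x s) = \<zero>\<^bsub>R\<^esub>"
proof -
  have K: "module R (ground_alg R)" using assoc_alg_ground[OF R.is_cring] by (simp add: assoc_alg_def)
  have z: "(\<lambda>s. \<zero>\<^bsub>R\<^esub>) \<in> lin_hom R S (ground_alg R)" by (intro lin_homI) auto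
  show ?thesis
  proof (rule S.lin_hom_U_eq[OF lin_hom_comp[OF D_lin[OF x] S.counit_lin] z K _ s])
    fix w assume "w \<in> S.words"
    then show "S.\<epsilon> (D x (sw w)) = \<zero>\<^bsub>R\<^esub>"
    proof (cases w)
      case Nil
      then show ?thesis
        using lin_hom_zero[OF S.counit_lin S.U.module_axioms' K] by (simp add: D_one[OF x])
    next
      case (Cons y v)
      with \<open>w \<in> S.words\<close> have y: "y \<in> carrier L" and v: "v \<in> words" by auto
      note c = sgen_closed[OF y] sw_closed[OF v] sgen_closed[OF circ_closed[OF y x]] D_closed[OF x sw_closed[OF v]]
      show ?thesis
        using Cons c lin_homD(2)[OF S.counit_lin]
        by (simp add: D_mult[OF x] D_gen[OF x y] S.counit_mult S.counit_gen S.counit_closed circ_closed x y)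
    qed
  qed
qed

text \<open>On a nonempty word both sides vanish: the product with \<sigma> x contains a generator,
  and the remaining term is covered by \<open>counit_D\<close>.\<close>

lemma Psi_counit:
  assumes u: "u \<in> carrier U"
  shows "S.\<epsilon> (\<Psi> u) = \<epsilon> u"
proof -
  have K: "module R (ground_alg R)" using assoc_alg_ground[OF R.is_cring] by (simp add: assoc_alg_def)
  show ?thesis
  proof (rule lin_hom_U_eq[OF lin_hom_comp[OF Psi_lin S.counit_lin] counit_lin K _ u])
    fix w assume w: "w \<in> words"
    show "S.\<epsilon> (\<Psi> (uw w)) = \<epsilon> (uw w)"
    proof (cases w rule: rev_cases)
      case Nil
      then show ?thesis by (simp add: Psi_one counit_one S.counit_one)
    next
      case (snoc v x)
      with w have x: "x \<in> carrier L" and v: "v \<in> words" by auto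
      note c = Psi_closed[OF uw_closed[OF v]] sgen_closed[OF x]
      show ?thesis
        unfolding snoc counit_snoc[OF v x] Psi_snoc[OF v x]
        using c D_closed[OF x c(1)] x lin_homD(2)[OF S.counit_lin]
        by (simp add: S.counit_mult S.counit_gen S.counit_closed counit_D[OF x])
    qed
  qed
qed

section \<open>The inverse of \<open>\<Psi>\<close> as the required lift\<close>

definition Phi (\<open>\<Phi>\<close>) where
  "\<Phi> = inv_into (carrier U) \<Psi>"

lemma Phi_Psi: "u \<in> carrier U \<Longrightarrow> \<Phi> (\<Psi> u) = u"
  unfolding Phi_def by (rule inv_into_f_f[OF Psi_inj])

lemma Psi_Phi: "s \<in> carrier S \<Longrightarrow> \<Psi> (\<Phi> s) = s"
  unfolding Phi_def using Psi_surj by (intro f_inv_into_f) simp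

lemma Phi_closed: "s \<in> carrier S \<Longrightarrow> \<Phi> s \<in> carrier U"
  unfolding Phi_def using Psi_surj by (intro inv_into_into) simp

lemma Phi_eqI: "u \<in> carrier U \<Longrightarrow> \<Psi> u = s \<Longrightarrow> \<Phi> s = u"
  using Phi_Psi by blast

lemma Phi_lin: "\<Phi> \<in> lin_hom R S U"
  by (intro lin_homI Phi_closed Phi_eqI; simp add: Phi_closed Psi_Phi lin_homD[OF Psi_lin])

lemma Phi_image: "\<Phi> ` SFil n = Fil n"
proof -
  have "\<Phi> ` \<Psi> ` Fil n = Fil n" using Phi_Psi FilD(1) by (force simp: image_image)
  then show ?thesis by (simp only: Psi_image)
qed

lemma Phi_SP: "s \<in> SF.P n \<Longrightarrow> \<Phi> s \<in> P n"
  using lin_hom_zero[OF Phi_lin S.U.module_axioms' U.module_axioms'] Phi_image by (cases n) auto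

lemma Phi_bij: "bij_betw \<Phi> (carrier S) (carrier U)"
  by (rule bij_betwI[of _ _ _ \<Psi>]) (auto simp: Phi_closed Psi_closed Phi_Psi Psi_Phi)

text \<open>Apply \<open>\<Phi>\<close> in both legs to \<open>Psi_comult\<close>; by functoriality
  of the tensor product, \<open>\<Phi>\<close> and \<open>\<Psi>\<close> cancel leg by leg.\<close>

lemma Phi_comult:
  assumes s: "s \<in> carrier S"
  shows "\<Delta> (\<Phi> s) = tensor_map R U U \<Phi> \<Phi> (S.\<Delta> s)"
proof -
  note m = U.module_axioms' S.U.module_axioms'
  note u = Phi_closed[OF s]
  note t = lin_homD(1)[OF comult_lin u]
  have "tensor_map R U U \<Phi> \<Phi> (S.\<Delta> s) = tensor_map R U U \<Phi> \<Phi> (PP (\<Delta> (\<Phi> s)))"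
    using Psi_comult[OF u] Psi_Phi[OF s] by simp
  also have "\<dots> = tensor_map R U U (\<lambda>x. \<Phi> (\<Psi> x)) (\<lambda>x. \<Phi> (\<Psi> x)) (\<Delta> (\<Phi> s))"
    by (rule tensor_map_comp[OF m(1) m(1) m(2) m(2) m(1) m(1) Psi_lin Psi_lin Phi_lin Phi_lin t])
  also have "\<dots> = \<Delta> (\<Phi> s)"
    by (rule tensor_map_id[OF m(1) m(1) Phi_Psi Phi_Psi t])
  finally show ?thesis ..
qed

lemma Phi_coalgebra_iso:
  "filtered_coalgebra_iso R (sym_alg R L) (sym_comult R L) (sym_counit R L) (sym_filtration R L)
     U \<Delta> \<epsilon> Fil \<Phi>"
  unfolding filtered_coalgebra_iso_def sym_abelianize
proof (intro conjI ballI allI)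
  show "\<epsilon> (\<Phi> s) = S.\<epsilon> s" if "s \<in> carrier S" for s
    using Psi_counit[OF Phi_closed[OF that]] Psi_Phi[OF that] by simp
qed (intro S.filtered_coalgebra_U filtered_coalgebra_U Phi_lin Phi_bij Phi_comult Phi_image; assumption)+

lemma sym_power_eq: "sym_power R L n = submodule_span R S (sw ` {w \<in> words. length w = n})"
proof -
  have "sym_power R L n = (+>\<^bsub>S.T\<^esub>) S.I ` tensor_power R (abelianize L) n"
    unfolding sym_power_def sym_ideal_abelianize tensor_alg_abelianize tensor_power_def word_tensor_abelianize
    by simp
  also have "\<dots> = submodule_span R S (sw ` {w \<in> S.words. length w = n})"
    unfolding S.tensor_power_eq by (rule S.proj_image_wt_span) auto
  finally show ?thesis by simp
qed

lemma Phi_lifts: "lifts_canonical_map R L \<Phi>"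
  unfolding lifts_canonical_map_def sym_abelianize
proof (intro allI ballI)
  fix n s assume "s \<in> sym_power R L n"
  then have s: "s \<in> submodule_span R S (sw ` {w \<in> words. length w = n})" by (simp add: sym_power_eq)
  have "s \<in> SFil n"
    using s span_mono[of "sw ` {w \<in> words. length w = n}" "sw ` {w \<in> words. length w \<le> n}" R S]
    unfolding S.env_filtration_eq by auto
  then have sc: "s \<in> carrier S" and u: "\<Phi> s \<in> Fil n"
    unfolding Phi_image[symmetric] using S.FilD(1) by blast+
  show "gr_map U Fil \<Phi> (gr_class S SFil n s) = can s"
  proof
    fix m
    show "gr_map U Fil \<Phi> (gr_class S SFil n s) m = can s m"
    proof (cases "m = n")
      case True
      \<comment> \<open>In degree \<open>n\<close> the union is over equal cosets because
        \<open>\<Phi>\<close> maps the preceding piece of Sym into that of U. Its value is then read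
        off from \<open>can_Psi_coeff\<close> at \<open>\<Phi> s\<close>.\<close>
      have "P n +>\<^bsub>U\<^esub> \<Phi> x = P n +>\<^bsub>U\<^esub> \<Phi> s" if x: "x \<in> SF.P n +>\<^bsub>S\<^esub> s" for x
      proof -
        have x': "x \<in> carrier S" "x \<ominus>\<^bsub>S\<^esub> s \<in> SF.P n"
          using SF.Q.mem_projD[OF x sc] SF.P_coset_eq_iff[of x s n] sc by blast+
        have "\<Phi> x \<ominus>\<^bsub>U\<^esub> \<Phi> s \<in> P n"
          using Phi_SP[OF x'(2)] lin_hom_minus[OF Phi_lin S.U.module_axioms' U.module_axioms' x'(1) sc] by simp
        then show ?thesis using P_coset_eq_iff Phi_closed x'(1) sc by blast
      qed
      then have "(\<Union>x\<in>SF.P n +>\<^bsub>S\<^esub> s. P n +>\<^bsub>U\<^esub> \<Phi> x) = P n +>\<^bsub>U\<^esub> \<Phi> s"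
        by (intro UN_constant_eq[OF SF.Q.proj_self[OF sc]] ballI)
      also have "\<dots> = can s n" using can_Psi_coeff[OF u] Psi_Phi[OF sc] by simp
      finally show ?thesis using True by (simp add: gr_map_def gr_class_def)
    next
      case False
      \<comment> \<open>Outside degree \<open>n\<close> the class of \<open>s\<close> is the trivial
        coset, and by homogeneity of \<open>s\<close> the canonical map has a trivial component
        there as well.\<close>
      have "P m +>\<^bsub>U\<^esub> \<Phi> x = P m" if "x \<in> SF.P m" for x
        using Phi_SP[OF that] Q.proj_zero_iff PD(1) by blast
      then have "(\<Union>x\<in>SF.P m. P m +>\<^bsub>U\<^esub> \<Phi> x) = P m"
        by (intro UN_constant_eq[OF SF.PD(2)] ballI)
      also have "\<dots> = can s m"
        by (rule can_coeff_zero[symmetric, OF _ s]) (use False in auto)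
      finally show ?thesis using False by (simp add: gr_map_def gr_class_def)
    qed
  qed
qed

end

section \<open>Passage from a pre-Lie algebra to its Lie algebra\<close>

lemma assoc_lie_simps [simp]:
  "carrier (assoc_lie G) = carrier G" "add (assoc_lie G) = add G" "zero (assoc_lie G) = zero G"
  "smult (assoc_lie G) = smult G" "mult (assoc_lie G) = (\<lambda>x y. (x \<otimes>\<^bsub>G\<^esub> y) \<ominus>\<^bsub>G\<^esub> (y \<otimes>\<^bsub>G\<^esub> x))"
  by (simp_all add: assoc_lie_def)

lemma assoc_lie_minus: "x \<ominus>\<^bsub>assoc_lie G\<^esub> y = x \<ominus>\<^bsub>G\<^esub> y"
  by (simp add: a_minus_def a_inv_def m_inv_def)

text \<open>\<open>assoc_lie\<close> overwrites the product slot with the bracket, so the original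
  product is handed over as the separate operation of the locale.\<close>

lemma prelie_env_assoc_lie:
  assumes "prelie_algebra R G"
  shows "prelie_env R (assoc_lie G) (mult G)"
proof -
  interpret G: prelie_algebra R G by fact
  have m: "module R (assoc_lie G)"
    by (intro moduleI abelian_groupI)
      (auto simp: G.R.is_cring G.smult_l_distr G.smult_r_distr G.smult_assoc1 G.M.a_ac
        intro: G.M.l_neg bexI[of _ "\<ominus>\<^bsub>G\<^esub> _"])
  have b: "bracket_module R (assoc_lie G)"
    by (intro bracket_module.intro m bracket_module_axioms.intro)
      (simp add: G.prod_closed G.m_minus_closed)
  show ?thesis
    by (intro prelie_env.intro sym_env.intro b bracket_module.bracket_module_abelianize[OF b] prelie_env_axioms.intro
        bilin_mapI lin_homI)
      (simp_all add: assoc_lie_minus G.prod_closed G.prod_l_distr G.prod_r_distr G.prod_smult_l G.prod_smult_r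
        G.prelie_identity)
qed

theorem corollary1p3p1:
  fixes R :: "('k, 'r) ring_scheme" and G :: "('k, 'g, 'm) module_scheme"
  assumes "prelie_algebra R G"
  shows "(filtered_hopf_algebra R (env_alg R (assoc_lie G))
            (env_comult R (assoc_lie G)) (env_counit R (assoc_lie G))
            (env_filtration R (assoc_lie G)) \<and>
          canonical_map R (assoc_lie G)
            \<in> alg_iso R (sym_alg R (assoc_lie G)) (gr_env R (assoc_lie G))) \<and>
         (\<exists>\<phi>. filtered_coalgebra_iso R
                (sym_alg R (assoc_lie G)) (sym_comult R (assoc_lie G))
                (sym_counit R (assoc_lie G)) (sym_filtration R (assoc_lie G))
                (env_alg R (assoc_lie G)) (env_comult R (assoc_lie G))
                (env_counit R (assoc_lie G)) (env_filtration R (assoc_lie G)) \<phi> \<and>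
              lifts_canonical_map R (assoc_lie G) \<phi>)"
proof -
  interpret prelie_env R "assoc_lie G" "mult G"
    by (rule prelie_env_assoc_lie[OF assms])
  show ?thesis
    using filtered_hopf_algebra_U can_alg_iso Phi_coalgebra_iso Phi_lifts by blast
qed

end
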